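(* Let $p\in\{2,3\}$. There exists a constant $C$, independent of the interface location, such that $$a_h(u,v)\le C\,\|u\|_h\,\|v\|_h\qquad\text{for all }u,v\in S_h^p(\Omega).$$
   Context: Setting. $\Omega\subset\mathbb R^2$ is a bounded open polygonal domain, separated by a closed, regular, simple $C^2$ interface curve $\Gamma$ into $\Omega^+,\Omega^-$, with $\overline\Omega=\overline{\Omega^+\cup\Omega^-\cup\Gamma}$. $\beta=\beta^\pm>0$ (constants) on $\Omega^\pm$. $\mathcal T_h$ is a shape-regular triangular mesh of $\Omega$, $h=\max_Th_T$, $h_T=\operatorname{diam}T$. Assumptions: for every edge $e$, $\Gamma\cap e$ is at most one isolated point unless $e\subset\Gamma$; for every element $K$, $\Gamma$ meets $\partial K$ on at most two distinct edges (vertex intersections allowed; two vertex intersections are regarded as lying on two distinct edges); $h<r/2$, where $r>0$ is such that the segments of length $2r$ centered at $X\in\Gamma$ and perpendicular to $\Gamma$ are pairwise disjoint for distinct $X\in\Gamma$. "Independent of the interface location" means that the constant can be chosen uniformly over all interfaces admissible in this sense. $\mathcal T_h^i=\{T:T\cap\Gamma\neq\emptyset\}$ (interface elements), $\mathcal T_h^n=\mathcal T_h\setminus\mathcal T_h^i$; $T^\pm=T\cap\Omega^\pm$, $\Gamma_T=\Gamma\cap T$. $\mathcal E_h$: all edges; $\mathcal E_h^i$: interface edges (those cut by $\Gamma$), $\mathcal E_h^n=\mathcal E_h\setminus\mathcal E_h^i$; a ring ($\mathring{\mathcal E}_h,\mathring{\mathcal E}_h^i,\mathring{\mathcal E}_h^n$)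 denotes restriction to interior edges; $\mathcal F_h^i$: edges of interface elements. For $e\in\mathcal E_h^i$, $e^\pm=e\cap\Omega^\pm$. On an interior edge $e$ shared by $T_e^1,T_e^2$: $[\![w]\!]=w|_{T_e^1}-w|_{T_e^2}$, $\{\!\{w\}\!\}=\frac12(w|_{T_e^1}+w|_{T_e^2})$, and $n$ is the unit normal pointing from $T_e^1$ to $T_e^2$; on $\Gamma_T$, $[\![w]\!]=w^+-w^-$ and $n$ is the unit normal to $\Gamma$. $\partial_nv=\sum_in_i\partial_iv$, $\partial_{nn}v=\sum_{i,j}n_in_j\partial_{ij}v$. In penalty terms, $\{\!\{\beta\}\!\}=(\beta^++\beta^-)/2$. All derivatives are taken piecewise (on each $T\in\mathcal T_h^n$ and each $T^\pm$, $T\in\mathcal T_h^i$), and $\beta\|\nabla^2v\|^2_{L^2(T)}$ means $\int_T\beta|\nabla^2v|^2dX$. IFE space. $\{A_i\}_{i\in\mathcal I_p}$ are the degree-$p$ Lagrange nodes of $T$, $\psi^p_{i,T}\in\mathcal P_p(T)$ the Lagrange shape functions. For $T\in\mathcal T_h^n$, $S_h^p(T)=\mathcal P_p(T)$. For $T\in\mathcal T_h^i$, split $\mathcal I_p=\mathcal I_p^+\sqcup\mathcal I_p^-$ according to $A_i\in T^\pm$ (nodes on $\Gamma$ assigned to one side), and in $\mathcal P_p(T)\times\mathcal P_p(T)$ set $\xi_i=(\psi^p_{i,T},0),\ \eta_i=(0,\psi^p_{i,T})$ if $i\in\mathcal I_p^+$, and $\xi_i=(0,\psi^p_{i,T}),\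 \eta_i=(\psi^p_{i,T},0)$ if $i\in\mathcal I_p^-$. With $\lambda>1$, $T_\lambda$ the dilation of $T$ by $\lambda$ about its barycenter, $\Gamma_T^\lambda=T_\lambda\cap\Gamma$, weights $\omega_j>0$, polynomials extended to $\mathbb R^2$, $[\![Du]\!]=Du_1-Du_2$, $[\![\beta Du]\!]=\beta^+Du_1-\beta^-Du_2$ for $u=(u_1,u_2)$, and $\partial_{ntt}v=\sum n_it_jt_k\partial_{ijk}v$ ($n,t$ unit normal and tangent to $\Gamma$), let $$\mathcal J(u,v)=\int_{\Gamma_T^\lambda}\big(\omega_0[\![u]\!][\![v]\!]+\omega_1h^2[\![\partial_nu]\!][\![\partial_nv]\!]+\omega_2h^4[\![\beta\partial_{nn}u]\!][\![\beta\partial_{nn}v]\!]+\omega_3h^6[\![\beta(\partial_n\Delta u+\partial_{ntt}u)]\!][\![\beta(\partial_n\Delta v+\partial_{ntt}v)]\!]\big)ds.$$ For $p\in\{2,3\}$ and each $j\in\mathcal I_p$ there is a unique $\varphi_j=\xi_j+\sum_ic_i\eta_i$ with $\mathcal J(\varphi_j,\eta_i)=0$ for all $i$; $\phi^p_{j,T}$ is the function equal to the first component of $\varphi_j$ on $T^+$ and the second on $T^-$, and $S_h^p(T)=\operatorname{span}\{\phi^p_{j,T}:j\in\mathcal I_p\}$. The global space $S_h^p(\Omega)$ (also written $S_h^p$) consists of all $u\in L^2(\Omega)$ such that $u|_T\in S_h^p(T)$ for all $T$, $u$ is continuous on every $e\in\mathcal E_h^n$, $u$ is continuous at all Lagrange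 nodes, and $u|_{\partial\Omega}=0$. Bilinear form. With penalty parameters $\sigma_u,\sigma_F,\sigma_n>0$, $a_h=A_h+J_{h,u}+J_{h,n}$, where $A_h(u,v)=\sum_{T\in\mathcal T_h}\int_T\beta\nabla^2u:\nabla^2v\,dX$, $$J_{h,u}(u,v)=-\sum_{e\in\mathring{\mathcal E}_h}\int_e\{\!\{\beta\partial_{nn}u\}\!\}[\![\partial_nv]\!]ds-\sum_{e\in\mathring{\mathcal E}_h}\int_e\{\!\{\beta\partial_{nn}v\}\!\}[\![\partial_nu]\!]ds+\sum_{e\in\mathring{\mathcal E}_h^n}\frac{\sigma_u\beta}{|e|}\int_e[\![\partial_nu]\!][\![\partial_nv]\!]ds$$ $$+\sum_{e\in\mathring{\mathcal E}_h^i}\sum_{s=\pm}\frac{\sigma_u\beta^s}{|e^s|}\int_{e^s}[\![\partial_nu]\!][\![\partial_nv]\!]ds+\sum_{T\in\mathcal T_h^i}\frac{\sigma_u\{\!\{\beta\}\!\}}{h_T}\int_{\Gamma_T}[\![\partial_nu]\!][\![\partial_nv]\!]ds,$$ $$J_{h,n}(u,v)=\sum_{e\in\mathring{\mathcal E}_h^i}\sum_{s=\pm}\sigma_F|e^s|\beta^s\int_{e^s}[\![\partial_{nn}u]\!][\![\partial_{nn}v]\!]ds+\sum_{e\in\mathring{\mathcal E}_h^n\cap\mathcal F_h^i}\sigma_F|e|\beta\int_e[\![\partial_{nn}u]\!][\![\partial_{nn}v]\!]ds$$ $$+\sum_{e\in\mathring{\mathcal E}_h^i}\frac{\sigma_n\{\!\{\beta\}\!\}}{|e|^3}\int_e[\![u]\!][\![v]\!]ds+\sum_{T\in\mathcal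 T_h^i}\frac{\sigma_n\{\!\{\beta\}\!\}}{h_T^3}\int_{\Gamma_T}[\![u]\!][\![v]\!]ds.$$ Norm. $$\|v\|_h^2=\sum_{T\in\mathcal T_h}\beta\|\nabla^2v\|^2_{L^2(T)}+\sum_{e\in\mathring{\mathcal E}_h^n}\frac{\sigma_u\beta}{|e|}\|[\![\partial_nv]\!]\|^2_{L^2(e)}+\sum_{T\in\mathcal T_h^i}\frac{\sigma_u\{\!\{\beta\}\!\}}{h_T}\|[\![\partial_nv]\!]\|^2_{L^2(\Gamma_T)}+\sum_{e\in\mathring{\mathcal E}_h^i}\sum_{s=\pm}\frac{\sigma_u\beta^s}{|e^s|}\|[\![\partial_nv]\!]\|^2_{L^2(e^s)}$$ $$+\sum_{e\in\mathring{\mathcal E}_h^n\cap\mathcal F_h^i}\sigma_F|e|\beta\|[\![\partial_{nn}v]\!]\|^2_{L^2(e)}+\sum_{e\in\mathring{\mathcal E}_h^i}\sum_{s=\pm}\sigma_F|e^s|\beta^s\|[\![\partial_{nn}v]\!]\|^2_{L^2(e^s)}+\sum_{e\in\mathring{\mathcal E}_h^i}\frac{\sigma_n\{\!\{\beta\}\!\}}{|e|^3}\|[\![v]\!]\|^2_{L^2(e)}+\sum_{T\in\mathcal T_h^i}\frac{\sigma_n\{\!\{\beta\}\!\}}{h_T^3}\|[\![v]\!]\|^2_{L^2(\Gamma_T)}.$$ *)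

theory Defs
  imports "HOL-Analysis.Analysis"
begin

text \<open>Piecewise partial derivatives are taken of the polynomial pieces, which are functions on the
  whole plane.\<close>

definition pd :: "2 \<Rightarrow> (real^2 \<Rightarrow> real) \<Rightarrow> real^2 \<Rightarrow> real" where
  "pd i q x = deriv (\<lambda>t. q (x + t *\<^sub>R axis i 1)) 0"

definition d_n :: "real^2 \<Rightarrow> (real^2 \<Rightarrow> real) \<Rightarrow> real^2 \<Rightarrow> real" where
  "d_n n q x = (\<Sum>i\<in>UNIV. n $ i * pd i q x)"

definition d_nn :: "real^2 \<Rightarrow> (real^2 \<Rightarrow> real) \<Rightarrow> real^2 \<Rightarrow> real" where
  "d_nn n q x = (\<Sum>i\<in>UNIV. \<Sum>j\<in>UNIV. n $ i * n $ j * pd i (pd j q) x)"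

definition d_ntt :: "real^2 \<Rightarrow> real^2 \<Rightarrow> (real^2 \<Rightarrow> real) \<Rightarrow> real^2 \<Rightarrow> real" where
  "d_ntt n t q x =
     (\<Sum>i\<in>UNIV. \<Sum>j\<in>UNIV. \<Sum>k\<in>UNIV. n $ i * t $ j * t $ k * pd i (pd j (pd k q)) x)"

definition laplacian :: "(real^2 \<Rightarrow> real) \<Rightarrow> real^2 \<Rightarrow> real" where
  "laplacian q x = (\<Sum>i\<in>UNIV. pd i (pd i q) x)"

definition hess_inner :: "(real^2 \<Rightarrow> real) \<Rightarrow> (real^2 \<Rightarrow> real) \<Rightarrow> real^2 \<Rightarrow> real" where
  "hess_inner q r x = (\<Sum>i\<in>UNIV. \<Sum>j\<in>UNIV. pd i (pd j q) x * pd i (pd j r) x)"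

definition polys :: "nat \<Rightarrow> (real^2 \<Rightarrow> real) set" where
  "polys p = {q. \<exists>c. \<forall>x. q x = (\<Sum>i\<le>p. \<Sum>j\<le>p - i. c i j * (x $ 1) ^ i * (x $ 2) ^ j)}"


section \<open>Domain, mesh and interface\<close>

text \<open>The condition \<open>interior (closure \<Omega>) = \<Omega>\<close> excludes slits and punctures.\<close>

definition polygonal_domain :: "(real^2) set \<Rightarrow> bool" where
  "polygonal_domain \<Omega> \<longleftrightarrow> open \<Omega> \<and> bounded \<Omega> \<and> connected \<Omega> \<and> \<Omega> \<noteq> {} \<and>
     interior (closure \<Omega>) = \<Omega> \<and>
     (\<exists>S. finite S \<and> frontier \<Omega> = (\<Union>(a, b)\<in>S. closed_segment a b))"

text \<open>Elements and edges are encoded by their sets of vertices. The closed triangle, resp. the closed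
  edge, is the convex hull.\<close>

type_synonym cell = "(real^2) set"

definition edges_of :: "cell \<Rightarrow> cell set" where
  "edges_of V = {E. E \<subseteq> V \<and> card E = 2}"

definition triangulation :: "(real^2) set \<Rightarrow> cell set \<Rightarrow> bool" where
  "triangulation \<Omega> M \<longleftrightarrow> finite M \<and>
     (\<forall>V\<in>M. card V = 3 \<and> \<not> affine_dependent V) \<and>
     (\<Union>V\<in>M. convex hull V) = closure \<Omega> \<and>
     (\<forall>V\<in>M. \<forall>W\<in>M. convex hull V \<inter> convex hull W = convex hull (V \<inter> W))"

definition shape_regular :: "real \<Rightarrow> cell set \<Rightarrow> bool" where
  "shape_regular \<kappa> M \<longleftrightarrow>
     (\<forall>V\<in>M. \<exists>c. \<exists>\<rho>>0. cball c \<rho> \<subseteq> convex hull V \<and> diameter (convex hull V) \<le> \<kappa> * \<rho>)"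

definition mesh_size :: "cell set \<Rightarrow> real" where
  "mesh_size M = Max ((\<lambda>V. diameter (convex hull V)) ` M)"

text \<open>The interface is parametrized by a 1-periodic function; \<open>\<Gamma> = range g\<close>.\<close>

definition regular_simple_closed_C2 :: "(real \<Rightarrow> real^2) \<Rightarrow> bool" where
  "regular_simple_closed_C2 g \<longleftrightarrow>
     (\<exists>g' g''. (\<forall>t. (g has_vector_derivative g' t) (at t)) \<and>
               (\<forall>t. (g' has_vector_derivative g'' t) (at t)) \<and>
               continuous_on UNIV g'' \<and> (\<forall>t. g' t \<noteq> 0)) \<and>
     (\<forall>t. g (t + 1) = g t) \<and> inj_on g {0..<1}"

definition ctan :: "(real \<Rightarrow> real^2) \<Rightarrow> real \<Rightarrow> real^2" where
  "ctan g t = sgn (vector_derivative g (at t))"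

definition cnormal :: "(real \<Rightarrow> real^2) \<Rightarrow> real \<Rightarrow> real^2" where
  "cnormal g t = (\<chi> i. if i = 1 then ctan g t $ 2 else - (ctan g t $ 1))"

definition disjoint_normals :: "(real \<Rightarrow> real^2) \<Rightarrow> real \<Rightarrow> bool" where
  "disjoint_normals g r \<longleftrightarrow>
     (\<forall>s\<in>{0..<1}. \<forall>t\<in>{0..<1}. s \<noteq> t \<longrightarrow>
        closed_segment (g s - r *\<^sub>R cnormal g s) (g s + r *\<^sub>R cnormal g s) \<inter>
        closed_segment (g t - r *\<^sub>R cnormal g t) (g t + r *\<^sub>R cnormal g t) = {})"

datatype side = Pos | Neg

text \<open>Data on which the constant may depend (besides the shape-regularity constant).\<close>

record fem_data =
  dom :: "(real^2) set"
  deg :: nat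
  beta :: "side \<Rightarrow> real"
  sigma_u :: real
  sigma_F :: real
  sigma_n :: real
  omega :: "nat \<Rightarrow> real"
  lam :: real

text \<open>Data over which the constant is uniform. The component \<open>part s\<close> is \<open>\<Omega>\<^sup>s\<close>; \<open>node_side\<close> is the
  assignment of Lagrange nodes to sides, prescribed off \<open>\<Gamma>\<close> and arbitrary on \<open>\<Gamma>\<close>.\<close>

record interface_mesh =
  mesh :: "cell set"
  curve :: "real \<Rightarrow> real^2"
  part :: "side \<Rightarrow> (real^2) set"
  node_side :: "real^2 \<Rightarrow> side"

definition admissible_data :: "fem_data \<Rightarrow> bool" where
  "admissible_data Q \<longleftrightarrow> polygonal_domain (dom Q) \<and> (\<forall>s. beta Q s > 0) \<and>
     sigma_u Q > 0 \<and> sigma_F Q > 0 \<and> sigma_n Q > 0 \<and>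
     (\<forall>j\<in>{0..3}. omega Q j > 0) \<and> lam Q > 1"

definition Gam :: "interface_mesh \<Rightarrow> (real^2) set" where
  "Gam G = range (curve G)"

text \<open>In the penultimate condition, \<open>a\<close> attributes each point of \<open>\<Gamma> \<inter> \<partial>K\<close> to an edge
  containing it. Injectivity on vertices says that two vertex intersections count as lying on two
  distinct edges.\<close>

definition admissible_interface :: "fem_data \<Rightarrow> interface_mesh \<Rightarrow> bool" where
  "admissible_interface Q G \<longleftrightarrow>
     regular_simple_closed_C2 (curve G) \<and>
     Gam G \<subseteq> dom Q \<and>
     part G Pos \<noteq> part G Neg \<and>
     components (dom Q - Gam G) = {part G Pos, part G Neg} \<and>
     (\<forall>V\<in>mesh G. \<forall>E\<in>edges_of V.
        convex hull E \<subseteq> Gam G \<or> (\<exists>x. Gam G \<inter> convex hull E \<subseteq> {x})) \<and>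
     (\<forall>V\<in>mesh G. \<exists>a.
        (\<forall>x\<in>Gam G \<inter> frontier (convex hull V). a x \<in> edges_of V \<and> x \<in> convex hull (a x)) \<and>
        card (a ` (Gam G \<inter> frontier (convex hull V))) \<le> 2 \<and>
        inj_on a (Gam G \<inter> V)) \<and>
     (\<exists>r>0. disjoint_normals (curve G) r \<and> mesh_size (mesh G) < r / 2)"

definition admissible :: "real \<Rightarrow> fem_data \<Rightarrow> interface_mesh \<Rightarrow> bool" where
  "admissible \<kappa> Q G \<longleftrightarrow>
     triangulation (dom Q) (mesh G) \<and> shape_regular \<kappa> (mesh G) \<and> admissible_interface Q G \<and>
     (\<forall>s. \<forall>x\<in>part G s. node_side G x = s)"

definition iface_elems :: "interface_mesh \<Rightarrow> cell set" where
  "iface_elems G = {V \<in> mesh G. convex hull V \<inter> Gam G \<noteq> {}}"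

definition int_edges :: "interface_mesh \<Rightarrow> cell set" where
  "int_edges G = {E. \<exists>V\<in>mesh G. \<exists>W\<in>mesh G. V \<noteq> W \<and> E \<in> edges_of V \<and> E \<in> edges_of W}"

text \<open>An edge is cut by \<open>\<Gamma>\<close> if both \<open>e\<^sup>+\<close> and \<open>e\<^sup>-\<close> are nonempty. Edges that \<open>\<Gamma>\<close> merely touches at a
  vertex, and edges contained in \<open>\<Gamma>\<close>, are not cut.\<close>

definition is_cut :: "interface_mesh \<Rightarrow> cell \<Rightarrow> bool" where
  "is_cut G E \<longleftrightarrow> (\<forall>s. convex hull E \<inter> part G s \<noteq> {})"

definition int_edges_cut :: "interface_mesh \<Rightarrow> cell set" where
  "int_edges_cut G = {E \<in> int_edges G. is_cut G E}"

definition int_edges_uncut :: "interface_mesh \<Rightarrow> cell set" where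
  "int_edges_uncut G = {E \<in> int_edges G. \<not> is_cut G E}"

definition iface_elem_edges :: "interface_mesh \<Rightarrow> cell set" where
  "iface_elem_edges G = (\<Union>V\<in>iface_elems G. edges_of V)"


section \<open>Arc-length integrals\<close>

text \<open>\<open>edge_int E S f\<close> is the integral of \<open>f\<close> over \<open>e \<inter> S\<close>; it does not depend on the chosen order of
  the end points. \<open>curve_int g S f\<close> is the integral over \<open>\<Gamma> \<inter> S\<close>, with the integrand given as a
  function of the parameter.\<close>

definition edge_int :: "cell \<Rightarrow> (real^2) set \<Rightarrow> (real^2 \<Rightarrow> real) \<Rightarrow> real" where
  "edge_int E S f =
     (let (a, b) = (SOME (a, b). E = {a, b});
          x = (\<lambda>t. (1 - t) *\<^sub>R a + t *\<^sub>R b)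
      in norm (b - a) * set_lebesgue_integral lborel {t \<in> {0..1}. x t \<in> S} (\<lambda>t. f (x t)))"

definition edge_len :: "cell \<Rightarrow> (real^2) set \<Rightarrow> real" where
  "edge_len E S = edge_int E S (\<lambda>_. 1)"

definition curve_int :: "(real \<Rightarrow> real^2) \<Rightarrow> (real^2) set \<Rightarrow> (real \<Rightarrow> real) \<Rightarrow> real" where
  "curve_int g S f =
     set_lebesgue_integral lborel {t \<in> {0..1}. g t \<in> S}
       (\<lambda>t. f t * norm (vector_derivative g (at t)))"


section \<open>The immersed finite element space\<close>

definition nodes :: "nat \<Rightarrow> cell \<Rightarrow> (real^2) set" where
  "nodes p V = {(\<Sum>v\<in>V. (real (k v) / real p) *\<^sub>R v) | k::real^2 \<Rightarrow> nat. (\<Sum>v\<in>V. k v) = p}"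

definition lagrange :: "nat \<Rightarrow> cell \<Rightarrow> real^2 \<Rightarrow> real^2 \<Rightarrow> real" where
  "lagrange p V A =
     (SOME q. q \<in> polys p \<and> (\<forall>B\<in>nodes p V. q B = (if B = A then 1 else 0)))"

text \<open>A pair \<open>(u\<^sub>1, u\<^sub>2)\<close> of polynomials is a function on \<^typ>\<open>side\<close>.\<close>

type_synonym pair = "side \<Rightarrow> real^2 \<Rightarrow> real"

definition xi :: "fem_data \<Rightarrow> interface_mesh \<Rightarrow> cell \<Rightarrow> real^2 \<Rightarrow> pair" where
  "xi Q G V A s = (if s = node_side G A then lagrange (deg Q) V A else (\<lambda>_. 0))"

definition eta :: "fem_data \<Rightarrow> interface_mesh \<Rightarrow> cell \<Rightarrow> real^2 \<Rightarrow> pair" where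
  "eta Q G V A s = (if s = node_side G A then (\<lambda>_. 0) else lagrange (deg Q) V A)"

text \<open>\<open>pjump L u x\<close> is the jump of \<open>L u\<close>, and \<open>bjump b L u x\<close> that of \<open>\<beta> L u\<close>.\<close>

definition pjump :: "((real^2 \<Rightarrow> real) \<Rightarrow> real^2 \<Rightarrow> real) \<Rightarrow> pair \<Rightarrow> real^2 \<Rightarrow> real" where
  "pjump L u x = L (u Pos) x - L (u Neg) x"

definition bjump ::
    "(side \<Rightarrow> real) \<Rightarrow> ((real^2 \<Rightarrow> real) \<Rightarrow> real^2 \<Rightarrow> real) \<Rightarrow> pair \<Rightarrow> real^2 \<Rightarrow> real" where
  "bjump b L u x = b Pos * L (u Pos) x - b Neg * L (u Neg) x"

definition dilate :: "real \<Rightarrow> cell \<Rightarrow> (real^2) set" where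
  "dilate l V = (let c = (1 / 3) *\<^sub>R (\<Sum>v\<in>V. v) in (\<lambda>x. c + l *\<^sub>R (x - c)) ` (convex hull V))"

definition J_loc :: "fem_data \<Rightarrow> interface_mesh \<Rightarrow> cell \<Rightarrow> pair \<Rightarrow> pair \<Rightarrow> real" where
  "J_loc Q G V u v =
     (let g = curve G; h = mesh_size (mesh G); b = beta Q;
          D3 = (\<lambda>t q x. d_n (cnormal g t) (laplacian q) x + d_ntt (cnormal g t) (ctan g t) q x)
      in curve_int g (dilate (lam Q) V) (\<lambda>t.
           omega Q 0 * pjump id u (g t) * pjump id v (g t)
         + omega Q 1 * h ^ 2 * pjump (d_n (cnormal g t)) u (g t) * pjump (d_n (cnormal g t)) v (g t)
         + omega Q 2 * h ^ 4 * bjump b (d_nn (cnormal g t)) u (g t)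
                             * bjump b (d_nn (cnormal g t)) v (g t)
         + omega Q 3 * h ^ 6 * bjump b (D3 t) u (g t) * bjump b (D3 t) v (g t)))"

definition is_ife_shape :: "fem_data \<Rightarrow> interface_mesh \<Rightarrow> cell \<Rightarrow> real^2 \<Rightarrow> pair \<Rightarrow> bool" where
  "is_ife_shape Q G V A \<phi> \<longleftrightarrow>
     (\<exists>c. \<phi> = (\<lambda>s x. xi Q G V A s x + (\<Sum>B\<in>nodes (deg Q) V. c B * eta Q G V B s x))) \<and>
     (\<forall>B\<in>nodes (deg Q) V. J_loc Q G V \<phi> (eta Q G V B) = 0)"

text \<open>The local space as a space of pairs; on non-interface elements both components are the same
  polynomial. Since each \<open>\<phi>\<^sub>j\<close> is unique, the interface case is the span of the \<open>\<phi>\<^sub>j\<close>.\<close>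

definition local_space :: "fem_data \<Rightarrow> interface_mesh \<Rightarrow> cell \<Rightarrow> pair set" where
  "local_space Q G V =
     (if V \<in> iface_elems G
      then {w. \<exists>\<phi> a. (\<forall>A\<in>nodes (deg Q) V. is_ife_shape Q G V A (\<phi> A)) \<and>
                     w = (\<lambda>s x. \<Sum>A\<in>nodes (deg Q) V. a A * \<phi> A s x)}
      else {\<lambda>_. q | q. q \<in> polys (deg Q)})"

text \<open>Elements of the global space are representatives of \<open>L\<^sup>2\<close> classes. The piece of \<open>u\<close> on \<open>T\<close> is
  the pair of polynomials in the local space that agrees with \<open>u\<close> almost everywhere on \<open>T\<^sup>+\<close> and
  \<open>T\<^sup>-\<close>.\<close>

definition represents :: "interface_mesh \<Rightarrow> cell \<Rightarrow> (real^2 \<Rightarrow> real) \<Rightarrow> pair \<Rightarrow> bool" where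
  "represents G V u w \<longleftrightarrow>
     (\<forall>s. AE x in lebesgue. x \<in> convex hull V \<inter> part G s \<longrightarrow> u x = w s x)"

definition piece :: "fem_data \<Rightarrow> interface_mesh \<Rightarrow> (real^2 \<Rightarrow> real) \<Rightarrow> cell \<Rightarrow> pair" where
  "piece Q G u V = (SOME w. w \<in> local_space Q G V \<and> represents G V u w)"

text \<open>The side from which \<open>T\<close> approaches its boundary point \<open>x\<close>: for \<open>x \<in> \<Omega>\<^sup>s\<close> this is \<open>s\<close>; it is also
  determined at relative interior points of an edge \<open>e \<subseteq> \<Gamma>\<close> and at points of the boundary of the
  domain. It is ambiguous only where \<open>\<Gamma>\<close> crosses \<open>\<partial>T\<close>, which is irrelevant under the integrals.\<close>

definition side_at :: "interface_mesh \<Rightarrow> cell \<Rightarrow> real^2 \<Rightarrow> side" where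
  "side_at G V x = (SOME s. x \<in> closure (interior (convex hull V) \<inter> part G s))"

definition tr :: "fem_data \<Rightarrow> interface_mesh \<Rightarrow> (real^2 \<Rightarrow> real) \<Rightarrow> cell \<Rightarrow> real^2 \<Rightarrow> (real^2 \<Rightarrow> real)"
  where "tr Q G u V x = piece Q G u V (side_at G V x)"

text \<open>At a node on \<open>\<Gamma>\<close> the nodal value is that of the component on the side to which the node is
  assigned.\<close>

definition ife_space :: "fem_data \<Rightarrow> interface_mesh \<Rightarrow> (real^2 \<Rightarrow> real) set" where
  "ife_space Q G =
     {u. u \<in> borel_measurable (lebesgue_on (dom Q)) \<and>
         integrable (lebesgue_on (dom Q)) (\<lambda>x. (u x)\<^sup>2) \<and>
         (\<forall>V\<in>mesh G. \<exists>w\<in>local_space Q G V. represents G V u w) \<and>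
         (\<forall>V\<in>mesh G. \<forall>W\<in>mesh G. \<forall>E\<in>edges_of V \<inter> edges_of W. \<not> is_cut G E \<longrightarrow>
            (\<forall>x\<in>rel_interior (convex hull E). tr Q G u V x x = tr Q G u W x x)) \<and>
         (\<forall>V\<in>mesh G. \<forall>W\<in>mesh G. \<forall>A\<in>nodes (deg Q) V \<inter> nodes (deg Q) W.
            piece Q G u V (node_side G A) A = piece Q G u W (node_side G A) A) \<and>
         (\<forall>V\<in>mesh G. \<forall>E\<in>edges_of V. convex hull E \<subseteq> frontier (dom Q) \<longrightarrow>
            (\<forall>x\<in>convex hull E. tr Q G u V x x = 0))}"


section \<open>Bilinear form and norm\<close>

text \<open>A choice of the ordered pair \<open>(T\<^sub>e\<^sup>1, T\<^sub>e\<^sup>2)\<close>. Exchanging the two elements changes the sign of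
  both \<open>n\<close> and the jump, which leaves every term below unchanged.\<close>

definition neighbours :: "interface_mesh \<Rightarrow> cell \<Rightarrow> cell \<times> cell" where
  "neighbours G E =
     (SOME (V, W). V \<in> mesh G \<and> W \<in> mesh G \<and> V \<noteq> W \<and> E \<in> edges_of V \<and> E \<in> edges_of W)"

definition edge_normal :: "interface_mesh \<Rightarrow> cell \<Rightarrow> real^2" where
  "edge_normal G E =
     (THE n. norm n = 1 \<and> (\<forall>x\<in>E. \<forall>y\<in>E. n \<bullet> (x - y) = 0) \<and>
             (\<forall>x\<in>E. \<forall>c\<in>fst (neighbours G E) - E. n \<bullet> (c - x) < 0))"

definition edge_jump :: "fem_data \<Rightarrow> interface_mesh \<Rightarrow> cell \<Rightarrow>
    ((real^2 \<Rightarrow> real) \<Rightarrow> real^2 \<Rightarrow> real) \<Rightarrow> (real^2 \<Rightarrow> real) \<Rightarrow> real^2 \<Rightarrow> real" where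
  "edge_jump Q G E L u x =
     (case neighbours G E of (V, W) \<Rightarrow> L (tr Q G u V x) x - L (tr Q G u W x) x)"

definition edge_avg_beta :: "fem_data \<Rightarrow> interface_mesh \<Rightarrow> cell \<Rightarrow>
    ((real^2 \<Rightarrow> real) \<Rightarrow> real^2 \<Rightarrow> real) \<Rightarrow> (real^2 \<Rightarrow> real) \<Rightarrow> real^2 \<Rightarrow> real" where
  "edge_avg_beta Q G E L u x =
     (case neighbours G E of (V, W) \<Rightarrow>
        (beta Q (side_at G V x) * L (tr Q G u V x) x
         + beta Q (side_at G W x) * L (tr Q G u W x) x) / 2)"

definition mean_beta :: "fem_data \<Rightarrow> real" where
  "mean_beta Q = (beta Q Pos + beta Q Neg) / 2"

text \<open>The coefficient as a function; the value on \<open>\<Gamma>\<close> is only seen by edges contained in \<open>\<Gamma>\<close>.\<close>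

definition beta_at :: "fem_data \<Rightarrow> interface_mesh \<Rightarrow> real^2 \<Rightarrow> real" where
  "beta_at Q G x = (if x \<in> part G Pos then beta Q Pos
                    else if x \<in> part G Neg then beta Q Neg else mean_beta Q)"

definition A_h where
  "A_h Q G u v = (\<Sum>V\<in>mesh G. \<Sum>s\<in>{Pos, Neg}.
     set_lebesgue_integral lborel (convex hull V \<inter> part G s)
       (\<lambda>x. beta Q s * hess_inner (piece Q G u V s) (piece Q G v V s) x))"

definition consistency where
  "consistency Q G u v = (\<Sum>E\<in>int_edges G. let n = edge_normal G E in
     edge_int E UNIV (\<lambda>x. edge_avg_beta Q G E (d_nn n) u x * edge_jump Q G E (d_n n) v x))"

definition pen_dn_uncut where
  "pen_dn_uncut Q G u v = (\<Sum>E\<in>int_edges_uncut G. let n = edge_normal G E in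
     sigma_u Q / edge_len E UNIV *
     edge_int E UNIV (\<lambda>x. beta_at Q G x * edge_jump Q G E (d_n n) u x * edge_jump Q G E (d_n n) v x))"

definition pen_dn_cut where
  "pen_dn_cut Q G u v = (\<Sum>E\<in>int_edges_cut G. \<Sum>s\<in>{Pos, Neg}. let n = edge_normal G E in
     sigma_u Q * beta Q s / edge_len E (part G s) *
     edge_int E (part G s) (\<lambda>x. edge_jump Q G E (d_n n) u x * edge_jump Q G E (d_n n) v x))"

definition pen_dn_iface where
  "pen_dn_iface Q G u v = (\<Sum>V\<in>iface_elems G. let g = curve G in
     sigma_u Q * mean_beta Q / diameter (convex hull V) *
     curve_int g (convex hull V)
       (\<lambda>t. pjump (d_n (cnormal g t)) (piece Q G u V) (g t)
          * pjump (d_n (cnormal g t)) (piece Q G v V) (g t)))"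

definition pen_dnn_cut where
  "pen_dnn_cut Q G u v = (\<Sum>E\<in>int_edges_cut G. \<Sum>s\<in>{Pos, Neg}. let n = edge_normal G E in
     sigma_F Q * edge_len E (part G s) * beta Q s *
     edge_int E (part G s) (\<lambda>x. edge_jump Q G E (d_nn n) u x * edge_jump Q G E (d_nn n) v x))"

definition pen_dnn_uncut where
  "pen_dnn_uncut Q G u v = (\<Sum>E\<in>int_edges_uncut G \<inter> iface_elem_edges G. let n = edge_normal G E in
     sigma_F Q * edge_len E UNIV *
     edge_int E UNIV (\<lambda>x. beta_at Q G x * edge_jump Q G E (d_nn n) u x * edge_jump Q G E (d_nn n) v x))"

definition pen_cut where
  "pen_cut Q G u v = (\<Sum>E\<in>int_edges_cut G.
     sigma_n Q * mean_beta Q / edge_len E UNIV ^ 3 *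
     edge_int E UNIV (\<lambda>x. edge_jump Q G E id u x * edge_jump Q G E id v x))"

definition pen_iface where
  "pen_iface Q G u v = (\<Sum>V\<in>iface_elems G. let g = curve G in
     sigma_n Q * mean_beta Q / diameter (convex hull V) ^ 3 *
     curve_int g (convex hull V)
       (\<lambda>t. pjump id (piece Q G u V) (g t) * pjump id (piece Q G v V) (g t)))"

definition J_hu where
  "J_hu Q G u v = - consistency Q G u v - consistency Q G v u
     + pen_dn_uncut Q G u v + pen_dn_cut Q G u v + pen_dn_iface Q G u v"

definition J_hn where
  "J_hn Q G u v = pen_dnn_cut Q G u v + pen_dnn_uncut Q G u v + pen_cut Q G u v + pen_iface Q G u v"

definition a_h :: "fem_data \<Rightarrow> interface_mesh \<Rightarrow> (real^2 \<Rightarrow> real) \<Rightarrow> (real^2 \<Rightarrow> real) \<Rightarrow> real" where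
  "a_h Q G u v = A_h Q G u v + J_hu Q G u v + J_hn Q G u v"

text \<open>Each summand of the squared norm is the diagonal of the form of the same name.\<close>

definition norm_h :: "fem_data \<Rightarrow> interface_mesh \<Rightarrow> (real^2 \<Rightarrow> real) \<Rightarrow> real" where
  "norm_h Q G v = sqrt (A_h Q G v v
     + pen_dn_uncut Q G v v + pen_dn_iface Q G v v + pen_dn_cut Q G v v
     + pen_dnn_uncut Q G v v + pen_dnn_cut Q G v v + pen_cut Q G v v + pen_iface Q G v v)"

end

theory Submission
  imports Defs
begin

text \<open>Every term of \<open>a\<^sub>h\<close> except the consistency terms is a positive semidefinite form that also occurs
  in the norm, so it is bounded by the Cauchy-Schwarz inequality. For the consistency terms one has to
  bound \<open>|e\<^sup>s| \<integral> (\<beta> \<partial>\<^sub>n\<^sub>n u)\<^sup>2\<close> over the part \<open>e\<^sup>s\<close> of an edge. As \<open>p \<le> 3\<close>, \<open>\<partial>\<^sub>n\<^sub>n u\<close> is affine on each piece,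
  and it suffices to find in one of the two neighbouring elements a disc on the side \<open>s\<close> of \<open>\<Gamma>\<close> whose
  radius and distance from \<open>e\<^sup>s\<close> are comparable with \<open>|e\<^sup>s|\<close>, whatever the position of \<open>\<Gamma>\<close>; the trace
  from the other neighbour is then controlled by the penalised jump of \<open>\<partial>\<^sub>n\<^sub>n u\<close>. Such a disc exists
  because \<open>h < r / 2\<close>: a disc of radius \<open>r\<close> tangent to \<open>\<Gamma>\<close> contains the midpoint of \<open>e\<^sup>s\<close> and misses
  \<open>\<Gamma>\<close>, and it reaches far into the neighbour towards which its centre lies.\<close>

section \<open>Polynomials and Lagrange shape functions\<close>

text \<open>\<Gamma> may cut off an arbitrarily short part of an edge and leave slivers of elements
  beside it, so no inverse inequality at the scale of the mesh can be expected. The way out is that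
  the jump of the normal derivative is penalised with the reciprocal length of the cut part: a
  Cauchy-Schwarz inequality weighted by that length asks only for discs of the size of the part. At
  this scale \<Gamma> is harmless, because the tangent disc is at least as large as an element.
  Which neighbour receives the good disc depends on the direction of the normal of \<Gamma> and
  cannot be chosen; hence the jump of the second normal derivative in the bound. Three kinds of
  edges need a variant. If \<Gamma> touches an uncut edge in an inner point, the longer of the two
  pieces serves the whole edge. If the edge lies in \<Gamma>, its midpoint is on the curve, and the
  tangent disc is found from the normal of the edge. If the edge belongs to no interface element,
  the jump of the second normal derivative is not penalised, and both neighbours must provide a
  disc; their incircles do.\<close>

lemma polysI:
  assumes "\<And>x. q x = (\<Sum>i\<le>p. \<Sum>j\<le>p - i. c i j * (x $ 1) ^ i * (x $ 2) ^ j)"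
  shows "q \<in> polys p"
  using assms unfolding polys_def by blast

lemma polys_zero: "(\<lambda>x. 0) \<in> polys p"
  by (rule polysI[where c = "\<lambda>i j. 0"]) simp

lemma polys_add:
  assumes "q \<in> polys p" "r \<in> polys p"
  shows "(\<lambda>x. q x + r x) \<in> polys p"
proof -
  obtain c d where c: "\<And>x. q x = (\<Sum>i\<le>p. \<Sum>j\<le>p - i. c i j * (x $ 1) ^ i * (x $ 2) ^ j)"
    and d: "\<And>x. r x = (\<Sum>i\<le>p. \<Sum>j\<le>p - i. d i j * (x $ 1) ^ i * (x $ 2) ^ j)"
    using assms unfolding polys_def by blast
  show ?thesis
    by (rule polysI[where c = "\<lambda>i j. c i j + d i j"])
      (simp add: c d sum.distrib distrib_right)
qed

lemma polys_cmult:
  assumes "q \<in> polys p"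
  shows "(\<lambda>x. a * q x) \<in> polys p"
proof -
  obtain c where c: "\<And>x. q x = (\<Sum>i\<le>p. \<Sum>j\<le>p - i. c i j * (x $ 1) ^ i * (x $ 2) ^ j)"
    using assms unfolding polys_def by blast
  show ?thesis
    by (rule polysI[where c = "\<lambda>i j. a * c i j"]) (simp add: c sum_distrib_left mult.assoc)
qed

lemma polys_sum:
  assumes "\<And>i. i \<in> I \<Longrightarrow> q i \<in> polys p"
  shows "(\<lambda>x. \<Sum>i\<in>I. q i x) \<in> polys p"
  using assms
proof (induction I rule: infinite_finite_induct)
  case (insert i I)
  have "(\<lambda>x. q i x + (\<Sum>i\<in>I. q i x)) \<in> polys p"
    by (rule polys_add) (use insert in auto)
  then show ?case using insert.hyps by simp
qed (simp_all add: polys_zero)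

lemma polys_monomial:
  assumes "i + j \<le> p"
  shows "(\<lambda>x. a * (x $ 1) ^ i * (x $ 2) ^ j) \<in> polys p"
proof (rule polysI[where c = "\<lambda>k l. if k = i then (if l = j then a else 0) else 0"])
  fix x :: "real^2"
  have "(\<Sum>l\<le>p - k. (if k = i then (if l = j then a else 0) else 0) * (x $ 1) ^ k * (x $ 2) ^ l)
      = (if k = i then a * (x $ 1) ^ i * (x $ 2) ^ j else 0)" for k
  proof (cases "k = i")
    case True
    have "(\<Sum>l\<le>p - i. (if l = j then a else 0) * (x $ 1) ^ i * (x $ 2) ^ l)
        = (\<Sum>l\<le>p - i. if l = j then a * (x $ 1) ^ i * (x $ 2) ^ l else 0)"
      by (rule sum.cong) auto
    also have "\<dots> = a * (x $ 1) ^ i * (x $ 2) ^ j"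
      using assms by (simp add: sum.delta')
    finally show ?thesis using True by simp
  qed simp
  then show "a * (x $ 1) ^ i * (x $ 2) ^ j = (\<Sum>k\<le>p. \<Sum>l\<le>p - k.
      (if k = i then (if l = j then a else 0) else 0) * (x $ 1) ^ k * (x $ 2) ^ l)"
    using assms by simp
qed

lemma polys_induct [consumes 1, case_names zero monomial add]:
  assumes q: "q \<in> polys p"
    and "P (\<lambda>x. 0)"
    and mon: "\<And>i j a. i + j \<le> p \<Longrightarrow> P (\<lambda>x. a * (x $ 1) ^ i * (x $ 2) ^ j)"
    and add: "\<And>q r. q \<in> polys p \<Longrightarrow> r \<in> polys p \<Longrightarrow> P q \<Longrightarrow> P r \<Longrightarrow> P (\<lambda>x. q x + r x)"
  shows "P q"
proof -
  have sum: "(\<forall>k\<in>K. f k \<in> polys p \<and> P (f k)) \<Longrightarrow> P (\<lambda>x. \<Sum>k\<in>K. f k x)"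
    if "finite K" for K :: "nat set" and f
    using that
  proof induction
    case (insert k K)
    have "P (\<lambda>x. f k x + (\<Sum>k\<in>K. f k x))"
      using insert by (intro add polys_sum) auto
    then show ?case using insert.hyps by simp
  qed (simp add: assms(2))
  obtain c where c: "\<And>x. q x = (\<Sum>i\<le>p. \<Sum>j\<le>p - i. c i j * (x $ 1) ^ i * (x $ 2) ^ j)"
    using q unfolding polys_def by blast
  have "P (\<lambda>x. \<Sum>i\<le>p. \<Sum>j\<le>p - i. c i j * (x $ 1) ^ i * (x $ 2) ^ j)"
  proof (rule sum, simp, rule ballI, rule conjI)
    fix i assume i: "i \<in> {..p}"
    then have m: "(\<lambda>x. c i j * (x $ 1) ^ i * (x $ 2) ^ j) \<in> polys p" if "j \<in> {..p-i}" for j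
      using that by (intro polys_monomial) auto
    show "(\<lambda>x. \<Sum>j\<le>p - i. c i j * (x $ 1) ^ i * (x $ 2) ^ j) \<in> polys p"
      by (rule polys_sum) (rule m)
    show "P (\<lambda>x. \<Sum>j\<le>p - i. c i j * (x $ 1) ^ i * (x $ 2) ^ j)"
    proof (rule sum, simp, rule ballI)
      fix j assume "j \<in> {..p-i}"
      then show "(\<lambda>x. c i j * (x $ 1) ^ i * (x $ 2) ^ j) \<in> polys p \<and>
          P (\<lambda>x. c i j * (x $ 1) ^ i * (x $ 2) ^ j)"
        using m i by (auto intro!: mon)
    qed
  qed
  moreover have "q = (\<lambda>x. \<Sum>i\<le>p. \<Sum>j\<le>p - i. c i j * (x $ 1) ^ i * (x $ 2) ^ j)"
    using c by (rule ext)
  ultimately show ?thesis by simp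
qed

lemma continuous_on_polys:
  assumes "q \<in> polys p"
  shows "continuous_on S q"
  using assms by (induction rule: polys_induct) (auto intro!: continuous_intros)

lemma has_real_derivative_monomial_axis:
  fixes x :: "real^2"
  shows "((\<lambda>t. a * ((x + t *\<^sub>R axis k 1) $ 1) ^ i * ((x + t *\<^sub>R axis k 1) $ 2) ^ j) has_real_derivative
     (if k = 1 then a * real i * (x $ 1) ^ (i - 1) * (x $ 2) ^ j
      else a * (x $ 1) ^ i * (real j * (x $ 2) ^ (j - 1)))) (at 0)"
proof (cases "k = 1")
  case True
  then show ?thesis
    by (auto simp: axis_def intro!: derivative_eq_intros)
next
  case False
  then have "k = 2" by (metis exhaust_2)
  then show ?thesis
    by (auto simp: axis_def intro!: derivative_eq_intros)
qed

text \<open>\<open>pd\<close> is built from \<open>deriv\<close>, which says nothing until a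
  derivative is exhibited. The truncated subtractions are harmless: a monomial whose exponent would
  underflow has derivative zero.\<close>

lemma polys_has_pd:
  assumes "q \<in> polys p"
  shows "\<exists>r\<in>polys (p - 1). \<forall>x. ((\<lambda>t. q (x + t *\<^sub>R axis k 1)) has_real_derivative r x) (at 0)"
  using assms
proof (induction rule: polys_induct)
  case zero
  then show ?case by (auto intro!: bexI[OF _ polys_zero])
next
  case (monomial i j a)
  let ?r = "\<lambda>x. if k = 1 then a * real i * (x $ 1) ^ (i - 1) * (x $ 2) ^ j
      else a * (x $ 1) ^ i * (real j * (x $ 2) ^ (j - 1))"
  have "(\<lambda>x. (a * real i) * (x $ 1) ^ (i - 1) * (x $ 2) ^ j) \<in> polys (p - 1)"
    using monomial by (cases "i = 0") (auto intro!: polys_zero polys_monomial)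
  moreover have "(\<lambda>x. (a * real j) * (x $ 1) ^ i * (x $ 2) ^ (j - 1)) \<in> polys (p - 1)"
    using monomial by (cases "j = 0") (auto intro!: polys_zero polys_monomial)
  ultimately have "?r \<in> polys (p - 1)"
    by (cases "k = 1") (simp_all add: mult_ac)
  then show ?case
    using has_real_derivative_monomial_axis by (intro bexI[of _ ?r]) blast+
next
  case (add q r)
  then obtain q' r' where "q' \<in> polys (p-1)" "r' \<in> polys (p-1)"
    "\<forall>x. ((\<lambda>t. q (x + t *\<^sub>R axis k 1)) has_real_derivative q' x) (at 0)"
    "\<forall>x. ((\<lambda>t. r (x + t *\<^sub>R axis k 1)) has_real_derivative r' x) (at 0)" by blast
  then show ?case
    by (intro bexI[of _ "\<lambda>x. q' x + r' x"] polys_add allI DERIV_add) auto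
qed

lemma pd_polys:
  assumes "q \<in> polys p"
  shows "pd k q \<in> polys (p - 1)"
proof -
  obtain r where r: "r \<in> polys (p - 1)"
    and "\<forall>x. ((\<lambda>t. q (x + t *\<^sub>R axis k 1)) has_real_derivative r x) (at 0)"
    using polys_has_pd[OF assms] by blast
  then have "pd k q = r"
    unfolding pd_def by (intro ext DERIV_imp_deriv) blast
  then show ?thesis using r by simp
qed

lemma d_n_polys: "q \<in> polys p \<Longrightarrow> d_n n q \<in> polys (p - 1)"
  unfolding d_n_def by (intro polys_sum polys_cmult pd_polys)

lemma d_nn_polys: 
  assumes "q \<in> polys p" shows "d_nn n q \<in> polys (p - 2)"
proof -
  have "pd i (pd j q) \<in> polys (p - 2)" for i j
    using pd_polys[OF pd_polys[OF assms], of i j] by (simp add: numeral_2_eq_2)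
  then show ?thesis unfolding d_nn_def by (intro polys_sum polys_cmult)
qed

lemma polys_mono:
  assumes "q \<in> polys p" "p \<le> p'"
  shows "q \<in> polys p'"
  using assms(1)
proof (induction rule: polys_induct)
  case (monomial i j a)
  then show ?case using assms(2) by (intro polys_monomial) simp
qed (auto intro: polys_zero polys_add)

text \<open>The form in which the bound on the degree is used: two derivatives of a cubic leave an
  affine function, and \<open>a\<close> is its constant gradient.\<close>

lemma polys_1_affine:
  assumes "q \<in> polys 1"
  shows "\<exists>a. \<forall>x y. q y = q x + a \<bullet> (y - x)"
proof -
  obtain c where c: "\<And>x. q x = (\<Sum>i\<le>1. \<Sum>j\<le>1 - i. c i j * (x $ 1) ^ i * (x $ 2) ^ j)"
    using assms unfolding polys_def by blast
  have q: "q x = c 0 0 + c 0 1 * x $ 2 + c 1 0 * x $ 1" for x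
    using c[of x] by simp
  show ?thesis
    by (rule exI[of _ "\<chi> i. if i = 1 then c 1 0 else c 0 1"])
      (simp add: q inner_vec_def sum_2 algebra_simps)
qed

section \<open>Barycentric coordinates and Lagrange shape functions\<close>

lemma polys_times_affine:
  assumes "q \<in> polys p"
  shows "(\<lambda>x. (c0 + c1 * x $ 1 + c2 * x $ 2) * q x) \<in> polys (Suc p)"
  using assms
proof (induction rule: polys_induct)
  case (monomial i j a)
  have "(\<lambda>x. (c0 * a) * (x $ 1) ^ i * (x $ 2) ^ j + (c1 * a) * (x $ 1) ^ Suc i * (x $ 2) ^ j
       + (c2 * a) * (x $ 1) ^ i * (x $ 2) ^ Suc j) \<in> polys (Suc p)"
    using monomial by (intro polys_add polys_monomial) auto
  then show ?case by (simp add: algebra_simps)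
next
  case (add q r)
  from polys_add[OF add(3,4)] show ?case by (simp add: distrib_left)
qed (simp add: polys_zero)

lemma polys_const: "(\<lambda>x. a) \<in> polys p"
  using polys_monomial[of 0 0 p a] by simp

lemma polys_prod_affine:
  assumes "finite I"
  shows "(\<lambda>x. \<Prod>i\<in>I. c0 i + c1 i * x $ 1 + c2 i * x $ 2) \<in> polys (card I)"
  using assms
proof induction
  case (insert i I)
  from polys_times_affine[OF insert.IH, of "c0 i" "c1 i" "c2 i"] insert.hyps
  show ?case by simp
qed (simp add: polys_const)

text \<open>If \<open>y\<close> is the point closest to \<open>v\<close> in the affine hull of the
  other vertices, the linear functional given by \<open>v - y\<close> is constant on that hull and
  takes a different value at \<open>v\<close>. Shifting and scaling it gives the coordinate
  belonging to \<open>v\<close>.\<close>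

lemma barycentric_coordinates:
  fixes V :: "(real^2) set"
  assumes "finite V" "\<not> affine_dependent V" "v \<in> V"
  shows "\<exists>c0 c1 c2. \<forall>w\<in>V. c0 + c1 * w $ 1 + c2 * w $ 2 = (if w = v then 1 else (0::real))"
proof -
  have "v \<notin> affine hull (V - {v})"
    using assms unfolding affine_dependent_def by blast
  then have "\<exists>a b. a \<bullet> v \<noteq> b \<and> (\<forall>w\<in>V-{v}. a \<bullet> w = b)"
  proof (cases "V - {v} = {}")
    case True
    have "0 \<bullet> v \<noteq> (1::real)" by simp
    then show ?thesis unfolding True by blast
  next
    case False
    define S where "S = affine hull (V - {v})"
    have S: "closed S" "convex S" "affine S" "S \<noteq> {}" "v \<notin> S"
      using False \<open>v \<notin> _\<close> by (auto simp: S_def affine_imp_convex)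
    obtain w0 where w0: "w0 \<in> S" using S by blast
    define y where "y = closest_point S v"
    have y: "y \<in> S" unfolding y_def using closest_point_in_set[OF S(1,4)] .
    have ineq: "(v - y) \<bullet> (w - y) \<le> 0" if "w \<in> S" for w
      unfolding y_def using closest_point_dot[OF S(2,1) that] .
    \<comment> \<open>The reflection of \<open>w\<close> in \<open>y\<close> stays in the affine
      set, so the obtuse-angle inequality holds with both signs.\<close>
    have eq: "(v - y) \<bullet> (w - y) = 0" if "w \<in> S" for w
    proof -
      have "y + (-1) *\<^sub>R (w - y) \<in> S"
        using mem_affine_3_minus[OF S(3) y y that, of 1] by (simp add: algebra_simps)
      then have "0 \<le> (v - y) \<bullet> (w - y)"
        using ineq by (fastforce simp: inner_diff_right)
      with ineq[OF that] show ?thesis by linarith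
    qed
    have "(v - y) \<bullet> v \<noteq> (v - y) \<bullet> y"
    proof
      assume "(v - y) \<bullet> v = (v - y) \<bullet> y"
      then have "(v - y) \<bullet> (v - y) = 0" by (simp add: inner_diff_right)
      then show False using y S(5) by simp
    qed
    moreover have "\<forall>w\<in>V-{v}. (v - y) \<bullet> w = (v - y) \<bullet> y"
      using eq hull_inc[of _ "V - {v}" affine] by (simp add: S_def inner_diff_right)
    ultimately show ?thesis by blast
  qed
  then obtain a b where ab: "a \<bullet> v \<noteq> b" "\<forall>w\<in>V-{v}. a \<bullet> w = b" by blast
  let ?k = "a \<bullet> v - b"
  have "- b / ?k + a $ 1 / ?k * w $ 1 + a $ 2 / ?k * w $ 2 = (a \<bullet> w - b) / ?k" for w
    by (simp add: inner_vec_def sum_2 diff_divide_distrib add_divide_distrib)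
  then show ?thesis
    using ab by (intro exI[of _ "- b / ?k"] exI[of _ "a $ 1 / ?k"] exI[of _ "a $ 2 / ?k"]) auto
qed

text \<open>Affine functions respect combinations whose weights sum to one, so the coordinate of
  \<open>v\<close> reads off its weight. The factor \<open>p\<close> turns the value into a natural
  number, ready for comparison with the roots of the Lagrange factors.\<close>

lemma affine_combination_at_node:
  fixes V :: "(real^2) set" and k :: "real^2 \<Rightarrow> nat" and c0 c1 c2 :: real
  assumes "finite V" "p > 0" "(\<Sum>v\<in>V. k v) = p" "v \<in> V"
    and c: "\<forall>w\<in>V. c0 + c1 * w $ 1 + c2 * w $ 2 = (if w = v then 1 else 0)"
    and x: "x = (\<Sum>w\<in>V. (real (k w) / real p) *\<^sub>R w)"
  shows "real p * (c0 + c1 * x $ 1 + c2 * x $ 2) = real (k v)"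
proof -
  have kp: "real p = (\<Sum>w\<in>V. real (k w))" using assms(3) by auto
  have 0: "(\<Sum>w\<in>V. real (k w) * c0) = real p * c0"
    by (simp add: kp sum_distrib_right)
  have xi: "real p * x $ i = (\<Sum>w\<in>V. real (k w) * w $ i)" for i
    using assms(2) by (simp add: x sum_distrib_left)
  have "real p * (c0 + c1 * x $ 1 + c2 * x $ 2)
      = (\<Sum>w\<in>V. real (k w) * c0) + c1 * (\<Sum>w\<in>V. real (k w) * w $ 1) + c2 * (\<Sum>w\<in>V. real (k w) * w $ 2)"
    unfolding 0 xi[symmetric] by (simp add: algebra_simps)
  also have "\<dots> = (\<Sum>w\<in>V. real (k w) * (c0 + c1 * w $ 1 + c2 * w $ 2))"
    by (simp add: sum.distrib[symmetric] sum_distrib_left algebra_simps)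
  also have "\<dots> = (\<Sum>w\<in>V. if w = v then real (k w) else 0)"
    by (rule sum.cong) (use c in auto)
  also have "\<dots> = real (k v)" using assms(1,4) by simp
  finally show ?thesis .
qed

text \<open>In barycentric coordinates \<open>\<lambda>\<^sub>v\<close>, the Lagrange polynomial of the node with coordinates
  \<open>k v / p\<close> is the product of the factors \<open>(p \<lambda>\<^sub>v - j) / (k v - j)\<close> for \<open>j < k v\<close>.\<close>

lemma lagrange_exists:
  assumes "card V = 3" "\<not> affine_dependent V" "p > 0" "A \<in> nodes p V"
  shows "\<exists>q\<in>polys p. \<forall>B\<in>nodes p V. q B = (if B = A then 1 else 0)"
proof -
  have fin: "finite V" using assms(1) by (metis card.infinite zero_neq_numeral)
  obtain k :: "real^2 \<Rightarrow> nat" where k: "A = (\<Sum>v\<in>V. (real (k v) / real p) *\<^sub>R v)" "(\<Sum>v\<in>V. k v) = p"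
    using assms(4) unfolding nodes_def by blast
  obtain c0 c1 c2 where c: "\<And>v. v \<in> V \<Longrightarrow>
      \<forall>w\<in>V. c0 v + c1 v * w $ 1 + c2 v * w $ 2 = (if w = v then 1 else (0::real))"
    using barycentric_coordinates[OF fin assms(2)] by metis
  \<comment> \<open>One index per linear factor. As the \<open>k v\<close> sum up to
    \<open>p\<close>, there are exactly \<open>p\<close> factors, which gives the degree.\<close>
  define I where "I = (SIGMA v:V. {..<k v})"
  have I: "finite I" "card I = p"
    unfolding I_def using fin k(2) by auto
  define q where "q x = (\<Prod>(v, j)\<in>I. (real p * (c0 v + c1 v * x $ 1 + c2 v * x $ 2) - real j)
      / (real (k v) - real j))" for x :: "real^2"
  define d where "d i = real (k (fst i)) - real (snd i)" for i :: "(real^2) \<times> nat"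
  have "q = (\<lambda>x. \<Prod>i\<in>I. (real p * c0 (fst i) - real (snd i)) / d i
      + real p * c1 (fst i) / d i * x $ 1 + real p * c2 (fst i) / d i * x $ 2)"
    unfolding q_def d_def
    by (intro ext prod.cong)
      (simp_all add: case_prod_unfold diff_divide_distrib add_divide_distrib algebra_simps)
  then have q: "q \<in> polys p"
    using polys_prod_affine[OF I(1), of "\<lambda>i. (real p * c0 (fst i) - real (snd i)) / d i"
      "\<lambda>i. real p * c1 (fst i) / d i" "\<lambda>i. real p * c2 (fst i) / d i"] I(2) by simp
  have "q B = (if B = A then 1 else 0)" if B: "B \<in> nodes p V" for B
  proof -
    obtain l :: "real^2 \<Rightarrow> nat" where l: "B = (\<Sum>v\<in>V. (real (l v) / real p) *\<^sub>R v)" "(\<Sum>v\<in>V. l v) = p"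
      using B unfolding nodes_def by blast
    have lam: "real p * (c0 v + c1 v * B $ 1 + c2 v * B $ 2) = real (l v)" if "v \<in> V" for v
      using affine_combination_at_node[OF fin assms(3) l(2) that c[OF that] l(1)] .
    have lamA: "real p * (c0 v + c1 v * A $ 1 + c2 v * A $ 2) = real (k v)" if "v \<in> V" for v
      using affine_combination_at_node[OF fin assms(3) k(2) that c[OF that] k(1)] .
    have qB: "q B = (\<Prod>(v, j)\<in>I. (real (l v) - real j) / (real (k v) - real j))"
      unfolding q_def by (rule prod.cong) (auto simp: I_def lam)
    show ?thesis
    proof (cases "B = A")
      case True
      then have "l v = k v" if "v \<in> V" for v
        using lam[OF that] lamA[OF that] by simp
      then have "q B = (\<Prod>(v, j)\<in>I. 1)"
        unfolding qB by (intro prod.cong) (auto simp: I_def)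
      then show ?thesis using True by (simp add: case_prod_unfold)
    next
      case False
      \<comment> \<open>Both families have sum \<open>p\<close>, so if they differ, some
        \<open>l v\<close> lies below \<open>k v\<close>. The factor of index
        \<open>(v, l v)\<close> then vanishes at \<open>B\<close>.\<close>
      have "\<exists>v\<in>V. l v < k v"
      proof (rule ccontr)
        assume "\<not> ?thesis"
        then have "\<forall>v\<in>V. k v \<le> l v" by auto
        then have "\<forall>v\<in>V. k v = l v"
          using sum_mono_inv[of k V l] k(2) l(2) fin by metis
        then have "A = B" unfolding k(1) l(1) by (intro sum.cong) auto
        then show False using False by simp
      qed
      then obtain v where v: "v \<in> V" "l v < k v" by blast
      then have "(v, l v) \<in> I" by (simp add: I_def)
      then have "q B = 0"
        unfolding qB using I(1) by (intro prod_zero) (auto intro!: bexI[of _ "(v, l v)"])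
      then show ?thesis using False by simp
    qed
  qed
  then show ?thesis using q by blast
qed

lemma lagrange_polys:
  assumes "card V = 3" "\<not> affine_dependent V" "p > 0" "A \<in> nodes p V"
  shows "lagrange p V A \<in> polys p"
proof -
  have "\<exists>q. q \<in> polys p \<and> (\<forall>B\<in>nodes p V. q B = (if B = A then 1 else 0))"
    using lagrange_exists[OF assms] by blast
  then show ?thesis unfolding lagrange_def by (rule someI2_ex) blast
qed

text \<open>Both components of a shape function are combinations of Lagrange polynomials of the
  element, whatever coefficients the orthogonality conditions select.\<close>

lemma local_space_polys:
  assumes "card V = 3" "\<not> affine_dependent V" "deg Q > 0" "w \<in> local_space Q G V"
  shows "w s \<in> polys (deg Q)"
proof (cases "V \<in> iface_elems G")
  case True
  then obtain \<phi> a where \<phi>: "\<forall>A\<in>nodes (deg Q) V. is_ife_shape Q G V A (\<phi> A)"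
    and w: "w = (\<lambda>s x. \<Sum>A\<in>nodes (deg Q) V. a A * \<phi> A s x)"
    using assms(4) unfolding local_space_def by auto
  have "\<phi> A s \<in> polys (deg Q)" if A: "A \<in> nodes (deg Q) V" for A
  proof -
    obtain c where c: "\<phi> A = (\<lambda>s x. xi Q G V A s x + (\<Sum>B\<in>nodes (deg Q) V. c B * eta Q G V B s x))"
      using \<phi> A unfolding is_ife_shape_def by blast
    have 1: "xi Q G V A s \<in> polys (deg Q)"
      unfolding xi_def using lagrange_polys[OF assms(1-3) A] by (simp add: polys_zero)
    have 2: "eta Q G V B s \<in> polys (deg Q)" if "B \<in> nodes (deg Q) V" for B
      unfolding eta_def using lagrange_polys[OF assms(1-3) that] by (simp add: polys_zero)
    have "(\<lambda>x. xi Q G V A s x + (\<Sum>B\<in>nodes (deg Q) V. c B * eta Q G V B s x)) \<in> polys (deg Q)"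
      by (intro polys_add polys_sum polys_cmult 1 2)
    then show ?thesis unfolding c .
  qed
  then show ?thesis unfolding w by (intro polys_sum polys_cmult)
next
  case False
  then show ?thesis using assms(4) unfolding local_space_def by auto
qed

section \<open>Cauchy-Schwarz inequalities\<close>

text \<open>\<open>cs a b c\<close> is \<open>c\<^sup>2 \<le> a b\<close> with \<open>a, b \<ge> 0\<close>, in a form that can be summed over elements and edges.\<close>

definition cs :: "real \<Rightarrow> real \<Rightarrow> real \<Rightarrow> bool" where
  "cs a b c \<longleftrightarrow> (\<forall>t>0. 2 * \<bar>c\<bar> \<le> t * a + b / t)"

lemma csD: "cs a b c \<Longrightarrow> t > 0 \<Longrightarrow> 2 * \<bar>c\<bar> \<le> t * a + b / t"
  unfolding cs_def by blast

lemma cs_zero: "cs 0 0 0"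
  unfolding cs_def by simp

text \<open>For a common \<open>t\<close> the defining inequality can simply be added. This takes
  the place of the discrete Cauchy-Schwarz inequality when local estimates are summed.\<close>

lemma cs_add:
  assumes "cs a b c" "cs a' b' c'"
  shows "cs (a + a') (b + b') (c + c')"
  unfolding cs_def
proof (intro allI impI)
  fix t :: real assume "t > 0"
  have "2 * \<bar>c + c'\<bar> \<le> 2 * \<bar>c\<bar> + 2 * \<bar>c'\<bar>"
    using mult_left_mono[OF abs_triangle_ineq[of c c'], of 2] by (simp add: distrib_left)
  also have "\<dots> \<le> (t * a + b / t) + (t * a' + b' / t)"
    using csD[OF assms(1) \<open>t > 0\<close>] csD[OF assms(2) \<open>t > 0\<close>] by (rule add_mono)
  also have "\<dots> = t * (a + a') + (b + b') / t"
    by (simp add: distrib_left add_divide_distrib)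
  finally show "2 * \<bar>c + c'\<bar> \<le> t * (a + a') + (b + b') / t" .
qed

lemma cs_uminus: "cs a b c \<Longrightarrow> cs a b (- c)"
  unfolding cs_def by simp

lemma cs_commute: "cs a b c \<Longrightarrow> cs b a c"
  unfolding cs_def
proof (intro allI impI)
  fix t :: real assume *: "\<forall>t>0. 2 * \<bar>c\<bar> \<le> t * a + b / t" "t > 0"
  from *(1)[rule_format, of "1 / t"] *(2) show "2 * \<bar>c\<bar> \<le> t * b + a / t"
    by (simp add: mult.commute add.commute)
qed

lemma cs_sum:
  assumes "\<And>i. i \<in> I \<Longrightarrow> cs (a i) (b i) (c i)"
  shows "cs (sum a I) (sum b I) (sum c I)"
  using assms by (induction I rule: infinite_finite_induct) (auto simp: cs_zero cs_add)

lemma cs_mono: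
  assumes "cs a b c" "a \<le> a'" "b \<le> b'"
  shows "cs a' b' c"
  unfolding cs_def
proof (intro allI impI)
  fix t :: real assume t: "t > 0"
  have "t * a \<le> t * a'" "b / t \<le> b' / t"
    using assms t by (auto simp: divide_right_mono)
  with csD[OF assms(1) t] show "2 * \<bar>c\<bar> \<le> t * a' + b' / t" by linarith
qed

lemma cs_scale:
  assumes "cs a b c" "k \<ge> 0"
  shows "cs (k * a) (k * b) (k * c)"
  unfolding cs_def
proof (intro allI impI)
  fix t :: real assume t: "t > 0"
  have "k * (2 * \<bar>c\<bar>) \<le> k * (t * a + b / t)"
    using csD[OF assms(1) t] assms(2) by (intro mult_left_mono)
  then show "2 * \<bar>k * c\<bar> \<le> t * (k * a) + k * b / t"
    using assms(2) by (simp add: abs_mult algebra_simps)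
qed

text \<open>Moves a weight from one factor to the other. It is applied with the length of an edge
  part, which matches the reciprocal weights of the penalties on first and second normal
  derivatives.\<close>

lemma cs_rescale:
  assumes "cs a b c" "k > 0"
  shows "cs (k * a) (b / k) c"
  unfolding cs_def
proof (intro allI impI)
  fix t :: real assume t: "t > 0"
  have "2 * \<bar>c\<bar> \<le> (t * k) * a + b / (t * k)"
    using csD[OF assms(1), of "t * k"] assms(2) t by simp
  then show "2 * \<bar>c\<bar> \<le> t * (k * a) + b / k / t"
    by (simp add: mult_ac)
qed

text \<open>The optimal parameter is the square root of \<open>b / a\<close>, which degenerates when
  \<open>a\<close> or \<open>b\<close> vanishes. The inequality is therefore proved for slightly
  larger numbers and carried over in the limit.\<close>

lemma cs_imp_le_sqrt:
  assumes "cs a b c" "a \<ge> 0" "b \<ge> 0"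
  shows "c \<le> sqrt a * sqrt b"
proof -
  have le: "2 * \<bar>c\<bar> \<le> 2 * sqrt a' * sqrt b'" if "a' > a" "b' > b" for a' b'
  proof -
    have pos: "sqrt a' > 0" "sqrt b' > 0" using that assms by auto
    have "2 * \<bar>c\<bar> \<le> (sqrt b' / sqrt a') * a' + b' / (sqrt b' / sqrt a')"
      using that pos by (intro csD[OF cs_mono[OF assms(1), of a' b']]) auto
    also have "\<dots> = sqrt b' * (a' / sqrt a') + (b' / sqrt b') * sqrt a'" by simp
    also have "\<dots> = 2 * sqrt a' * sqrt b'"
      using that assms by (simp only: real_div_sqrt) simp
    finally show ?thesis .
  qed
  have "((\<lambda>e. 2 * sqrt (a + e) * sqrt (b + e)) \<longlongrightarrow> 2 * sqrt (a + 0) * sqrt (b + 0)) (at_right 0)"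
    by (intro tendsto_intros)
  moreover have "eventually (\<lambda>e. 2 * \<bar>c\<bar> \<le> 2 * sqrt (a + e) * sqrt (b + e)) (at_right 0)"
    using le by (auto simp: eventually_at_right_field intro!: exI[of _ 1])
  ultimately have "2 * \<bar>c\<bar> \<le> 2 * sqrt a * sqrt b"
    by (intro tendsto_lowerbound[of _ _ "at_right (0::real)"]) auto
  then show ?thesis by linarith
qed

lemma cs_integral:
  fixes f g h :: "'a \<Rightarrow> real"
  assumes "integrable M f" "integrable M g" "integrable M h"
    and le: "\<And>x t. x \<in> space M \<Longrightarrow> t > 0 \<Longrightarrow> 2 * \<bar>h x\<bar> \<le> t * f x + g x / t"
  shows "cs (\<integral>x. f x \<partial>M) (\<integral>x. g x \<partial>M) (\<integral>x. h x \<partial>M)"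
  unfolding cs_def
proof (intro allI impI)
  fix t :: real assume t: "t > 0"
  have "2 * \<bar>\<integral>x. h x \<partial>M\<bar> \<le> 2 * (\<integral>x. \<bar>h x\<bar> \<partial>M)" by simp
  also have "\<dots> = (\<integral>x. 2 * \<bar>h x\<bar> \<partial>M)" by simp
  also have "\<dots> \<le> (\<integral>x. t * f x + g x / t \<partial>M)"
    using assms t by (intro integral_mono) auto
  also have "\<dots> = t * (\<integral>x. f x \<partial>M) + (\<integral>x. g x \<partial>M) / t"
    using assms by simp
  finally show "2 * \<bar>\<integral>x. h x \<partial>M\<bar> \<le> t * (\<integral>x. f x \<partial>M) + (\<integral>x. g x \<partial>M) / t" .
qed

lemma cs_set_integral:
  fixes f g h :: "'a \<Rightarrow> real"
  assumes "set_integrable M A f" "set_integrable M A g" "set_integrable M A h"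
    and le: "\<And>x t. x \<in> A \<Longrightarrow> t > 0 \<Longrightarrow> 2 * \<bar>h x\<bar> \<le> t * f x + g x / t"
  shows "cs (set_lebesgue_integral M A f) (set_lebesgue_integral M A g) (set_lebesgue_integral M A h)"
  using assms unfolding set_integrable_def set_lebesgue_integral_def
  by (intro cs_integral) (auto simp: indicator_def)

lemma two_mult_le_weighted:
  fixes x y :: real
  assumes "t > 0"
  shows "2 * \<bar>x * y\<bar> \<le> t * x\<^sup>2 + y\<^sup>2 / t"
proof -
  have "(2 * \<bar>x * y\<bar>) * t \<le> t * (t * x\<^sup>2) + y\<^sup>2"
    using zero_le_power2[of "t * \<bar>x\<bar> - \<bar>y\<bar>"]
    by (simp add: power2_diff power_mult_distrib abs_mult power2_eq_square[of t] mult_ac)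
  then have "2 * \<bar>x * y\<bar> \<le> (t * (t * x\<^sup>2) + y\<^sup>2) / t"
    using assms by (simp only: pos_le_divide_eq)
  then show ?thesis using assms by (simp add: add_divide_distrib)
qed

text \<open>Traces along an edge jump where the edge changes sides, so continuity cannot serve as
  the standing regularity. This class is closed under algebraic operations and Borel case
  distinctions. Boundedness is restricted to the parameter interval, since polynomials are unbounded
  on the line.\<close>

definition bdd_borel :: "(real \<Rightarrow> real) \<Rightarrow> bool" where
  "bdd_borel f \<longleftrightarrow> f \<in> borel_measurable borel \<and> (\<exists>B. \<forall>t\<in>{0..1}. \<bar>f t\<bar> \<le> B)"

lemma bdd_borel_const [simp]: "bdd_borel (\<lambda>t. c)"
  unfolding bdd_borel_def by auto

lemma bdd_borel_add:
  assumes "bdd_borel f" "bdd_borel g"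
  shows "bdd_borel (\<lambda>t. f t + g t)"
proof -
  obtain B C where BC: "\<forall>t\<in>{0..1}. \<bar>f t\<bar> \<le> B" "\<forall>t\<in>{0..1}. \<bar>g t\<bar> \<le> C"
    using assms unfolding bdd_borel_def by blast
  then have "\<forall>t\<in>{0..1}. \<bar>f t + g t\<bar> \<le> B + C"
    by (meson abs_triangle_ineq add_mono order_trans)
  then show ?thesis using assms unfolding bdd_borel_def by auto
qed

lemma bdd_borel_mult:
  assumes "bdd_borel f" "bdd_borel g"
  shows "bdd_borel (\<lambda>t. f t * g t)"
proof -
  obtain B C where BC: "\<forall>t\<in>{0..1}. \<bar>f t\<bar> \<le> B" "\<forall>t\<in>{0..1}. \<bar>g t\<bar> \<le> C"
    using assms unfolding bdd_borel_def by blast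
  then have "\<forall>t\<in>{0..1}. \<bar>f t * g t\<bar> \<le> B * C"
    unfolding abs_mult by (meson abs_ge_zero mult_mono order_trans)
  then show ?thesis using assms unfolding bdd_borel_def by auto
qed

lemma bdd_borel_uminus: "bdd_borel f \<Longrightarrow> bdd_borel (\<lambda>t. - f t)"
  unfolding bdd_borel_def by auto

lemma bdd_borel_diff: "bdd_borel f \<Longrightarrow> bdd_borel g \<Longrightarrow> bdd_borel (\<lambda>t. f t - g t)"
  using bdd_borel_add[OF _ bdd_borel_uminus, of f g] by simp

lemma bdd_borel_divide_const: "bdd_borel f \<Longrightarrow> bdd_borel (\<lambda>t. f t / c)"
  using bdd_borel_mult[OF _ bdd_borel_const, of f "inverse c"] by (simp add: divide_inverse)

lemma bdd_borel_power2: "bdd_borel f \<Longrightarrow> bdd_borel (\<lambda>t. (f t)\<^sup>2)"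
  unfolding power2_eq_square by (rule bdd_borel_mult)

lemma bdd_borel_continuous:
  assumes "continuous_on UNIV f"
  shows "bdd_borel f"
proof -
  have "compact (f ` {0..1})"
    using assms by (intro compact_continuous_image) (auto intro: continuous_on_subset)
  then obtain B where "\<forall>y\<in>f ` {0..1}. norm y \<le> B"
    using compact_imp_bounded bounded_iff by blast
  then show ?thesis
    using assms unfolding bdd_borel_def by (auto intro: borel_measurable_continuous_onI)
qed

lemma bdd_borel_if:
  assumes "bdd_borel f" "bdd_borel g" "A \<in> sets borel"
  shows "bdd_borel (\<lambda>t. if t \<in> A then f t else g t)"
proof -
  obtain B C where "\<forall>t\<in>{0..1}. \<bar>f t\<bar> \<le> B" "\<forall>t\<in>{0..1}. \<bar>g t\<bar> \<le> C"
    using assms unfolding bdd_borel_def by blast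
  then have "\<forall>t\<in>{0..1}. \<bar>if t \<in> A then f t else g t\<bar> \<le> max B C"
    by (auto simp: le_max_iff_disj)
  moreover have "(\<lambda>t. if t \<in> A then f t else g t) \<in> borel_measurable borel"
    using assms by (intro measurable_If_set) (auto simp: bdd_borel_def)
  ultimately show ?thesis unfolding bdd_borel_def by blast
qed

lemma bdd_borel_set_integrable:
  assumes "bdd_borel f" "J \<in> sets borel" "J \<subseteq> {0..1}"
  shows "set_integrable lborel J f"
proof -
  obtain B where B: "\<forall>t\<in>{0..1}. \<bar>f t\<bar> \<le> B" using assms unfolding bdd_borel_def by blast
  have "set_integrable lborel {0..1} (\<lambda>t::real. B)"
    unfolding set_integrable_def by (intro integrable_scaleR_left integrable_real_indicator) auto
  then have "set_integrable lborel {0..1} f"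
    unfolding set_integrable_def
    by (rule Bochner_Integration.integrable_bound)
      (use B assms in \<open>auto simp: indicator_def bdd_borel_def intro!: AE_I2 borel_measurable_scaleR
        intro: order_trans[OF _ abs_ge_self]\<close>)
  then show ?thesis
    by (rule set_integrable_subset) (use assms in auto)
qed

lemma cs_bdd_borel_weighted:
  assumes "bdd_borel w" "bdd_borel f" "bdd_borel g" "J \<in> sets borel" "J \<subseteq> {0..1}"
    and "\<And>t. t \<in> J \<Longrightarrow> w t \<ge> 0"
  shows "cs (set_lebesgue_integral lborel J (\<lambda>t. w t * f t * f t))
     (set_lebesgue_integral lborel J (\<lambda>t. w t * g t * g t))
     (set_lebesgue_integral lborel J (\<lambda>t. w t * f t * g t))"
proof (intro cs_set_integral bdd_borel_set_integrable bdd_borel_mult assms)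
  fix x t :: real assume "x \<in> J" "t > 0"
  then have "w x * (2 * \<bar>f x * g x\<bar>) \<le> w x * (t * (f x)\<^sup>2 + (g x)\<^sup>2 / t)"
    using assms(6) by (intro mult_left_mono two_mult_le_weighted) auto
  then show "2 * \<bar>w x * f x * g x\<bar> \<le> t * (w x * f x * f x) + w x * g x * g x / t"
    using assms(6)[OF \<open>x \<in> J\<close>] by (simp add: abs_mult power2_eq_square algebra_simps)
qed

lemma set_integral_nonneg_on:
  fixes f :: "'a \<Rightarrow> real"
  assumes "\<And>x. x \<in> A \<Longrightarrow> 0 \<le> f x"
  shows "0 \<le> set_lebesgue_integral M A f"
  unfolding set_lebesgue_integral_def
  using assms by (intro Bochner_Integration.integral_nonneg) (auto simp: indicator_def)

section \<open>Affine functions on a disc\<close>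

text \<open>The values of an affine function at a point and at its mirror image in \<open>z\<close>
  average to \<open>f z\<close>. Convexity of the square gives a pointwise inequality, and the disc
  is invariant under the reflection.\<close>

lemma affine_square_le_integral_ball:
  fixes f :: "real^2 \<Rightarrow> real"
  assumes f: "\<And>x. f x = f z + a \<bullet> (x - z)" and "r > 0"
  shows "(f z)\<^sup>2 * (pi * r\<^sup>2) \<le> set_lebesgue_integral lborel (ball z r) (\<lambda>x. (f x)\<^sup>2)"
proof -
  let ?F = "\<lambda>x. indicator (ball z r) x *\<^sub>R (f x)\<^sup>2"
  have cont: "continuous_on UNIV f"
  proof -
    have "f = (\<lambda>x. f z + a \<bullet> (x - z))" using f by (rule ext)
    moreover have "continuous_on UNIV (\<lambda>x. f z + a \<bullet> (x - z))" by (intro continuous_intros)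
    ultimately show ?thesis by metis
  qed
  have "set_integrable lborel (cball z r) (\<lambda>x. (f x)\<^sup>2)"
    unfolding set_integrable_def
    by (intro borel_integrable_compact continuous_intros) (auto intro: continuous_on_subset[OF cont])
  then have int: "set_integrable lborel (ball z r) (\<lambda>x. (f x)\<^sup>2)"
    by (rule set_integrable_subset) auto
  then have intF: "integrable lborel ?F" unfolding set_integrable_def .
  \<comment> \<open>The point reflection in \<open>z\<close> has Jacobian of modulus one, so it
    preserves Lebesgue measure.\<close>
  have refl: "distr lborel borel (\<lambda>x. 2 *\<^sub>R z + (-1) *\<^sub>R x) = (lborel :: (real^2) measure)"
    using lborel_affine[of "-1" "2 *\<^sub>R z"] by (simp add: density_1 one_ennreal_def[symmetric])
  have eq: "(\<integral>x. ?F x \<partial>lborel) = (\<integral>x. ?F (2 *\<^sub>R z + (-1) *\<^sub>R x) \<partial>lborel)"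
    using intF by (subst refl[symmetric], subst integral_distr) auto
  have int': "integrable lborel (\<lambda>x. ?F (2 *\<^sub>R z + (-1) *\<^sub>R x))"
  proof -
    have "integrable (distr lborel borel (\<lambda>x. 2 *\<^sub>R z + (-1) *\<^sub>R x)) ?F" using intF refl by simp
    then show ?thesis by (subst (asm) integrable_distr_eq) (use intF in auto)
  qed
  have "(f z)\<^sup>2 * (2 * (pi * r\<^sup>2)) = (\<integral>x. indicator (ball z r) x *\<^sub>R (2 * (f z)\<^sup>2) \<partial>lborel)"
  proof -
    have "measure lborel (ball z r) = pi * r\<^sup>2"
      using content_ball[of r z] \<open>r > 0\<close> by (simp add: unit_ball_vol_2)
    then show ?thesis by (simp add: emeasure_lborel_ball_finite)
  qed
  also have "\<dots> \<le> (\<integral>x. ?F x + ?F (2 *\<^sub>R z + (-1) *\<^sub>R x) \<partial>lborel)"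
  proof (intro integral_mono)
    show "integrable lborel (\<lambda>x. indicator (ball z r) x *\<^sub>R (2 * (f z)\<^sup>2))"
      using emeasure_lborel_ball_finite[of z r] by simp
    show "integrable lborel (\<lambda>x. ?F x + ?F (2 *\<^sub>R z + (-1) *\<^sub>R x))"
      using intF int' by simp
    fix x
    have ind: "indicator (ball z r) (2 *\<^sub>R z + (-1) *\<^sub>R x) = (indicator (ball z r) x :: real)"
    proof -
      have "2 *\<^sub>R z + (-1) *\<^sub>R x - z = z - x" by (simp add: scaleR_2)
      then have "dist z (2 *\<^sub>R z + (-1) *\<^sub>R x) = dist z x"
        by (metis dist_commute dist_norm)
      then show ?thesis by (simp add: indicator_def)
    qed
    have "f (2 *\<^sub>R z + (-1) *\<^sub>R x) = f z - a \<bullet> (x - z)"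
      by (subst f) (simp add: scaleR_2 inner_diff_right)
    then have "2 * (f z)\<^sup>2 \<le> (f x)\<^sup>2 + (f (2 *\<^sub>R z + (-1) *\<^sub>R x))\<^sup>2"
      by (subst (2) f) (simp add: power2_sum power2_diff)
    then show "indicator (ball z r) x *\<^sub>R (2 * (f z)\<^sup>2) \<le> ?F x + ?F (2 *\<^sub>R z + (-1) *\<^sub>R x)"
      unfolding ind by (simp add: indicator_def)
  qed
  also have "\<dots> = 2 * set_lebesgue_integral lborel (ball z r) (\<lambda>x. (f x)\<^sup>2)"
    unfolding set_lebesgue_integral_def
    using Bochner_Integration.integral_add[OF intF int'] eq by simp
  finally show ?thesis by simp
qed

text \<open>On the line through \<open>z\<close> and \<open>y\<close> the function is determined by
  its values at \<open>z\<close> and at a point at distance \<open>r / 2\<close>. Both are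
  controlled by discs of radius \<open>r / 2\<close> inside the given one, and extrapolating to
  \<open>y\<close> costs a factor depending on \<open>M\<close>.\<close>

lemma affine_square_le_integral:
  fixes f :: "real^2 \<Rightarrow> real"
  assumes f: "\<And>x y. f y = f x + a \<bullet> (y - x)" and r: "r > 0"
    and S: "ball z r \<subseteq> S" and int: "set_integrable lborel S (\<lambda>x. (f x)\<^sup>2)"
    and y: "dist y z \<le> M * r"
  shows "(f y)\<^sup>2 * r\<^sup>2 \<le> 8 * (1 + 2 * M)\<^sup>2 * set_lebesgue_integral lborel S (\<lambda>x. (f x)\<^sup>2)"
proof -
  let ?I = "set_lebesgue_integral lborel S (\<lambda>x. (f x)\<^sup>2)"
  have "0 \<le> M * r" using y zero_le_dist[of y z] by linarith
  then have M: "M \<ge> 0" using r by (simp add: zero_le_mult_iff)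
  \<comment> \<open>The disc about \<open>w\<close> has area \<open>pi / 4\<close> times the square
    of \<open>r\<close>, and \<open>pi / 4\<close> is at least one half; hence the factor 2.\<close>
  have point: "(f w)\<^sup>2 * r\<^sup>2 \<le> 2 * ?I" if w: "dist w z \<le> r / 2" for w
  proof -
    have sub: "ball w (r / 2) \<subseteq> S"
    proof -
      have "ball w (r / 2) \<subseteq> ball z r"
        using w by (simp add: ball_subset_ball_iff)
      then show ?thesis using S by blast
    qed
    have "(f w)\<^sup>2 * (pi * (r / 2)\<^sup>2) \<le> set_lebesgue_integral lborel (ball w (r/2)) (\<lambda>x. (f x)\<^sup>2)"
      using r f by (intro affine_square_le_integral_ball[where a = a]) auto
    also have "\<dots> \<le> ?I"
      using set_integrable_subset[OF int _ sub] int sub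
      unfolding set_lebesgue_integral_def set_integrable_def
      by (intro integral_mono) (auto simp: indicator_def)
    finally have "(f w)\<^sup>2 * r\<^sup>2 * (pi / 4) \<le> ?I" by (simp add: power_divide mult_ac)
    moreover have "(f w)\<^sup>2 * r\<^sup>2 * (1 / 2) \<le> (f w)\<^sup>2 * r\<^sup>2 * (pi / 4)"
      using pi_ge_two by (intro mult_left_mono) auto
    ultimately show ?thesis by linarith
  qed
  \<comment> \<open>The extrapolation parameter: \<open>y\<close> divides the line through
    \<open>z\<close> and \<open>w\<close> as \<open>(1 - m) z + m w\<close>, so both coefficients
    are at most \<open>1 + 2 * M\<close> in modulus.\<close>
  define m where "m = 2 * dist y z / r"
  define w where "w = (if y = z then z else z + (r / (2 * dist y z)) *\<^sub>R (y - z))"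
  have m: "0 \<le> m" "m \<le> 2 * M"
    using r y by (auto simp: m_def divide_le_eq)
  have w: "dist w z \<le> r / 2"
    using r by (auto simp: w_def dist_norm)
  have fw: "f w = f z + (r / (2 * dist y z)) * (a \<bullet> (y - z))" if "y \<noteq> z"
    by (subst f[of w z]) (use that in \<open>simp add: w_def\<close>)
  have fy: "f y = (1 - m) * f z + m * f w"
  proof (cases "y = z")
    case False
    then have "m * (r / (2 * dist y z)) = 1" using r by (simp add: m_def)
    then have "m * f w = m * f z + a \<bullet> (y - z)"
      unfolding fw[OF False] distrib_left mult.assoc[symmetric] by (simp only: mult_1_left)
    then show ?thesis using f[of y z] by (simp add: left_diff_distrib)
  qed (simp add: m_def)
  have "(f y)\<^sup>2 \<le> 2 * ((1 - m) * f z)\<^sup>2 + 2 * (m * f w)\<^sup>2"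
    unfolding fy using zero_le_power2[of "(1 - m) * f z - m * f w"]
    by (simp add: power2_sum power2_diff)
  also have "\<dots> \<le> 2 * ((1 + 2 * M)\<^sup>2 * (f z)\<^sup>2) + 2 * ((1 + 2 * M)\<^sup>2 * (f w)\<^sup>2)"
  proof -
    have "(1 - m)\<^sup>2 \<le> (1 + 2 * M)\<^sup>2" "m\<^sup>2 \<le> (1 + 2 * M)\<^sup>2"
      using m by (auto simp: abs_le_square_iff[symmetric])
    then show ?thesis
      unfolding power_mult_distrib by (intro add_mono mult_left_mono mult_right_mono) auto
  qed
  finally have "(f y)\<^sup>2 * r\<^sup>2 \<le> 2 * (1 + 2 * M)\<^sup>2 * ((f z)\<^sup>2 * r\<^sup>2 + (f w)\<^sup>2 * r\<^sup>2)"
    by (drule_tac c = "r\<^sup>2" in mult_right_mono) (auto simp: algebra_simps)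
  also have "\<dots> \<le> 2 * (1 + 2 * M)\<^sup>2 * (2 * ?I + 2 * ?I)"
    using point[of z] point[OF w] r by (intro mult_left_mono add_mono) auto
  finally show ?thesis by simp
qed

section \<open>Triangles in the plane\<close>

text \<open>The clockwise quarter turn, with the same orientation as \<open>cnormal\<close>.\<close>

definition perp :: "real^2 \<Rightarrow> real^2" where
  "perp v = (\<chi> i. if i = 1 then v $ 2 else - (v $ 1))"

lemma perp_nth [simp]: "perp v $ 1 = v $ 2" "perp v $ 2 = - (v $ 1)"
  by (simp_all add: perp_def)

lemma inner_2: "x \<bullet> y = x $ 1 * y $ 1 + x $ 2 * y $ 2" for x y :: "real^2"
  by (simp add: inner_vec_def sum_2)

lemma inner_perp [simp]: "v \<bullet> perp v = 0" "perp v \<bullet> v = 0"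
  by (simp_all add: inner_2)

lemma norm_perp [simp]: "norm (perp v) = norm v"
  by (simp add: norm_eq_sqrt_inner inner_2 add.commute)

lemma orthonormal_expansion:
  fixes \<tau> n w :: "real^2"
  assumes "norm \<tau> = 1" "norm n = 1" "n \<bullet> \<tau> = 0"
  shows "w = (w \<bullet> \<tau>) *\<^sub>R \<tau> + (w \<bullet> n) *\<^sub>R n"
proof -
  have "\<tau> $ 1 * \<tau> $ 1 + \<tau> $ 2 * \<tau> $ 2 = 1" "n $ 1 * n $ 1 + n $ 2 * n $ 2 = 1"
    "n $ 1 * \<tau> $ 1 + n $ 2 * \<tau> $ 2 = 0"
    using assms by (simp_all add: norm_eq_1 inner_2)
  \<comment> \<open>This needs the rows of the matrix with columns \<tau> and \<open>n\<close> to be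
    orthonormal, which follows algebraically from the orthonormality of the columns.\<close>
  then have "w $ 1 = (w $ 1 * \<tau> $ 1 + w $ 2 * \<tau> $ 2) * \<tau> $ 1 + (w $ 1 * n $ 1 + w $ 2 * n $ 2) * n $ 1"
    "w $ 2 = (w $ 1 * \<tau> $ 1 + w $ 2 * \<tau> $ 2) * \<tau> $ 2 + (w $ 1 * n $ 1 + w $ 2 * n $ 2) * n $ 2"
    by algebra+
  then show ?thesis by (simp add: vec_eq_iff forall_2 inner_2)
qed

text \<open>The barycentric coordinates of \<open>x + w\<close> are computed: the weight \<mu> of
  \<open>c\<close> comes from the normal component of \<open>w\<close>, the shift \<theta> along the
  edge from the tangential one. The sign condition on \<open>w\<close> is \<mu> \<ge> 0, and the
  other two weights stay non-negative for small \<open>w\<close>.\<close>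

lemma half_ball_subset_triangle:
  fixes a b c n :: "real^2"
  assumes ab: "a \<noteq> b" and n: "norm n = 1" "n \<bullet> (b - a) = 0" and k: "n \<bullet> (c - a) > 0"
    and t: "0 < t" "t < 1" and x: "x = (1 - t) *\<^sub>R a + t *\<^sub>R b"
  shows "\<exists>\<epsilon>>0. \<forall>w. norm w < \<epsilon> \<longrightarrow> n \<bullet> w \<ge> 0 \<longrightarrow> x + w \<in> convex hull {a, b, c}"
proof -
  define k where "k = n \<bullet> (c - a)"
  define L where "L = norm (b - a)"
  define \<tau> where "\<tau> = (1 / L) *\<^sub>R (b - a)"
  have pos: "k > 0" "L > 0" using assms by (auto simp: k_def L_def)
  have \<tau>: "norm \<tau> = 1" "n \<bullet> \<tau> = 0" "b - a = L *\<^sub>R \<tau>"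
    using pos n by (auto simp: \<tau>_def L_def)
  have xa: "x - a = (t * L) *\<^sub>R \<tau>"
  proof -
    have "x - a = t *\<^sub>R (b - a)" by (simp add: x algebra_simps)
    then show ?thesis unfolding \<tau>(3) by simp
  qed
  have "n \<bullet> (x - a) = 0" unfolding xa using \<tau> by simp
  then have kx: "n \<bullet> (c - x) = k"
    unfolding k_def by (simp add: inner_diff_right)
  \<comment> \<open>\<open>s\<close> is the smaller barycentric coordinate of \<open>x\<close> on
    the edge; \<open>K\<close> is the Lipschitz constant in \<open>w\<close> of the sum of \<mu> and
    the modulus of \<theta>.\<close>
  define s where "s = min t (1 - t)"
  define K where "K = 1 / k + 1 / L + norm (c - x) / (k * L)"
  have s: "0 < s" "s \<le> t" "s \<le> 1 - t" "s \<le> 1" using t by (auto simp: s_def)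
  have K: "K > 0" using pos unfolding K_def by (intro add_pos_nonneg add_pos_pos) auto
  show ?thesis
  proof (intro exI[of _ "s / K"] conjI allI impI)
    show "s / K > 0" using s K by simp
    fix w assume w: "norm w < s / K" "n \<bullet> w \<ge> 0"
    define \<mu> where "\<mu> = n \<bullet> w / k"
    define \<theta> where "\<theta> = (w \<bullet> \<tau> - \<mu> * ((c - x) \<bullet> \<tau>)) / L"
    have \<mu>0: "\<mu> \<ge> 0" using w pos by (simp add: \<mu>_def)
    have \<mu>1: "\<mu> \<le> norm w / k"
      unfolding \<mu>_def using norm_cauchy_schwarz[of n w] n pos by (intro divide_right_mono) auto
    have \<theta>1: "\<bar>\<theta>\<bar> \<le> norm w / L + norm w * norm (c - x) / (k * L)"
    proof -
      have 1: "\<bar>w \<bullet> \<tau>\<bar> \<le> norm w" "\<bar>(c - x) \<bullet> \<tau>\<bar> \<le> norm (c - x)"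
        using Cauchy_Schwarz_ineq2[of w \<tau>] Cauchy_Schwarz_ineq2[of "c - x" \<tau>] \<tau> by auto
      have "\<bar>w \<bullet> \<tau> - \<mu> * ((c - x) \<bullet> \<tau>)\<bar> \<le> \<bar>w \<bullet> \<tau>\<bar> + \<mu> * \<bar>(c - x) \<bullet> \<tau>\<bar>"
        using abs_triangle_ineq4[of "w \<bullet> \<tau>" "\<mu> * ((c - x) \<bullet> \<tau>)"] \<mu>0 by (simp add: abs_mult)
      also have "\<dots> \<le> norm w + norm w / k * norm (c - x)"
        using 1 \<mu>0 \<mu>1 by (intro add_mono mult_mono) auto
      finally have "\<bar>\<theta>\<bar> \<le> (norm w + norm w / k * norm (c - x)) / L"
        unfolding \<theta>_def using pos by (simp add: divide_right_mono)
      then show ?thesis by (simp add: add_divide_distrib)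
    qed
    have "w - \<mu> *\<^sub>R (c - x) - (\<theta> * L) *\<^sub>R \<tau> = 0"
    proof -
      define u where "u = c - x"
      let ?v = "w - \<mu> *\<^sub>R (c - x) - (\<theta> * L) *\<^sub>R \<tau>"
      have "?v \<bullet> n = 0" unfolding u_def[symmetric] inner_commute[of _ n]
        using kx[folded u_def] pos \<tau> by (simp add: inner_diff_right \<mu>_def)
      moreover have "?v \<bullet> \<tau> = 0" unfolding \<theta>_def u_def[symmetric]
        using pos \<tau> norm_eq_1[of \<tau>] by (simp add: inner_diff_left)
      ultimately show ?thesis using orthonormal_expansion[OF \<tau>(1) n(1) \<tau>(2), of ?v] by simp
    qed
    then have "w = \<mu> *\<^sub>R (c - x) + \<theta> *\<^sub>R (b - a)"
      unfolding \<tau>(3) by (simp add: algebra_simps)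
    then have "x + w = ((1 - t) * (1 - \<mu>) - \<theta>) *\<^sub>R a + (t * (1 - \<mu>) + \<theta>) *\<^sub>R b + \<mu> *\<^sub>R c"
      unfolding x by (simp add: algebra_simps)
    moreover have "\<bar>\<theta>\<bar> + \<mu> \<le> s"
    proof -
      have "\<bar>\<theta>\<bar> + \<mu> \<le> norm w * K"
        using \<theta>1 \<mu>1 unfolding K_def by (simp add: distrib_left)
      also have "\<dots> \<le> s" using w K by (simp add: pos_less_divide_eq)
      finally show ?thesis .
    qed
    moreover have "\<bar>\<theta>\<bar> \<le> t * (1 - \<mu>)" "\<bar>\<theta>\<bar> \<le> (1 - t) * (1 - \<mu>)"
    proof -
      have "t * \<mu> \<le> \<mu>" "(1 - t) * \<mu> \<le> \<mu>" using t \<mu>0 by (auto intro: mult_left_le_one_le)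
      then show "\<bar>\<theta>\<bar> \<le> t * (1 - \<mu>)" "\<bar>\<theta>\<bar> \<le> (1 - t) * (1 - \<mu>)"
        using \<open>\<bar>\<theta>\<bar> + \<mu> \<le> s\<close> s unfolding right_diff_distrib mult_1_right by linarith+
    qed
    ultimately show "x + w \<in> convex hull {a, b, c}"
      unfolding convex_hull_3 using \<mu>0
      by (intro CollectI exI[of _ "(1 - t) * (1 - \<mu>) - \<theta>"] exI[of _ "t * (1 - \<mu>) + \<theta>"] exI[of _ \<mu>])
        (auto simp: algebra_simps abs_le_iff)
  qed
qed

text \<open>Affine independence keeps the third vertex off the line of the edge, so the unit normal
  can be oriented inwards.\<close>

lemma triangle_edge:
  fixes V :: "(real^2) set"
  assumes V: "card V = 3" "\<not> affine_dependent V" and E: "E \<in> edges_of V" "E = {a, b}"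
  obtains c n where "V = {a, b, c}" "a \<noteq> b" "c \<noteq> a" "c \<noteq> b" "norm n = 1" "n \<bullet> (b - a) = 0" "n \<bullet> (c - a) > 0"
proof -
  have ab: "a \<noteq> b" "E \<subseteq> V" using E by (auto simp: edges_of_def card_insert_if)
  have finV: "finite V" using V by (metis card.infinite zero_neq_numeral)
  have "card (V - E) = 1"
    using ab V E by (simp add: card_Diff_subset edges_of_def finite_subset[OF _ finV])
  then obtain c where c: "V - E = {c}" by (auto simp: card_1_singleton_iff)
  then have Vc: "V = {a, b, c}" "c \<noteq> a" "c \<noteq> b" using ab E by auto
  define m where "m = perp ((1 / norm (b - a)) *\<^sub>R (b - a))"
  have m: "norm m = 1" "m \<bullet> (b - a) = 0"
  proof -
    show "norm m = 1" unfolding m_def norm_perp using ab by simp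
    have "b - a = norm (b - a) *\<^sub>R ((1 / norm (b - a)) *\<^sub>R (b - a))" using ab by simp
    then show "m \<bullet> (b - a) = 0" unfolding m_def by (metis inner_perp(2) inner_scaleR_right mult_zero_right)
  qed
  have "m \<bullet> (c - a) \<noteq> 0"
  proof
    assume 0: "m \<bullet> (c - a) = 0"
    let ?\<tau> = "(1 / norm (b - a)) *\<^sub>R (b - a)"
    have "c - a = ((c - a) \<bullet> ?\<tau>) *\<^sub>R ?\<tau>"
      using orthonormal_expansion[of ?\<tau> m "c - a"] m ab 0 by (simp add: inner_commute)
    then obtain u where "c - a = u *\<^sub>R (b - a)" by (metis scaleR_scaleR)
    then have "c = (1 - u) *\<^sub>R a + u *\<^sub>R b" by (simp add: algebra_simps add_eq_0_iff diff_eq_eq)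
    then have "collinear {a, c, b}" unfolding collinear_3_expand
      by (intro disjI2 exI[of _ "1 - u"]) simp
    then have "affine_dependent {a, c, b}"
      unfolding collinear_3_eq_affine_dependent using ab Vc by auto
    then show False using V(2) Vc by (simp add: insert_commute)
  qed
  then consider "m \<bullet> (c - a) > 0" | "(- m) \<bullet> (c - a) > 0" by fastforce
  then show thesis
    using that[OF Vc(1) ab(1) Vc(2,3), of m] that[OF Vc(1) ab(1) Vc(2,3), of "- m"] m by cases auto
qed

lemma triangle_in_halfplane:
  fixes a b c n :: "real^2"
  assumes "n \<bullet> (b - a) = 0" "n \<bullet> (c - a) > 0" "x = (1 - t) *\<^sub>R a + t *\<^sub>R b" "y \<in> convex hull {a, b, c}"
  shows "n \<bullet> (y - x) \<ge> 0"
proof -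
  obtain u v w where y: "y = u *\<^sub>R a + v *\<^sub>R b + w *\<^sub>R c" "0 \<le> u" "0 \<le> v" "0 \<le> w" "u + v + w = 1"
    using assms(4) unfolding convex_hull_3 by blast
  have u: "u = 1 - v - w" using y by linarith
  have "y - x = (v - t) *\<^sub>R (b - a) + w *\<^sub>R (c - a)"
    unfolding y assms(3) u by (simp add: algebra_simps)
  then have "n \<bullet> (y - x) = w * (n \<bullet> (c - a))"
    using assms(1) by (simp add: inner_add_right)
  then show ?thesis using y assms(2) by simp
qed

lemma halfplane_interior:
  fixes n :: "real^2"
  assumes "norm n = 1" "\<And>y. y \<in> T \<Longrightarrow> n \<bullet> (y - x) \<ge> 0" "y \<in> interior T"
  shows "n \<bullet> (y - x) > 0"
proof -
  obtain e where e: "e > 0" "ball y e \<subseteq> T" using assms(3) by (auto simp: mem_interior)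
  have "y - (e / 2) *\<^sub>R n \<in> ball y e" using e assms(1) by (simp add: dist_norm)
  then have "n \<bullet> (y - (e / 2) *\<^sub>R n - x) \<ge> 0" using e assms(2) by blast
  moreover have "n \<bullet> n = 1" using assms(1) by (simp add: norm_eq_1)
  ultimately have "n \<bullet> (y - x) \<ge> e / 2" by (simp add: inner_diff_right)
  then show ?thesis using e by linarith
qed

text \<open>For \<open>d = 0\<close> the last hypothesis is exactly membership in the disc tangent
  at \<open>x\<close>. For \<open>d > 0\<close> the disc is pushed back by \<open>d\<close> along
  \<nu>, and the bound on the length of \<open>w\<close> ensures that a short vector entering the
  tangent disc at \<open>x\<close> is still caught.\<close>

lemma mem_ball_tangent:
  fixes w \<nu> :: "'a::real_inner"
  assumes "norm \<nu> = 1" "0 \<le> d" "d \<le> R" "2 * norm w \<le> R" "(norm w)\<^sup>2 < 2 * R * (w \<bullet> \<nu>)"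
  shows "x + w \<in> ball (x + (R - d) *\<^sub>R \<nu>) R"
proof -
  have R: "R \<ge> 0" using assms by linarith
  have "w \<bullet> \<nu> \<le> norm w" using norm_cauchy_schwarz[of w \<nu>] assms(1) by simp
  then have "2 * (w \<bullet> \<nu>) \<le> 2 * R - d" using assms by linarith
  then have 1: "d * (2 * (w \<bullet> \<nu>)) \<le> d * (2 * R - d)" using assms by (intro mult_left_mono)
  have "\<nu> \<bullet> \<nu> = 1" using assms by (simp add: norm_eq_1)
  then have "(norm (w - (R - d) *\<^sub>R \<nu>))\<^sup>2 = (norm w)\<^sup>2 - 2 * (R - d) * (w \<bullet> \<nu>) + (R - d) * (R - d)"
    unfolding power2_norm_eq_inner by (simp add: inner_diff_left inner_diff_right inner_commute)
  also have "\<dots> < 2 * R * (w \<bullet> \<nu>) - 2 * (R - d) * (w \<bullet> \<nu>) + (R - d) * (R - d)"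
    using assms(5) by simp
  also have "\<dots> = d * (2 * (w \<bullet> \<nu>)) + (R - d) * (R - d)" by (simp add: algebra_simps)
  also have "\<dots> \<le> d * (2 * R - d) + (R - d) * (R - d)" using 1 by simp
  also have "\<dots> = R\<^sup>2" by (simp add: algebra_simps power2_eq_square)
  finally have "norm (w - (R - d) *\<^sub>R \<nu>) < R" using R by (rule power_less_imp_less_base)
  moreover have "dist (x + (R - d) *\<^sub>R \<nu>) (x + w) = norm (w - (R - d) *\<^sub>R \<nu>)"
    by (simp add: dist_norm norm_minus_commute[of w])
  ultimately show ?thesis by simp
qed

text \<open>The disc is found by moving from \<open>x\<close> along the edge, in the direction in which \<open>\<nu>\<close> points,
  and then a little towards the incentre \<open>c\<close>. As \<open>\<nu>\<close> does not point out of \<open>T\<close> across the edge,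
  one of the two displacements enters the tangent disc at a definite rate.\<close>

lemma fat_disc_in_tangent_disc:
  fixes x c \<tau> n \<nu> :: "real^2"
  assumes T: "convex T" "cball c \<rho> \<subseteq> T" "x + l *\<^sub>R \<tau> \<in> T" "x - l *\<^sub>R \<tau> \<in> T"
    and T2: "\<And>y. y \<in> T \<Longrightarrow> norm (y - x) \<le> H" "\<And>y. y \<in> T \<Longrightarrow> n \<bullet> (y - x) \<ge> 0"
    and on: "norm \<tau> = 1" "norm n = 1" "n \<bullet> \<tau> = 0" "norm \<nu> = 1" "\<nu> \<bullet> n \<ge> 0"
    and \<rho>: "\<rho> > 0" "H \<le> \<kappa> * \<rho>" and l: "l > 0" and R: "H \<le> R" "0 \<le> d" "d \<le> R"
  shows "\<exists>z. ball z (l / (100 * \<kappa>\<^sup>2)) \<subseteq> T \<inter> ball (x + (R - d) *\<^sub>R \<nu>) R \<and> norm (z - x) \<le> l \<and> \<kappa> \<ge> 1"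
proof -
  have lH: "l \<le> H" using T2(1)[OF T(3)] on l by simp
  \<comment> \<open>The point of the inscribed disc that is lowest in direction \<open>n\<close>
    still lies above the edge.\<close>
  have q: "n \<bullet> (c - x) \<ge> \<rho>"
  proof -
    have "c - \<rho> *\<^sub>R n \<in> T" using T(2) on \<rho> by (auto simp: dist_norm)
    from T2(2)[OF this] have "n \<bullet> (c - x) - \<rho> * (n \<bullet> n) \<ge> 0" by (simp add: inner_diff_right)
    then show ?thesis using on by (simp add: norm_eq_1)
  qed
  have cT: "c \<in> T" using T(2) \<rho> by auto
  have cx: "norm (c - x) \<le> H" using T2(1)[OF cT] .
  have H: "H > 0" using lH l by linarith
  have "n \<bullet> (c - x) \<le> norm (c - x)" using norm_cauchy_schwarz[of n "c - x"] on by simp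
  then have "1 * \<rho> \<le> \<kappa> * \<rho>" using q cx \<rho> by linarith
  then have \<kappa>: "\<kappa> \<ge> 1" using \<rho> by (simp only: mult_le_cancel_right)
  \<comment> \<open>Solves \<open>25 * e^2 = e / (2 * \<kappa>)\<close>: the square of a
    displacement of length at most \<open>5 * e * l\<close> is then outweighed by the gain in
    direction \<nu>.\<close>
  define e where "e = 1 / (50 * \<kappa>)"
  have e: "e > 0" "e \<le> 1 / 50" using \<kappa> by (auto simp: e_def field_simps)
  \<comment> \<open>Division by \<open>H\<close> makes the move towards the incentre at most
    \<open>e * l\<close> long, however large the element is in comparison with
    \<open>l\<close>.\<close>
  define \<beta> where "\<beta> = e * l / H"
  have "l / H \<le> 1" using lH H by simp
  then have "e * (l / H) \<le> e * 1" using e by (intro mult_left_mono) auto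
  then have \<beta>: "\<beta> > 0" "\<beta> \<le> e" using e l H by (simp_all add: \<beta>_def)
  have \<beta>H: "\<beta> * H = e * l" using H by (simp add: \<beta>_def)
  \<comment> \<open>Half of the guaranteed progress \<open>e * l / \<kappa>\<close> in direction
    \<nu>, so that a perturbation of this size keeps the other half.\<close>
  define \<delta> where "\<delta> = l / (100 * \<kappa>\<^sup>2)"
  have \<delta>: "\<delta> = e * l / (2 * \<kappa>)" by (simp add: \<delta>_def e_def power2_eq_square)
  have el: "e * l > 0" using e l by simp
  have \<delta>1: "\<delta> \<le> e * l / 2" "\<delta> > 0"
  proof -
    show "\<delta> \<le> e * l / 2" unfolding \<delta> by (rule divide_left_mono) (use el \<kappa> in auto)
    show "\<delta> > 0" unfolding \<delta> using el \<kappa> by simp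
  qed
  define a where "a = \<nu> \<bullet> \<tau>"
  define b where "b = \<nu> \<bullet> n"
  define \<sigma> where "\<sigma> = (if a \<ge> 0 then 1 else - 1 :: real)"
  have \<sigma>: "\<sigma> * a = \<bar>a\<bar>" "\<bar>\<sigma>\<bar> = 1" by (auto simp: \<sigma>_def)
  have A: "x + (\<sigma> * l) *\<^sub>R \<tau> \<in> T" using T by (simp add: \<sigma>_def)
  have x: "x \<in> T"
  proof -
    have "x = (1/2) *\<^sub>R (x + l *\<^sub>R \<tau>) + (1/2) *\<^sub>R (x - l *\<^sub>R \<tau>)" 
      by (simp add: algebra_simps flip: scaleR_add_left)
    also have "\<dots> \<in> T" using T by (intro convexD) auto
    finally show ?thesis .
  qed
  \<comment> \<open>The factor 3 lets the move along the edge outweigh the tangential part of the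
    move towards \<open>c\<close>, which may cost up to
    \<open>e * l * \<bar>a\<bar>\<close>.\<close>
  define w where "w = (3 * e * (\<sigma> * l)) *\<^sub>R \<tau> + \<beta> *\<^sub>R (c - x)"
  \<comment> \<open>Since \<nu> is a unit vector with \<open>b \<ge> 0\<close>, its tangential and
    normal parts cannot both be small; so at least one of the two moves makes progress.\<close>
  have ab: "\<bar>a\<bar> + b \<ge> 1"
  proof -
    have \<nu>: "\<nu> = a *\<^sub>R \<tau> + b *\<^sub>R n"
      unfolding a_def b_def using orthonormal_expansion[OF on(1-3)] .
    have "norm \<nu> \<le> norm (a *\<^sub>R \<tau>) + norm (b *\<^sub>R n)" by (subst \<nu>) (rule norm_triangle_ineq)
    then show ?thesis using on by (simp add: b_def)
  qed
  have w\<nu>: "w \<bullet> \<nu> \<ge> e * l / \<kappa>"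
  proof -
    define p where "p = (c - x) \<bullet> \<tau>"
    define q' where "q' = (c - x) \<bullet> n"
    have p: "\<bar>p\<bar> \<le> H" unfolding p_def using Cauchy_Schwarz_ineq2[of "c - x" \<tau>] on cx by simp
    have q': "q' \<ge> H / \<kappa>"
    proof -
      have "H / \<kappa> \<le> \<rho>" using \<rho> \<kappa> by (simp add: divide_le_eq mult.commute)
      then show ?thesis using q by (simp add: q'_def inner_commute)
    qed
    have "c - x = p *\<^sub>R \<tau> + q' *\<^sub>R n" unfolding p_def q'_def by (rule orthonormal_expansion[OF on(1-3)])
    then have "(c - x) \<bullet> \<nu> = p * a + q' * b"
      by (simp add: inner_add_left inner_add_right a_def b_def inner_commute)
    then have eq: "w \<bullet> \<nu> = 3 * e * l * \<bar>a\<bar> + \<beta> * (p * a) + \<beta> * (q' * b)"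
      using \<sigma>(1) by (simp add: w_def inner_add_left distrib_left a_def inner_commute[of \<tau>] mult_ac)
    have 1: "\<beta> * (p * a) \<ge> - (e * l * \<bar>a\<bar>)"
    proof -
      have "\<bar>p * a\<bar> \<le> H * \<bar>a\<bar>" unfolding abs_mult using p by (intro mult_right_mono) auto
      then have "- (H * \<bar>a\<bar>) \<le> p * a" by linarith
      then have "\<beta> * (- (H * \<bar>a\<bar>)) \<le> \<beta> * (p * a)" using \<beta> by (intro mult_left_mono) auto
      moreover have "\<beta> * (- (H * \<bar>a\<bar>)) = - (e * l * \<bar>a\<bar>)" unfolding \<beta>H[symmetric] by simp
      ultimately show ?thesis by metis
    qed
    have 2: "\<beta> * (q' * b) \<ge> e * l / \<kappa> * b"
    proof -
      have "(\<beta> * H) / \<kappa> * b = \<beta> * (H / \<kappa> * b)" by simp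
      also have "\<dots> \<le> \<beta> * (q' * b)"
        using \<beta> q' on(5) by (intro mult_left_mono mult_right_mono) (auto simp: b_def)
      finally show ?thesis unfolding \<beta>H .
    qed
    have "e * l / \<kappa> * 1 \<le> e * l / \<kappa> * (\<bar>a\<bar> + b)"
      using ab el \<kappa> by (intro mult_left_mono) auto
    also have "\<dots> \<le> e * l * \<bar>a\<bar> + e * l / \<kappa> * b"
    proof -
      have "e * l / \<kappa> \<le> e * l / 1" using el \<kappa> by (intro divide_left_mono) auto
      then have "e * l / \<kappa> \<le> e * l" by simp
      then have "e * l / \<kappa> * \<bar>a\<bar> \<le> e * l * \<bar>a\<bar>" by (intro mult_right_mono) auto
      then show ?thesis by (simp add: distrib_left)
    qed
    also have "\<dots> \<le> w \<bullet> \<nu>"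
    proof -
      have "e * l * \<bar>a\<bar> \<ge> 0" using el by simp
      then show ?thesis using eq 1 2 by simp
    qed
    finally show ?thesis by simp
  qed
  have nw: "norm w \<le> 4 * (e * l)"
  proof -
    have "norm w \<le> norm ((3 * e * (\<sigma> * l)) *\<^sub>R \<tau>) + norm (\<beta> *\<^sub>R (c - x))"
      unfolding w_def by (rule norm_triangle_ineq)
    also have "\<dots> = 3 * (e * l) + \<beta> * norm (c - x)"
      using e l \<sigma> on \<beta> by (simp add: abs_mult)
    also have "\<dots> \<le> 3 * (e * l) + \<beta> * H" using cx \<beta> by simp
    finally show ?thesis unfolding \<beta>H by simp
  qed
  have el50: "e * l \<le> l / 50" using e l mult_right_mono[of e "1/50" l] by simp
  have sub: "x + w + v \<in> T \<and> x + w + v \<in> ball (x + (R - d) *\<^sub>R \<nu>) R" if v: "norm v < \<delta>" for v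
  proof
    have "norm ((1 / \<beta>) *\<^sub>R v) \<le> \<rho>"
    proof -
      have "\<delta> = \<beta> * (H / (2 * \<kappa>))" unfolding \<delta> \<beta>H[symmetric] by simp
      also have "\<dots> \<le> \<beta> * \<rho>"
      proof (rule mult_left_mono)
        have "H \<le> \<rho> * (2 * \<kappa>)" using \<rho> \<kappa> H by (simp add: mult_ac)
        then show "H / (2 * \<kappa>) \<le> \<rho>" using \<kappa> by (simp add: divide_le_eq)
      qed (use \<beta> in simp)
      finally have "norm v \<le> \<beta> * \<rho>" using v by linarith
      then show ?thesis using \<beta> by (simp add: divide_le_eq mult.commute)
    qed
    then have c': "c + (1 / \<beta>) *\<^sub>R v \<in> T" using T(2) by (auto simp: dist_norm)
    let ?S = "{x, x + (\<sigma> * l) *\<^sub>R \<tau>, c + (1 / \<beta>) *\<^sub>R v}"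
    \<comment> \<open>The perturbation is absorbed by the third point: moving it by
      \<open>v / \<beta>\<close> keeps it in the inscribed disc.\<close>
    have "x + w + v = (1 - 3 * e - \<beta>) *\<^sub>R x + (3 * e) *\<^sub>R (x + (\<sigma> * l) *\<^sub>R \<tau>)
        + \<beta> *\<^sub>R (c + (1 / \<beta>) *\<^sub>R v)"
      using \<beta> by (simp add: w_def algebra_simps)
    then have "x + w + v \<in> convex hull ?S"
      unfolding convex_hull_3 using e \<beta>
      by (intro CollectI exI[of _ "1 - 3 * e - \<beta>"] exI[of _ "3 * e"] exI[of _ \<beta>]) simp
    also have "\<dots> \<subseteq> T" using x A c' T(1) by (intro hull_minimal) auto
    finally show "x + w + v \<in> T" .
    have nwv: "norm (w + v) \<le> 5 * (e * l)"
      using norm_triangle_ineq[of w v] nw v \<delta>1 el by linarith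
    have "\<bar>v \<bullet> \<nu>\<bar> \<le> \<delta>" using Cauchy_Schwarz_ineq2[of v \<nu>] on v by simp
    then have wv: "(w + v) \<bullet> \<nu> \<ge> e * l / (2 * \<kappa>)"
      using w\<nu> unfolding \<delta> inner_add_left by (simp add: field_simps)
    have "(norm (w + v))\<^sup>2 \<le> (5 * (e * l))\<^sup>2" using nwv by (intro power_mono) auto
    also have "\<dots> = (e * l / (2 * \<kappa>)) * l"
      using \<kappa> by (simp add: power2_eq_square e_def)
    also have "\<dots> < (e * l / (2 * \<kappa>)) * (2 * R)"
      using el \<kappa> l lH R by (intro mult_strict_left_mono) auto
    also have "\<dots> \<le> (w + v) \<bullet> \<nu> * (2 * R)"
      using wv R H by (intro mult_right_mono) auto
    finally have "(norm (w + v))\<^sup>2 < 2 * R * ((w + v) \<bullet> \<nu>)" by (simp add: mult_ac)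
    moreover have "2 * norm (w + v) \<le> R" using nwv el50 lH R l by linarith
    ultimately show "x + w + v \<in> ball (x + (R - d) *\<^sub>R \<nu>) R"
      using mem_ball_tangent[OF on(4) R(2,3)] by (simp add: add.assoc)
  qed
  have "ball (x + w) \<delta> \<subseteq> T \<inter> ball (x + (R - d) *\<^sub>R \<nu>) R"
  proof
    fix y assume "y \<in> ball (x + w) \<delta>"
    then have "norm (y - (x + w)) < \<delta>" by (simp add: dist_norm norm_minus_commute)
    from sub[OF this] show "y \<in> T \<inter> ball (x + (R - d) *\<^sub>R \<nu>) R" by simp
  qed
  moreover have "norm (x + w - x) \<le> l" using nw el50 l by (simp only: add_diff_cancel_left')
  ultimately show ?thesis using \<kappa> unfolding \<delta>_def by blast
qed

section \<open>Tangent discs of the interface\<close>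

lemma cnormal_eq_perp: "cnormal g t = perp (ctan g t)"
  by (simp add: cnormal_def perp_def)

lemma regular_curve_derivative:
  assumes "regular_simple_closed_C2 g"
  shows "(g has_vector_derivative vector_derivative g (at t)) (at t)"
    and "vector_derivative g (at t) \<noteq> 0"
    and "continuous_on UNIV (\<lambda>t. vector_derivative g (at t))"
    and "continuous_on UNIV g"
proof -
  obtain g' g'' where g: "\<And>t. (g has_vector_derivative g' t) (at t)"
    "\<And>t. (g' has_vector_derivative g'' t) (at t)" "\<And>t. g' t \<noteq> 0"
    using assms unfolding regular_simple_closed_C2_def by blast
  have eq: "vector_derivative g (at t) = g' t" for t
    using g(1) by (rule vector_derivative_at)
  have cont: "continuous_on UNIV f" if "\<And>t. (f has_vector_derivative f' t) (at t)"
    for f :: "real \<Rightarrow> real^2" and f'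
    using that by (meson continuous_at_imp_continuous_on has_vector_derivative_continuous)
  show "(g has_vector_derivative vector_derivative g (at t)) (at t)"
    "vector_derivative g (at t) \<noteq> 0" "continuous_on UNIV (\<lambda>t. vector_derivative g (at t))"
    "continuous_on UNIV g"
    unfolding eq using g cont[of g', OF g(2)] cont[of g, OF g(1)] by auto
qed

lemma norm_ctan: "regular_simple_closed_C2 g \<Longrightarrow> norm (ctan g t) = 1"
  using regular_curve_derivative(2) by (simp add: ctan_def norm_sgn)

lemma regular_curve_parameter:
  assumes "regular_simple_closed_C2 g"
  shows "\<exists>s\<in>{0..<1}. g s = g t"
proof -
  have per: "\<And>t. g (t + 1) = g t" using assms unfolding regular_simple_closed_C2_def by blast
  have nat: "g (t + real k) = g t" for t k
  proof (induction k)
    case (Suc k)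
    then show ?case using per[of "t + real k"] by (simp add: ac_simps)
  qed simp
  have "g (frac t) = g t"
  proof (cases "\<lfloor>t\<rfloor> \<ge> 0")
    case True
    have "frac t + real (nat \<lfloor>t\<rfloor>) = t" using True by (simp add: frac_def)
    then show ?thesis using nat[of "frac t" "nat \<lfloor>t\<rfloor>"] by simp
  next
    case False
    have "t + real (nat (- \<lfloor>t\<rfloor>)) = frac t" using False by (simp add: frac_def)
    then show ?thesis using nat[of t "nat (- \<lfloor>t\<rfloor>)"] by simp
  qed
  then show ?thesis using frac_lt_1[of t] by (intro bexI[of _ "frac t"]) auto
qed

lemma compact_range_regular_curve:
  assumes "regular_simple_closed_C2 g"
  shows "compact (range g)"
proof -
  have "range g = g ` {0..1}"
  proof
    show "range g \<subseteq> g ` {0..1}"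
    proof
      fix y assume "y \<in> range g"
      then obtain t where "y = g t" by blast
      then obtain s where "s \<in> {0..<1}" "y = g s" using regular_curve_parameter[OF assms, of t] by metis
      then show "y \<in> g ` {0..1}" by auto
    qed
  qed auto
  moreover have "compact (g ` {0..1})"
    using regular_curve_derivative(4)[OF assms]
    by (intro compact_continuous_image) (auto intro: continuous_on_subset)
  ultimately show ?thesis by simp
qed

text \<open>At a nearest parameter the derivative of the squared distance vanishes, so
  \<open>x - g t\<close> is orthogonal to the tangent. Periodicity puts the parameter in the
  fundamental interval, while the curve is defined on the whole line, so no boundary case
  arises.\<close>

lemma nearest_point_of_curve:
  assumes g: "regular_simple_closed_C2 g"
  obtains t l where "t \<in> {0..<1}" "\<And>s. dist x (g t) \<le> dist x (g s)"
    "x = g t + l *\<^sub>R cnormal g t" "\<bar>l\<bar> = dist x (g t)"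
proof -
  obtain y where y: "y \<in> range g" "\<And>z. z \<in> range g \<Longrightarrow> dist x y \<le> dist x z"
    using distance_attains_inf[of "range g" x] compact_range_regular_curve[OF g] compact_imp_closed
    by blast
  then obtain t where t: "t \<in> {0..<1}" "g t = y"
    using regular_curve_parameter[OF g] by blast
  let ?f = "\<lambda>s. (g s - x) \<bullet> (g s - x)"
  let ?v = "vector_derivative g (at t)"
  have "((\<lambda>s. g s - x) has_vector_derivative ?v) (at t)"
    using has_vector_derivative_diff[OF regular_curve_derivative(1)[OF g, of t] has_vector_derivative_const]
    by simp
  from bounded_bilinear.has_vector_derivative[OF bounded_bilinear_inner this this]
  have der: "(?f has_real_derivative ((g t - x) \<bullet> ?v + ?v \<bullet> (g t - x))) (at t)"
    by (simp add: has_real_derivative_iff_has_vector_derivative)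
  have "?f t \<le> ?f s" for s
  proof -
    have "(dist x (g t))\<^sup>2 \<le> (dist x (g s))\<^sup>2" using y t by (intro power_mono) auto
    then show ?thesis by (simp add: dist_norm norm_minus_commute flip: power2_norm_eq_inner)
  qed
  then have "(g t - x) \<bullet> ?v + ?v \<bullet> (g t - x) = 0"
    by (intro DERIV_local_min[OF der, of 1]) auto
  then have "(x - g t) \<bullet> ?v = 0" by (simp add: inner_commute inner_diff_left)
  then have 0: "(x - g t) \<bullet> ctan g t = 0" by (simp add: ctan_def sgn_div_norm)
  have n: "norm (ctan g t) = 1" "norm (cnormal g t) = 1" "cnormal g t \<bullet> ctan g t = 0"
    using norm_ctan[OF g] by (simp_all add: cnormal_eq_perp)
  define l where "l = (x - g t) \<bullet> cnormal g t"
  have e: "x - g t = l *\<^sub>R cnormal g t"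
    using orthonormal_expansion[OF n, of "x - g t"] 0 by (simp add: l_def)
  show thesis
  proof
    show "t \<in> {0..<1}" by fact
    show "dist x (g t) \<le> dist x (g s)" for s using y t by auto
    show "x = g t + l *\<^sub>R cnormal g t" unfolding e[symmetric] by simp
    show "\<bar>l\<bar> = dist x (g t)" unfolding dist_norm e using n by simp
  qed
qed

lemma mem_normal_segment:
  fixes P n :: "'a::real_vector"
  assumes "\<bar>l\<bar> \<le> r" "r > 0"
  shows "P + l *\<^sub>R n \<in> closed_segment (P - r *\<^sub>R n) (P + r *\<^sub>R n)"
proof -
  define u where "u = (l + r) / (2 * r)"
  have "0 \<le> u" "u \<le> 1" using assms by (auto simp: u_def)
  moreover have "P + l *\<^sub>R n = (1 - u) *\<^sub>R (P - r *\<^sub>R n) + u *\<^sub>R (P + r *\<^sub>R n)"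
  proof -
    have "l = (2 * u - 1) * r" using assms by (simp add: u_def field_simps)
    then have "l *\<^sub>R n = (2 * u - 1) *\<^sub>R (r *\<^sub>R n)" by simp
    moreover have "(1 - u) *\<^sub>R (P - v) + u *\<^sub>R (P + v) = P + (2 * u - 1) *\<^sub>R v" for v
    proof -
      have "2 * u - 1 = u + u - 1" by simp
      then have "(2 * u - 1) *\<^sub>R v = u *\<^sub>R v + u *\<^sub>R v - v"
        by (simp only: scaleR_left_diff_distrib scaleR_left_distrib scaleR_one)
      then show ?thesis by (simp add: scaleR_diff_left scaleR_diff_right scaleR_add_right)
    qed
    ultimately show ?thesis by simp
  qed
  ultimately show ?thesis unfolding closed_segment_def by blast
qed

text \<open>A curve point in the disc would yield a nearest point, whose normal segment contains the
  centre just as the normal segment of \<open>g t\<close> does.\<close>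

lemma normal_disc_disjoint_curve:
  assumes g: "regular_simple_closed_C2 g" and r: "disjoint_normals g r" "r > 0"
    and t: "t \<in> {0..<1}" and \<sigma>: "\<bar>\<sigma>\<bar> = 1"
  shows "ball (g t + (\<sigma> * r) *\<^sub>R cnormal g t) r \<inter> range g = {}"
proof (rule ccontr)
  let ?c = "g t + (\<sigma> * r) *\<^sub>R cnormal g t"
  assume "\<not> ?thesis"
  then obtain q where q: "dist ?c (g q) < r" by auto
  obtain s l where s: "s \<in> {0..<1}" "\<And>u. dist ?c (g s) \<le> dist ?c (g u)"
    "?c = g s + l *\<^sub>R cnormal g s" "\<bar>l\<bar> = dist ?c (g s)"
    using nearest_point_of_curve[OF g, of ?c] by blast
  have "\<bar>l\<bar> < r" using s(2)[of q] s(4) q by linarith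
  then have "?c \<in> closed_segment (g s - r *\<^sub>R cnormal g s) (g s + r *\<^sub>R cnormal g s)"
    using mem_normal_segment[of l r "g s"] r s(3) by simp
  moreover have "?c \<in> closed_segment (g t - r *\<^sub>R cnormal g t) (g t + r *\<^sub>R cnormal g t)"
    using r \<sigma> by (intro mem_normal_segment) (auto simp: abs_mult)
  ultimately have "s = t" using r(1) s(1) t unfolding disjoint_normals_def by blast
  moreover have "dist ?c (g t) = r"
    using \<sigma> r norm_ctan[OF g] by (simp add: dist_norm cnormal_eq_perp abs_mult)
  ultimately show False using s(4) \<open>\<bar>l\<bar> < r\<close> by simp
qed

text \<open>\<open>d\<close> is the distance of \<open>x\<close> from the curve. If it is at most
  \<open>r\<close>, the disc of radius \<open>r\<close> that touches the curve at the nearest point,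
  on the side of \<open>x\<close>, contains \<open>x\<close> at depth \<open>d\<close>. Otherwise
  the disc of radius \<open>d\<close> about \<open>x\<close> itself is large enough, and then
  \<open>R = d\<close>.\<close>

lemma tangent_disc_disjoint_curve:
  assumes g: "regular_simple_closed_C2 g" and r: "disjoint_normals g r" "r > 0" and x: "x \<notin> range g"
  obtains \<nu> R d where "norm \<nu> = 1" "r \<le> R" "0 < d" "d \<le> R" "ball (x + (R - d) *\<^sub>R \<nu>) R \<inter> range g = {}"
proof -
  obtain t l where t: "t \<in> {0..<1}" "\<And>u. dist x (g t) \<le> dist x (g u)"
    "x = g t + l *\<^sub>R cnormal g t" "\<bar>l\<bar> = dist x (g t)"
    using nearest_point_of_curve[OF g, of x] by blast
  have n: "norm (cnormal g t) = 1" using norm_ctan[OF g] by (simp add: cnormal_eq_perp)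
  have l: "\<bar>l\<bar> > 0" using x t(4) by force
  show thesis
  proof (cases "\<bar>l\<bar> \<le> r")
    case True
    have "(r - \<bar>l\<bar>) * sgn l + l = sgn l * r" 
      by (cases l "0::real" rule: linorder_cases) auto
    then have "l *\<^sub>R cnormal g t + (r - \<bar>l\<bar>) *\<^sub>R (sgn l *\<^sub>R cnormal g t) = (sgn l * r) *\<^sub>R cnormal g t"
      by (simp only: scaleR_scaleR scaleR_add_left[symmetric] add.commute)
    then have "x + (r - \<bar>l\<bar>) *\<^sub>R (sgn l *\<^sub>R cnormal g t) = g t + (sgn l * r) *\<^sub>R cnormal g t"
      by (subst t(3)) (simp add: add.assoc)
    moreover have "\<bar>sgn l\<bar> = 1" using l by (simp add: abs_sgn_eq)
    ultimately have "ball (x + (r - \<bar>l\<bar>) *\<^sub>R (sgn l *\<^sub>R cnormal g t)) r \<inter> range g = {}"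
      using normal_disc_disjoint_curve[OF g r t(1), of "sgn l"] by simp
    moreover have "norm (sgn l *\<^sub>R cnormal g t) = 1" using n l by (simp add: abs_sgn_eq)
    ultimately show ?thesis using that[of "sgn l *\<^sub>R cnormal g t" r "\<bar>l\<bar>"] l True by simp
  next
    case False
    have "ball x \<bar>l\<bar> \<inter> range g = {}" 
    proof -
      have "\<not> dist x (g u) < \<bar>l\<bar>" for u using t(2)[of u] t(4) by linarith
      then show ?thesis by auto
    qed
    then show ?thesis using that[of "cnormal g t" "\<bar>l\<bar>" "\<bar>l\<bar>"] n l False by simp
  qed
qed

text \<open>If the normal of the curve at \<open>x\<close> were not orthogonal to the segment,
  points of the segment close to \<open>x\<close> would enter one of the two discs tangent at
  \<open>x\<close>, although they lie on the curve. So \<open>n\<close> is the curve normal up to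
  sign, and both tangent discs are free of the curve.\<close>

lemma tangent_disc_at_segment:
  assumes g: "regular_simple_closed_C2 g" and r: "disjoint_normals g r" "r > 0"
    and x: "x \<in> range g" and e: "e > 0" and seg: "\<And>s. \<bar>s\<bar> < e \<Longrightarrow> x + s *\<^sub>R \<tau> \<in> range g"
    and on: "norm \<tau> = 1" "norm n = 1" "n \<bullet> \<tau> = 0"
  shows "ball (x + r *\<^sub>R n) r \<inter> range g = {}"
proof -
  obtain t where t: "t \<in> {0..<1}" "g t = x" using x regular_curve_parameter[OF g] by blast
  let ?m = "cnormal g t"
  have m: "norm ?m = 1" using norm_ctan[OF g] by (simp add: cnormal_eq_perp)
  have "?m \<bullet> \<tau> = 0"
  proof (rule ccontr)
    assume *: "?m \<bullet> \<tau> \<noteq> 0"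
    define k where "k = \<bar>?m \<bullet> \<tau>\<bar>"
    define \<sigma> where "\<sigma> = sgn (?m \<bullet> \<tau>)"
    have k: "k > 0" "\<sigma> * (?m \<bullet> \<tau>) = k" "\<bar>\<sigma>\<bar> = 1" using * by (auto simp: k_def \<sigma>_def sgn_if)
    \<comment> \<open>Short enough to stay on the segment and to satisfy
      \<open>s * s < 2 * s * r * k\<close>, which places the point inside the open disc.\<close>
    define s where "s = min (e / 2) (r * k)"
    have s: "0 < s" "s < e" "s \<le> r * k" using e r k by (auto simp: s_def)
    have \<sigma>2: "\<sigma> * \<sigma> = 1" using k(3) by (metis abs_mult_self_eq mult_1)
    have "(norm (s *\<^sub>R \<tau> - (\<sigma> * r) *\<^sub>R ?m))\<^sup>2 = s * s - 2 * s * r * k + r * r"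
    proof -
      have "(norm (s *\<^sub>R \<tau> - (\<sigma> * r) *\<^sub>R ?m))\<^sup>2 
          = s * s * (\<tau> \<bullet> \<tau>) - 2 * s * r * (\<sigma> * (?m \<bullet> \<tau>)) + (\<sigma> * \<sigma>) * (r * r) * (?m \<bullet> ?m)"
        unfolding power2_norm_eq_inner
        by (simp add: inner_diff_left inner_diff_right inner_commute[of \<tau> ?m] algebra_simps)
      then show ?thesis using k on(1) m \<sigma>2 by (simp add: norm_eq_1)
    qed
    also have "\<dots> < r * r"
    proof -
      have "s * s \<le> s * (r * k)" using s by (intro mult_left_mono) auto
      moreover have "s * (r * k) > 0" using s r k by simp
      ultimately show ?thesis by (simp add: mult.assoc)
    qed
    finally have "norm (s *\<^sub>R \<tau> - (\<sigma> * r) *\<^sub>R ?m) < r"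
      using r by (intro power_less_imp_less_base[of _ 2 r]) (auto simp: power2_eq_square)
    moreover have "dist (g t + (\<sigma> * r) *\<^sub>R ?m) (x + s *\<^sub>R \<tau>) = norm (s *\<^sub>R \<tau> - (\<sigma> * r) *\<^sub>R ?m)"
      using t(2) by (simp add: dist_norm norm_minus_commute)
    ultimately have "x + s *\<^sub>R \<tau> \<in> ball (g t + (\<sigma> * r) *\<^sub>R ?m) r" by simp
    then show False
      using normal_disc_disjoint_curve[OF g r t(1) k(3)] seg[of s] s by auto
  qed
  then have mn: "?m = (?m \<bullet> n) *\<^sub>R n" using orthonormal_expansion[OF on, of ?m] by simp
  define \<sigma> where "\<sigma> = ?m \<bullet> n"
  have \<sigma>: "\<bar>\<sigma>\<bar> = 1" using m on mn unfolding \<sigma>_def by (metis mult.right_neutral norm_scaleR)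
  then have "\<sigma> * \<sigma> = 1" by (metis abs_mult_self_eq mult_1)
  then have "(\<sigma> * r) *\<^sub>R ?m = r *\<^sub>R n"
    by (subst mn, fold \<sigma>_def) (simp add: mult_ac)
  then show ?thesis using normal_disc_disjoint_curve[OF g r t(1) \<sigma>] t(2) by simp
qed

section \<open>Admissible meshes\<close>

lemma finite_card_3: "card V = 3 \<Longrightarrow> finite V"
  by (metis card.infinite zero_neq_numeral)

locale admissible_mesh =
  fixes \<kappa> :: real and Q :: fem_data and G :: interface_mesh
  assumes deg: "deg Q \<in> {2, 3}" and data: "admissible_data Q" and adm: "admissible \<kappa> Q G"
begin

lemma open_dom: "open (dom Q)" and dom_regular: "interior (closure (dom Q)) = dom Q"
  using data unfolding admissible_data_def polygonal_domain_def by auto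

lemma curve_regular: "regular_simple_closed_C2 (curve G)"
  using adm unfolding admissible_def admissible_interface_def by blast

lemma Gam_eq: "Gam G = range (curve G)" by (simp add: Gam_def)

lemma closed_Gam: "closed (Gam G)"
  unfolding Gam_def using compact_range_regular_curve[OF curve_regular] by (rule compact_imp_closed)

lemma components_eq: "components (dom Q - Gam G) = {part G Pos, part G Neg}"
  and part_distinct: "part G Pos \<noteq> part G Neg"
  using adm unfolding admissible_def admissible_interface_def by simp_all

lemma part_component: "part G s \<in> components (dom Q - Gam G)"
  unfolding components_eq by (cases s) auto

lemma open_part: "open (part G s)"
  using open_components[OF open_Diff[OF open_dom closed_Gam] part_component] .

lemma part_subset: "part G s \<subseteq> dom Q - Gam G"
  using in_components_subset[OF part_component] .

lemma part_disjoint: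
  assumes "x \<in> part G s" "x \<in> part G s'"
  shows "s = s'"
  using components_nonoverlap[OF part_component[of s] part_component[of s']] assms part_distinct
  by (cases s; cases s') auto

lemma part_cover: "x \<in> dom Q - Gam G \<Longrightarrow> \<exists>s. x \<in> part G s"
  using Union_components[of "dom Q - Gam G"] unfolding components_eq by auto

text \<open>The device that assigns a disc to a side: the sets used below are convex, avoid
  \<Gamma>, and meet a known side in one point.\<close>

lemma connected_subset_part:
  assumes "connected K" "K \<subseteq> dom Q - Gam G" "x \<in> K" "x \<in> part G s"
  shows "K \<subseteq> part G s"
  using components_maximal[OF part_component assms(1,2)] assms(3,4) by blast

lemma mesh_triangle:
  assumes "V \<in> mesh G"
  shows "card V = 3" "\<not> affine_dependent V" "convex hull V \<subseteq> closure (dom Q)"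
    "interior (convex hull V) \<subseteq> dom Q" "compact (convex hull V)" "finite V"
proof -
  have tri: "triangulation (dom Q) (mesh G)" using adm unfolding admissible_def by blast
  then show V: "card V = 3" "\<not> affine_dependent V" "convex hull V \<subseteq> closure (dom Q)"
    using assms unfolding triangulation_def by blast+
  then show "interior (convex hull V) \<subseteq> dom Q"
    using interior_mono dom_regular by metis
  show "finite V" using finite_card_3[OF V(1)] .
  then show "compact (convex hull V)" by (rule finite_imp_compact_convex_hull)
qed

lemma finite_mesh: "finite (mesh G)"
  using adm unfolding admissible_def triangulation_def by blast

lemma mesh_intersection:
  assumes "V \<in> mesh G" "W \<in> mesh G"
  shows "convex hull V \<inter> convex hull W = convex hull (V \<inter> W)"
  using adm assms unfolding admissible_def triangulation_def by blast

lemma mesh_dist_le: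
  assumes "V \<in> mesh G" "x \<in> convex hull V" "y \<in> convex hull V"
  shows "dist x y \<le> diameter (convex hull V)"
  using diameter_bounded_bound[OF compact_imp_bounded[OF mesh_triangle(5)[OF assms(1)]] assms(2,3)] .

lemma reach:
  obtains r where "r > 0" "disjoint_normals (curve G) r" 
    "\<And>V. V \<in> mesh G \<Longrightarrow> diameter (convex hull V) \<le> r"
proof -
  obtain r where r: "r > 0" "disjoint_normals (curve G) r" "mesh_size (mesh G) < r / 2"
    using adm unfolding admissible_def admissible_interface_def by blast
  have "diameter (convex hull V) \<le> r" if "V \<in> mesh G" for V
  proof -
    have "diameter (convex hull V) \<le> mesh_size (mesh G)"
      unfolding mesh_size_def using that finite_mesh by (intro Max_ge) auto
    then show ?thesis using r by linarith
  qed
  then show thesis using that r by blast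
qed

lemma incircle:
  assumes "V \<in> mesh G"
  obtains c \<rho> where "\<rho> > 0" "cball c \<rho> \<subseteq> convex hull V" "diameter (convex hull V) \<le> \<kappa> * \<rho>"
  using adm assms unfolding admissible_def shape_regular_def by blast

lemma int_edge_neighbours:
  assumes "E \<in> int_edges G" "neighbours G E = (V, W)"
  shows "V \<in> mesh G" "W \<in> mesh G" "V \<noteq> W" "E \<in> edges_of V" "E \<in> edges_of W"
proof -
  let ?P = "\<lambda>(V, W). V \<in> mesh G \<and> W \<in> mesh G \<and> V \<noteq> W \<and> E \<in> edges_of V \<and> E \<in> edges_of W"
  have "\<exists>p. ?P p" using assms(1) unfolding int_edges_def by auto
  then have "?P (neighbours G E)" unfolding neighbours_def by (rule someI_ex)
  then show "V \<in> mesh G" "W \<in> mesh G" "V \<noteq> W" "E \<in> edges_of V" "E \<in> edges_of W"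
    unfolding assms(2) by auto
qed

end

section \<open>Fat elements at an edge\<close>

abbreviation edge_times :: "real^2 \<Rightarrow> real^2 \<Rightarrow> (real^2) set \<Rightarrow> real set" where
  "edge_times a b S \<equiv> {t \<in> {0..1}. linepath a b t \<in> S}"

lemma convex_hull_edge: "x \<in> convex hull {a, b} \<longleftrightarrow> (\<exists>t\<in>{0..1}. x = linepath a b t)"
  unfolding segment_convex_hull[symmetric] closed_segment_def linepath_def by auto

lemma linepath_diff: "linepath a b t - linepath a b s = (t - s) *\<^sub>R (b - a)"
  by (simp add: linepath_def algebra_simps)

lemma linepath_in_edge: "t \<in> {0..1} \<Longrightarrow> linepath a b t \<in> convex hull {a, b}"
  unfolding convex_hull_edge by blast

text \<open>An end point of the interval lies in the closure of its interior, so an open set that is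
  hit there is also hit at an inner parameter. This settles the ends of edges and the crossing
  point.\<close>

lemma linepath_meets_open_set:
  fixes U :: "'a::real_normed_vector set"
  assumes "open U" "linepath a b u \<in> U" "u \<in> {c..d}" "c < d"
  shows "\<exists>t\<in>{c<..<d}. linepath a b t \<in> U"
proof -
  have "continuous_on UNIV (linepath a b)"
    unfolding linepath_def by (intro continuous_intros)
  then have "open (linepath a b -` U)" using assms(1) by (simp add: continuous_on_open_vimage)
  moreover have "u \<in> closure {c<..<d}" using assms by simp
  ultimately show ?thesis
    using assms(2) closure_iff_nhds_not_empty[of u "{c<..<d}"] by blast
qed

text \<open>A triangle with a distinguished edge from \<open>a\<close> to \<open>b\<close> and its
  inward unit normal. The other neighbour of the edge is an instance with
  \<open>- n\<close>.\<close>

locale edge_triangle =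
  fixes T :: "(real^2) set" and a b c n :: "real^2"
  assumes T: "T = {a, b, c}" and ab: "a \<noteq> b"
    and n: "norm n = 1" "n \<bullet> (b - a) = 0" and c: "n \<bullet> (c - a) > 0"
begin

lemma near_edge_interior:
  assumes "0 < t" "t < 1"
  shows "\<exists>\<epsilon>>0. \<forall>w. norm w < \<epsilon> \<longrightarrow> n \<bullet> w > 0 \<longrightarrow> linepath a b t + w \<in> interior (convex hull T)"
proof -
  let ?x = "linepath a b t"
  obtain \<epsilon> where \<epsilon>: "\<epsilon> > 0" "\<And>w. norm w < \<epsilon> \<Longrightarrow> n \<bullet> w \<ge> 0 \<Longrightarrow> ?x + w \<in> convex hull T"
    using half_ball_subset_triangle[OF ab n c assms, of ?x] unfolding T linepath_def by blast
  let ?U = "ball ?x \<epsilon> \<inter> {y. n \<bullet> y > n \<bullet> ?x}"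
  have "open ?U" by (intro open_Int open_ball open_halfspace_gt)
  moreover have "?U \<subseteq> convex hull T"
  proof
    fix y assume "y \<in> ?U"
    then show "y \<in> convex hull T"
      using \<epsilon>(2)[of "y - ?x"] by (simp add: dist_norm norm_minus_commute inner_diff_right)
  qed
  ultimately have "?U \<subseteq> interior (convex hull T)" by (rule interior_maximal[rotated])
  moreover have "?x + w \<in> ?U" if "norm w < \<epsilon>" "n \<bullet> w > 0" for w
    using that by (simp add: dist_norm inner_add_right)
  ultimately show ?thesis using \<epsilon>(1) by blast
qed

lemma halfplane:
  assumes "y \<in> convex hull T"
  shows "n \<bullet> (y - linepath a b t) \<ge> 0"
  using triangle_in_halfplane[OF n(2) c _ assms[unfolded T], of "linepath a b t" t]
  by (simp add: linepath_def)

lemma edge_subset: "convex hull {a, b} \<subseteq> convex hull T"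
  unfolding T by (rule hull_mono) auto

lemma linepath_in_triangle: "t \<in> {0..1} \<Longrightarrow> linepath a b t \<in> convex hull T"
  using linepath_in_edge edge_subset by blast

lemma direction: "norm ((1 / dist a b) *\<^sub>R (b - a)) = 1" "n \<bullet> ((1 / dist a b) *\<^sub>R (b - a)) = 0"
    "b - a = dist a b *\<^sub>R ((1 / dist a b) *\<^sub>R (b - a))"
  using ab n by (auto simp: dist_norm norm_minus_commute)

lemma unit_normal_cases:
  assumes "norm m = 1" "m \<bullet> (b - a) = 0"
  shows "m = n \<or> m = - n"
proof -
  have m: "m = (m \<bullet> n) *\<^sub>R n"
    using orthonormal_expansion[OF direction(1) n(1) direction(2), of m] assms(2) by simp
  then have "\<bar>m \<bullet> n\<bar> = 1" using assms(1) n(1) by (metis mult.right_neutral norm_scaleR)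
  then have "m \<bullet> n = 1 \<or> m \<bullet> n = - 1" by linarith
  then show ?thesis using m by auto
qed

end

context admissible_mesh
begin

lemma edge_triangleI:
  assumes "V \<in> mesh G" "E \<in> edges_of V" "E = {a, b}"
  obtains c n where "edge_triangle V a b c n"
  using triangle_edge[OF mesh_triangle(1,2)[OF assms(1)] assms(2,3)] edge_triangle.intro by metis

text \<open>If the inward normals agreed, a small step from the midpoint along \<open>n\<close>
  would lie in both triangles, while conformity says that they share only the edge.\<close>

lemma neighbour_triangles:
  assumes E: "E \<in> int_edges G" "neighbours G E = (V, W)" "E = {a, b}"
  obtains c d n where "edge_triangle V a b c n" "edge_triangle W a b d (- n)"
proof -
  note N = int_edge_neighbours[OF E(1,2)]
  obtain c n where V: "edge_triangle V a b c n" using edge_triangleI[OF N(1,4) E(3)] .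
  obtain d m where W: "edge_triangle W a b d m" using edge_triangleI[OF N(2,5) E(3)] .
  interpret V: edge_triangle V a b c n by fact
  interpret W: edge_triangle W a b d m by fact
  have "m \<noteq> n"
  proof
    assume mn: "m = n"
    let ?x = "linepath a b (1 / 2)"
    obtain e1 where e1: "e1 > 0" "\<And>w. norm w < e1 \<Longrightarrow> n \<bullet> w > 0 \<Longrightarrow> ?x + w \<in> interior (convex hull V)"
      using V.near_edge_interior[of "1/2"] by auto
    obtain e2 where e2: "e2 > 0" "\<And>w. norm w < e2 \<Longrightarrow> n \<bullet> w > 0 \<Longrightarrow> ?x + w \<in> interior (convex hull W)"
      using W.near_edge_interior[of "1/2"] unfolding mn by auto
    define u where "u = min e1 e2 / 2"
    have u: "0 < u" "u < e1" "u < e2" using e1(1) e2(1) by (auto simp: u_def)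
    have nn: "n \<bullet> n = 1" using V.n(1) by (simp add: norm_eq_1)
    have "?x + u *\<^sub>R n \<in> convex hull V \<inter> convex hull W"
      using e1(2)[of "u *\<^sub>R n"] e2(2)[of "u *\<^sub>R n"] u nn V.n(1) interior_subset by fastforce
    also have "\<dots> = convex hull (V \<inter> W)" using mesh_intersection[OF N(1,2)] .
    also have "V \<inter> W = {a, b}" using V.T W.T N(3) by auto
    finally obtain t where "?x + u *\<^sub>R n = linepath a b t" unfolding convex_hull_edge by blast
    then have "u *\<^sub>R n = linepath a b t - ?x" by (metis add_diff_cancel_left')
    then have "n \<bullet> (u *\<^sub>R n) = (t - 1/2) * (n \<bullet> (b - a))" by (simp add: linepath_diff)
    then show False using u nn V.n(2) by simp
  qed
  then have "m = - n" using V.unit_normal_cases[OF W.n(1,2)] by blast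
  then show thesis using that V W by simp
qed

text \<open>Half discs from the two neighbours fit together to a disc in the closure of the domain;
  as the domain is the interior of its closure, the centre belongs to it.\<close>

lemma linepath_in_dom:
  assumes E: "E \<in> int_edges G" "E = {a, b}" and t: "0 < t" "t < 1"
  shows "linepath a b t \<in> dom Q"
proof -
  obtain V W where N: "neighbours G E = (V, W)" by (cases "neighbours G E")
  note N' = int_edge_neighbours[OF E(1) N]
  obtain c d n where V: "edge_triangle V a b c n" and W: "edge_triangle W a b d (- n)"
    using neighbour_triangles[OF E(1) N E(2)] .
  let ?x = "linepath a b t"
  obtain e1 where e1: "e1 > 0" "\<And>w. norm w < e1 \<Longrightarrow> n \<bullet> w \<ge> 0 \<Longrightarrow> ?x + w \<in> convex hull V"
    using half_ball_subset_triangle[of a b n c t ?x] V t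
    unfolding edge_triangle_def linepath_def by auto
  obtain e2 where e2: "e2 > 0" "\<And>w. norm w < e2 \<Longrightarrow> (- n) \<bullet> w \<ge> 0 \<Longrightarrow> ?x + w \<in> convex hull W"
    using half_ball_subset_triangle[of a b "- n" d t ?x] W t
    unfolding edge_triangle_def linepath_def by auto
  have "ball ?x (min e1 e2) \<subseteq> closure (dom Q)"
  proof
    fix y assume "y \<in> ball ?x (min e1 e2)"
    then have "norm (y - ?x) < e1" "norm (y - ?x) < e2" by (auto simp: dist_norm norm_minus_commute)
    then have "y \<in> convex hull V \<or> y \<in> convex hull W"
      using e1(2)[of "y - ?x"] e2(2)[of "y - ?x"] by (cases "n \<bullet> (y - ?x) \<ge> 0") auto
    then show "y \<in> closure (dom Q)" using mesh_triangle(3) N' by blast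
  qed
  then have "?x \<in> interior (closure (dom Q))"
    using e1(1) e2(1) by (auto simp: mem_interior intro!: exI[of _ "min e1 e2"])
  then show ?thesis unfolding dom_regular .
qed

lemma interior_near_edge_meets_part:
  assumes "edge_triangle T a b c n" "0 < t" "t < 1" "open U" "linepath a b t \<in> U"
  shows "\<exists>y. y \<in> interior (convex hull T) \<inter> U"
proof -
  interpret edge_triangle T a b c n by fact
  let ?x = "linepath a b t"
  obtain e1 where e1: "e1 > 0" "\<And>w. norm w < e1 \<Longrightarrow> n \<bullet> w > 0 \<Longrightarrow> ?x + w \<in> interior (convex hull T)"
    using near_edge_interior assms by blast
  obtain e2 where e2: "e2 > 0" "ball ?x e2 \<subseteq> U" using assms open_contains_ball by blast
  define u where "u = min e1 e2 / 2"
  have u: "0 < u" "u < e1" "u < e2" using e1(1) e2(1) by (auto simp: u_def)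
  have "?x + u *\<^sub>R n \<in> interior (convex hull T)"
    using e1(2)[of "u *\<^sub>R n"] u n by (simp add: norm_eq_1)
  moreover have "?x + u *\<^sub>R n \<in> U"
    using e2 u n by (auto simp: dist_norm)
  ultimately show ?thesis by blast
qed

section \<open>Sides of the interface seen from an element, and discs that lie on one side\<close>

lemma side_at_eqI:
  assumes "x \<in> closure (interior (convex hull V) \<inter> part G s)"
    and "\<And>s'. x \<in> closure (interior (convex hull V) \<inter> part G s') \<Longrightarrow> s' = s"
  shows "side_at G V x = s"
  unfolding side_at_def using assms by (rule some_equality)

text \<open>\<open>side_at\<close> is a choice, so existence and uniqueness of the side are both
  due. Openness of the parts yields both.\<close>

lemma side_at_part:
  assumes T: "edge_triangle T a b c n" and t: "0 < t" "t < 1" and x: "linepath a b t \<in> part G s"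
  shows "side_at G T (linepath a b t) = s"
proof (rule side_at_eqI)
  let ?x = "linepath a b t"
  show "?x \<in> closure (interior (convex hull T) \<inter> part G s)"
    unfolding closure_iff_nhds_not_empty
  proof (intro allI impI)
    fix A U assume "U \<subseteq> A" "open U" "?x \<in> U"
    then show "interior (convex hull T) \<inter> part G s \<inter> A \<noteq> {}"
      using interior_near_edge_meets_part[OF T t, of "U \<inter> part G s"] open_part x by blast
  qed
  fix s' assume "?x \<in> closure (interior (convex hull T) \<inter> part G s')"
  then obtain y where "y \<in> part G s'" "y \<in> part G s"
    using open_part[of s] x unfolding closure_iff_nhds_not_empty by blast
  then show "s' = s" by (rule part_disjoint)
qed

text \<open>The planar construction at the midpoint of the subsegment with parameters
  \<open>p\<close> and \<open>q\<close>; \<open>l\<close> is half its length, so the two points at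
  distance \<open>l\<close> are its ends.\<close>

lemma fat_disc_in_element:
  assumes "edge_triangle T a b c n" and TM: "T \<in> mesh G" and pq: "0 \<le> p" "p < q" "q \<le> 1"
    and \<nu>: "norm \<nu> = 1" "\<nu> \<bullet> n \<ge> 0" and R: "diameter (convex hull T) \<le> R" "0 \<le> \<delta>" "\<delta> \<le> R"
  defines "l \<equiv> (q - p) / 2 * dist a b" and "x \<equiv> linepath a b ((p + q) / 2)"
  shows "\<exists>z. ball z (l / (100 * \<kappa>\<^sup>2)) \<subseteq> interior (convex hull T) \<inter> ball (x + (R - \<delta>) *\<^sub>R \<nu>) R \<and>
    dist z x \<le> l \<and> \<kappa> \<ge> 1"
proof -
  interpret edge_triangle T a b c n by fact
  let ?\<tau> = "(1 / dist a b) *\<^sub>R (b - a)"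
  have mid: "0 < (p + q) / 2" "(p + q) / 2 < 1" using pq by auto
  have lt: "l *\<^sub>R ?\<tau> = ((q - p) / 2) *\<^sub>R (b - a)" using ab by (simp add: l_def)
  have q1: "x + l *\<^sub>R ?\<tau> = linepath a b q"
  proof -
    have "linepath a b q - x = l *\<^sub>R ?\<tau>"
      unfolding x_def linepath_diff lt by (simp add: field_simps)
    then show ?thesis by (simp add: algebra_simps)
  qed
  have p1: "x - l *\<^sub>R ?\<tau> = linepath a b p"
  proof -
    have "x - linepath a b p = l *\<^sub>R ?\<tau>"
      unfolding x_def linepath_diff lt by (simp add: field_simps)
    then show ?thesis by (simp add: algebra_simps)
  qed
  have xT: "x \<in> convex hull T" unfolding x_def using mid by (intro linepath_in_triangle) auto
  have pqT: "x + l *\<^sub>R ?\<tau> \<in> convex hull T" "x - l *\<^sub>R ?\<tau> \<in> convex hull T"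
    unfolding p1 q1 using pq by (intro linepath_in_triangle; simp)+
  obtain c' \<rho> where c': "\<rho> > 0" "cball c' \<rho> \<subseteq> convex hull T" "diameter (convex hull T) \<le> \<kappa> * \<rho>"
    using incircle[OF TM] .
  have dT: "norm (y - x) \<le> diameter (convex hull T)" if "y \<in> convex hull T" for y
    using mesh_dist_le[OF TM that xT] by (simp add: dist_norm)
  have hT: "n \<bullet> (y - x) \<ge> 0" if "y \<in> convex hull T" for y
    unfolding x_def using halfplane[OF that] .
  have l: "l > 0" using pq ab by (simp add: l_def)
  obtain z where z: "ball z (l / (100 * \<kappa>\<^sup>2)) \<subseteq> convex hull T \<inter> ball (x + (R - \<delta>) *\<^sub>R \<nu>) R"
    "norm (z - x) \<le> l" "\<kappa> \<ge> 1"
    using fat_disc_in_tangent_disc[OF convex_convex_hull c'(2) pqT dT hT direction(1) n(1) direction(2)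
        \<nu> c'(1,3) l R] by blast
  have "ball z (l / (100 * \<kappa>\<^sup>2)) \<subseteq> interior (convex hull T)"
    using z(1) by (intro interior_maximal) auto
  then show ?thesis using z by (auto simp: dist_norm)
qed

text \<open>The neighbour is the one whose inward normal has a non-negative product with \<nu>. The
  intersection of its interior with the tangent disc is convex and avoids \<Gamma>, hence lies on
  one side. It is the side \<open>s\<close>, since \<open>x\<close> belongs to the disc and is
  approached from within the element.\<close>

lemma fat_disc_off_interface:
  assumes E: "E \<in> int_edges G" "neighbours G E = (V, W)" "E = {a, b}"
    and pq: "0 \<le> p" "p < q" "q \<le> 1" and s: "\<And>t. p < t \<Longrightarrow> t < q \<Longrightarrow> linepath a b t \<in> part G s"
  defines "l \<equiv> (q - p) / 2 * dist a b" and "x \<equiv> linepath a b ((p + q) / 2)"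
  shows "\<exists>T\<in>{V, W}. \<exists>z. ball z (l / (100 * \<kappa>\<^sup>2)) \<subseteq> convex hull T \<inter> part G s \<and> dist z x \<le> l \<and> \<kappa> \<ge> 1"
proof -
  note N = int_edge_neighbours[OF E(1,2)]
  obtain c d n where V: "edge_triangle V a b c n" and W: "edge_triangle W a b d (- n)"
    using neighbour_triangles[OF E] .
  have xs: "x \<in> part G s" unfolding x_def using pq by (intro s) auto
  then have x\<Gamma>: "x \<notin> range (curve G)" using part_subset Gam_eq by blast
  obtain r where r: "r > 0" "disjoint_normals (curve G) r"
    "\<And>V. V \<in> mesh G \<Longrightarrow> diameter (convex hull V) \<le> r" using reach by metis
  obtain \<nu> R \<delta> where \<nu>: "norm \<nu> = 1" "r \<le> R" "0 < \<delta>" "\<delta> \<le> R"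
    "ball (x + (R - \<delta>) *\<^sub>R \<nu>) R \<inter> range (curve G) = {}"
    using tangent_disc_disjoint_curve[OF curve_regular r(2,1) x\<Gamma>] .
  obtain T c m where TT: "T \<in> {V, W}" "edge_triangle T a b c m" "\<nu> \<bullet> m \<ge> 0"
    using V W by (cases "\<nu> \<bullet> n \<ge> 0") fastforce+
  interpret edge_triangle T a b c m by (rule TT(2))
  have TM: "T \<in> mesh G" using TT(1) N by auto
  have mid: "0 < (p + q) / 2" "(p + q) / 2 < 1" using pq by auto
  let ?B = "ball (x + (R - \<delta>) *\<^sub>R \<nu>) R"
  have RT: "diameter (convex hull T) \<le> R" using r(3)[OF TM] \<nu> by linarith
  obtain z where z: "ball z (l / (100 * \<kappa>\<^sup>2)) \<subseteq> interior (convex hull T) \<inter> ?B" "dist z x \<le> l" "\<kappa> \<ge> 1"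
    using fat_disc_in_element[OF TT(2) TM pq \<nu>(1) TT(3) RT less_imp_le[OF \<nu>(3)] \<nu>(4)]
    unfolding l_def x_def by blast
  let ?K = "interior (convex hull T) \<inter> ?B"
  have K: "convex ?K" by (intro convex_Int convex_interior convex_convex_hull convex_ball)
  have KG: "?K \<subseteq> dom Q - Gam G" using mesh_triangle(4)[OF TM] \<nu>(5) Gam_eq by auto
  have "x \<in> ?B" using \<nu> by (simp add: dist_norm)
  then obtain y where y: "y \<in> ?K" "y \<in> part G s"
    using interior_near_edge_meets_part[OF TT(2) mid, of "?B \<inter> part G s"] xs open_part
    unfolding x_def by blast
  have "?K \<subseteq> part G s" using connected_subset_part[OF convex_connected[OF K] KG y] .
  then have "ball z (l / (100 * \<kappa>\<^sup>2)) \<subseteq> convex hull T \<inter> part G s"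
    using z(1) interior_subset by blast
  then show ?thesis using TT(1) z by blast
qed

text \<open>Here the midpoint has distance zero from \<Gamma>. Since \<Gamma> contains the edge, the
  disc of radius \<open>r\<close> tangent at each inner point of the edge is free of \<Gamma>. The
  disc at the midpoint yields the fat disc; the union over all points shows that the whole edge is
  approached from the same side.\<close>

lemma fat_disc_on_interface:
  assumes TM: "T \<in> mesh G" "E \<in> edges_of T" "E = {a, b}" and E: "convex hull E \<subseteq> Gam G"
  defines "l \<equiv> dist a b / 2" and "x \<equiv> linepath a b (1 / 2)"
  shows "\<exists>s z. ball z (l / (100 * \<kappa>\<^sup>2)) \<subseteq> convex hull T \<inter> part G s \<and> dist z x \<le> l \<and> \<kappa> \<ge> 1 \<and>
     (\<forall>t. 0 < t \<longrightarrow> t < 1 \<longrightarrow> side_at G T (linepath a b t) = s)"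
proof -
  obtain c n where "edge_triangle T a b c n" using edge_triangleI[OF TM] .
  then interpret edge_triangle T a b c n .
  let ?\<tau> = "(1 / dist a b) *\<^sub>R (b - a)"
  let ?L = "dist a b"
  have L: "?L > 0" using ab by simp
  have nn: "n \<bullet> n = 1" using n(1) by (simp add: norm_eq_1)
  obtain r where r: "r > 0" "disjoint_normals (curve G) r"
    "\<And>V. V \<in> mesh G \<Longrightarrow> diameter (convex hull V) \<le> r" using reach by metis
  have lp: "linepath a b t + s *\<^sub>R ?\<tau> = linepath a b (t + s / ?L)" for t s
    by (simp add: linepath_def algebra_simps)
  have \<Gamma>: "linepath a b t \<in> range (curve G)" if "0 \<le> t" "t \<le> 1" for t
    using linepath_in_edge[of t a b] that E TM(3) Gam_eq by auto
  have disc: "ball (linepath a b t + r *\<^sub>R n) r \<inter> range (curve G) = {}" if t: "0 < t" "t < 1" for t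
  proof (rule tangent_disc_at_segment[OF curve_regular r(2,1) _ _ _ direction(1) n(1) direction(2)])
    show "linepath a b t \<in> range (curve G)" using \<Gamma> t by simp
    show "min t (1 - t) * ?L > 0" using t L by simp
    fix s assume "\<bar>s\<bar> < min t (1 - t) * ?L"
    then have "\<bar>s\<bar> / ?L < min t (1 - t)" by (simp only: pos_divide_less_eq[OF L])
    then have "\<bar>s / ?L\<bar> < min t (1 - t)" by simp
    then have "0 \<le> t + s / ?L" "t + s / ?L \<le> 1" by linarith+
    then show "linepath a b t + s *\<^sub>R ?\<tau> \<in> range (curve G)" unfolding lp by (rule \<Gamma>)
  qed
  let ?I = "interior (convex hull T)"
  \<comment> \<open>The points of the element above the open edge and lower than
    \<open>2 * r\<close>. Each lies on the diameter of the tangent disc at its foot point, so the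
    set avoids \<Gamma>; as an intersection with half-planes it is convex.\<close>
  let ?K = "?I \<inter> {y. ?\<tau> \<bullet> y > ?\<tau> \<bullet> a} \<inter> {y. ?\<tau> \<bullet> y < ?\<tau> \<bullet> a + ?L} \<inter> {y. n \<bullet> y < n \<bullet> a + 2 * r}"
  have K: "convex ?K"
    by (intro convex_Int convex_interior convex_convex_hull convex_halfspace_lt convex_halfspace_gt)
  have KG: "?K \<subseteq> dom Q - Gam G"
  proof
    fix y assume y: "y \<in> ?K"
    define t where "t = ((y - a) \<bullet> ?\<tau>) / ?L"
    define u where "u = (y - a) \<bullet> n"
    have t: "0 < t" "t < 1"
    proof -
      have "(y - a) \<bullet> ?\<tau> = ?\<tau> \<bullet> y - ?\<tau> \<bullet> a"
        by (simp only: inner_commute[of _ ?\<tau>] inner_diff_right)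
      moreover have "?\<tau> \<bullet> y > ?\<tau> \<bullet> a" "?\<tau> \<bullet> y < ?\<tau> \<bullet> a + ?L" using y by blast+
      ultimately have *: "0 < (y - a) \<bullet> ?\<tau>" "(y - a) \<bullet> ?\<tau> < 1 * ?L" by linarith+
      show "0 < t" unfolding t_def using *(1) L by (rule divide_pos_pos)
      show "t < 1" unfolding t_def pos_divide_less_eq[OF L] by (rule *(2))
    qed
    have "u > 0" unfolding u_def
      using halfplane_interior[where y = y, OF n(1) halfplane[where t = 0]] y
      by (simp add: linepath_0' inner_commute)
    moreover have "u < 2 * r"
    proof -
      have "u = n \<bullet> y - n \<bullet> a" by (simp only: u_def inner_commute[of _ n] inner_diff_right)
      then show ?thesis using y by simp
    qed
    moreover have "y = linepath a b t + u *\<^sub>R n"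
    proof -
      have "y - a = (t * ?L) *\<^sub>R ?\<tau> + u *\<^sub>R n"
        unfolding t_def u_def using orthonormal_expansion[OF direction(1) n(1) direction(2), of "y - a"] L
        by simp
      moreover have "(t * ?L) *\<^sub>R ?\<tau> = t *\<^sub>R (b - a)" using L by simp
      ultimately have "y = a + (t *\<^sub>R (b - a) + u *\<^sub>R n)" by (metis add.commute diff_add_cancel)
      then show ?thesis by (simp add: linepath_def algebra_simps)
    qed
    ultimately have "y \<in> ball (linepath a b t + r *\<^sub>R n) r"
      using n(1) by (simp add: dist_norm abs_less_iff flip: scaleR_diff_left)
    then have "y \<notin> Gam G" using disc[OF t] Gam_eq by auto
    then show "y \<in> dom Q - Gam G" using y mesh_triangle(4)[OF TM(1)] by auto
  qed
  \<comment> \<open>The radius keeps the foot point within the open edge and the height below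
    \<open>2 * r\<close>.\<close>
  let ?U = "\<lambda>t. ball (linepath a b t) (min (min (t * ?L) ((1 - t) * ?L)) (2 * r))"
  have near: "y \<in> ?K" if y: "y \<in> ?I" "y \<in> ?U t" for y t
  proof -
    let ?v = "y - linepath a b t"
    have v: "norm ?v < t * ?L" "norm ?v < (1 - t) * ?L" "norm ?v < 2 * r"
      using y by (auto simp: dist_norm norm_minus_commute)
    have y': "y = a + (t * ?L) *\<^sub>R ?\<tau> + ?v" using L by (simp add: linepath_def algebra_simps)
    have "\<bar>?\<tau> \<bullet> ?v\<bar> \<le> norm ?v" "\<bar>n \<bullet> ?v\<bar> \<le> norm ?v"
      using Cauchy_Schwarz_ineq2[of ?\<tau> ?v] Cauchy_Schwarz_ineq2[of n ?v]
      unfolding direction(1) n(1) mult_1_left by blast+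
    moreover have "?\<tau> \<bullet> y = ?\<tau> \<bullet> a + t * ?L + ?\<tau> \<bullet> ?v"
    proof -
      have "?\<tau> \<bullet> ?\<tau> = 1" using direction(1) by (simp only: norm_eq_1)
      then show ?thesis by (subst y') (simp only: inner_add_right inner_scaleR_right mult_1_right)
    qed
    moreover have "n \<bullet> y = n \<bullet> a + n \<bullet> ?v"
      by (subst y') (simp only: inner_add_right inner_scaleR_right[of n "t * ?L"] direction(2))
    moreover have "(1 - t) * ?L = ?L - t * ?L" by (simp add: left_diff_distrib)
    ultimately have "?\<tau> \<bullet> y > ?\<tau> \<bullet> a" "?\<tau> \<bullet> y < ?\<tau> \<bullet> a + ?L" "n \<bullet> y < n \<bullet> a + 2 * r"
      using v by linarith+
    then show ?thesis using y by blast
  qed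
  have U: "open (?U t)" "linepath a b t \<in> ?U t" if "0 < t" "t < 1" for t
    using that L r by auto
  let ?B = "ball (x + r *\<^sub>R n) r"
  \<comment> \<open>A common point of \<open>?K\<close> and the tangent disc at the midpoint; it
    forces both onto the same side.\<close>
  obtain y0 where y0: "y0 \<in> ?K" "y0 \<in> ?I \<inter> ?B"
  proof -
    obtain e where e: "e > 0" "\<And>w. norm w < e \<Longrightarrow> n \<bullet> w > 0 \<Longrightarrow> x + w \<in> ?I"
      using near_edge_interior[of "1/2"] unfolding x_def by auto
    define u where "u = min (min e r) (?L / 2) / 2"
    have u: "0 < u" "u < e" "u < r" "u < ?L / 2" using e(1) r(1) L unfolding u_def by linarith+
    have I: "x + u *\<^sub>R n \<in> ?I" using e(2)[of "u *\<^sub>R n"] u n nn by simp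
    have "x + u *\<^sub>R n \<in> ?U (1 / 2)" using u n r unfolding x_def by (simp add: dist_norm)
    from near[OF I this] have "x + u *\<^sub>R n \<in> ?K" .
    moreover have "x + u *\<^sub>R n \<in> ?B"
      using u n by (simp add: dist_norm flip: scaleR_diff_left)
    ultimately show thesis using that I by blast
  qed
  obtain s where s: "y0 \<in> part G s" using part_cover KG y0 by blast
  have Ks: "?K \<subseteq> part G s" using connected_subset_part[OF convex_connected[OF K] KG y0(1) s] .
  have side: "side_at G T (linepath a b t) = s" if t: "0 < t" "t < 1" for t
  proof (rule side_at_eqI)
    let ?y = "linepath a b t"
    show "?y \<in> closure (?I \<inter> part G s)"
      unfolding closure_iff_nhds_not_empty
    proof (intro allI impI)
      fix A U assume A: "U \<subseteq> A" "open U" "?y \<in> U"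
      then obtain y where "y \<in> ?I" "y \<in> U" "y \<in> ?U t"
        using interior_near_edge_meets_part[OF edge_triangle_axioms t, of "U \<inter> ?U t"] U[OF t] by blast
      then show "?I \<inter> part G s \<inter> A \<noteq> {}" using near[of y t] Ks A by blast
    qed
    fix s' assume "?y \<in> closure (?I \<inter> part G s')"
    then obtain y where "y \<in> ?I" "y \<in> part G s'" "y \<in> ?U t"
      using U[OF t] unfolding closure_iff_nhds_not_empty by blast
    then have "y \<in> part G s" using near[of y t] Ks by blast
    with \<open>y \<in> part G s'\<close> show "s' = s" by (rule part_disjoint)
  qed
  have "n \<bullet> n \<ge> 0" by simp
  \<comment> \<open>Used with \<nu> = \<open>n\<close>, radius \<open>r\<close> and depth 0: the
    midpoint is on the boundary of the disc.\<close>
  then obtain z where z: "ball z (l / (100 * \<kappa>\<^sup>2)) \<subseteq> ?I \<inter> ?B" "dist z x \<le> l" "\<kappa> \<ge> 1"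
    using fat_disc_in_element[OF edge_triangle_axioms TM(1) _ _ _ n(1) _ r(3)[OF TM(1)] order_refl, of 0 1] r(1)
    unfolding l_def x_def by auto
  have K2: "convex (?I \<inter> ?B)" by (intro convex_Int convex_interior convex_convex_hull convex_ball)
  have "?I \<inter> ?B \<subseteq> dom Q - Gam G"
    using mesh_triangle(4)[OF TM(1)] disc[of "1/2"] Gam_eq unfolding x_def by auto
  from connected_subset_part[OF convex_connected[OF K2] this y0(2) s] have "?I \<inter> ?B \<subseteq> part G s" .
  then have "ball z (l / (100 * \<kappa>\<^sup>2)) \<subseteq> convex hull T \<inter> part G s"
    using z(1) interior_subset by blast
  then show ?thesis using side z by blast
qed

text \<open>\<open>J\<close> is the parameter set of a part of the edge from \<open>a\<close> to \<open>b\<close>. On it, the traces from \<open>T\<close> belong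
  to a polynomial piece of \<open>T\<close> that lives on a disc whose size and distance are comparable with the
  length of that part.\<close>

definition fat :: "real^2 \<Rightarrow> real^2 \<Rightarrow> real set \<Rightarrow> cell \<Rightarrow> bool" where
  "fat a b J T \<longleftrightarrow> (\<exists>s z \<delta> F. \<delta> > 0 \<and> ball z \<delta> \<subseteq> convex hull T \<inter> part G s \<and> finite F \<and>
     (\<forall>t\<in>J - F. side_at G T (linepath a b t) = s) \<and>
     (\<forall>t\<in>J. dist (linepath a b t) z \<le> 500 * \<kappa>\<^sup>2 * \<delta>) \<and>
     dist a b * measure lborel J \<le> 500 * \<kappa>\<^sup>2 * \<delta>)"

lemma measure_unit_subinterval:
  assumes "J \<subseteq> {c..d}" "c \<le> d"
  shows "measure lborel J \<le> d - c"
proof (cases "J \<in> sets lborel")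
  case True
  have "measure lborel J \<le> measure lborel {c..d}"
    using assms True by (intro measure_mono_fmeasurable) (auto simp: fmeasurable_def)
  then show ?thesis using assms by simp
next
  case False
  then have "measure lborel J = 0" by (rule measure_notin_sets)
  then show ?thesis using assms(2) by linarith
qed

text \<open>With the disc of radius \<open>l / (100 * \<kappa>\<^sup>2)\<close>, the number
  \<open>500 * \<kappa>\<^sup>2\<close> stands for a distance \<open>5 * l\<close>: at most
  \<open>4 * l\<close> to the midpoint \<open>x\<close>, and \<open>l\<close> from there to
  \<open>z\<close>. The finite set \<open>F\<close> collects the parameters where
  \<open>side_at\<close> may be ambiguous.\<close>

lemma fatI:
  assumes l: "l > 0" and disc: "ball z (l / (100 * \<kappa>\<^sup>2)) \<subseteq> convex hull T \<inter> part G s" "dist z x \<le> l" "\<kappa> \<ge> 1"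
    and F: "finite F" "\<And>t. t \<in> J - F \<Longrightarrow> side_at G T (linepath a b t) = s"
    and J: "\<And>t. t \<in> J \<Longrightarrow> dist (linepath a b t) x \<le> 4 * l" "dist a b * measure lborel J \<le> 4 * l"
  shows "fat a b J T"
proof -
  have \<kappa>: "500 * \<kappa>\<^sup>2 * (l / (100 * \<kappa>\<^sup>2)) = 5 * l" using disc(3) by simp
  have "dist (linepath a b t) z \<le> 5 * l" if "t \<in> J" for t
    using J(1)[OF that] disc(2) dist_triangle[of "linepath a b t" z x]
    by (simp add: dist_commute[of x z]) 
  moreover have "dist a b * measure lborel J \<le> 5 * l" using J(2) l by linarith
  moreover have "l / (100 * \<kappa>\<^sup>2) > 0" using l disc(3) by simp
  ultimately show ?thesis
    unfolding fat_def using disc(1) F by (intro exI[of _ s] exI[of _ z] exI[of _ "l / (100 * \<kappa>\<^sup>2)"] exI[of _ F])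
      (auto simp: \<kappa>)
qed

section \<open>Position of the interface on an edge\<close>

lemma dist_linepath: "dist (linepath a b t) (linepath a b s) = \<bar>t - s\<bar> * dist a b"
  unfolding dist_norm linepath_diff by (simp add: norm_minus_commute)

lemma open_segment_in_part:
  assumes "E \<in> int_edges G" "E = {a, b}" "0 \<le> p" "q \<le> 1"
    and off: "\<And>t. p < t \<Longrightarrow> t < q \<Longrightarrow> linepath a b t \<notin> Gam G"
  shows "\<exists>s. \<forall>t. p < t \<longrightarrow> t < q \<longrightarrow> linepath a b t \<in> part G s"
proof (cases "p < q")
  case True
  let ?K = "linepath a b ` {p<..<q}"
  have con: "connected ?K"
    by (intro connected_continuous_image) (auto simp: linepath_def intro!: continuous_intros)
  have K: "?K \<subseteq> dom Q - Gam G"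
    using off linepath_in_dom[OF assms(1,2)] assms(3,4) by auto
  have m: "linepath a b ((p + q) / 2) \<in> ?K" using True by auto
  then obtain s where s: "linepath a b ((p + q) / 2) \<in> part G s"
    using part_cover subsetD[OF K m] by blast
  have "?K \<subseteq> part G s" using connected_subset_part[OF con K m s] .
  then show ?thesis by (intro exI[of _ s]) auto
qed auto

text \<open>Uncut edges that \<open>\<Gamma>\<close> does not cross are covered by \<open>t0 = 1\<close>.\<close>

lemma edge_crossing:
  assumes E: "E \<in> int_edges G" "E = {a, b}" "\<not> convex hull E \<subseteq> Gam G"
  obtains t0 s1 s2 where "0 < t0" "t0 \<le> 1"
    "\<And>t. 0 < t \<Longrightarrow> t < t0 \<Longrightarrow> linepath a b t \<in> part G s1"
    "\<And>t. t0 < t \<Longrightarrow> t < 1 \<Longrightarrow> linepath a b t \<in> part G s2"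
proof -
  obtain V where V: "V \<in> mesh G" "E \<in> edges_of V" using E(1) unfolding int_edges_def by blast
  then have ab: "a \<noteq> b" using E(2) by (auto simp: edges_of_def)
  have "\<forall>V\<in>mesh G. \<forall>E\<in>edges_of V. convex hull E \<subseteq> Gam G \<or> (\<exists>x. Gam G \<inter> convex hull E \<subseteq> {x})"
    using adm unfolding admissible_def admissible_interface_def by simp
  then obtain x where x: "Gam G \<inter> convex hull E \<subseteq> {x}" using V E(3) by blast
  obtain t0 where t0: "0 < t0" "t0 \<le> 1" "\<And>t. 0 < t \<Longrightarrow> t < 1 \<Longrightarrow> t \<noteq> t0 \<Longrightarrow> linepath a b t \<notin> Gam G"
  proof (cases "\<exists>t. 0 < t \<and> t < 1 \<and> linepath a b t \<in> Gam G")
    case True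
    then obtain t0 where t0: "0 < t0" "t0 < 1" "linepath a b t0 \<in> Gam G" by blast
    have "linepath a b t \<notin> Gam G" if "0 < t" "t < 1" "t \<noteq> t0" for t
    proof
      assume "linepath a b t \<in> Gam G"
      then have "linepath a b t = linepath a b t0"
        using x t0 that linepath_in_edge[of t a b] linepath_in_edge[of t0 a b] E(2) by auto
      then have "\<bar>t - t0\<bar> * dist a b = 0" by (metis dist_linepath dist_self)
      then show False using that ab by simp
    qed
    then show ?thesis using that t0 by auto
  next
    case False
    then show ?thesis using that[of 1] by auto
  qed
  obtain s1 where s1: "\<And>t. 0 < t \<Longrightarrow> t < t0 \<Longrightarrow> linepath a b t \<in> part G s1"
    using open_segment_in_part[OF E(1,2), of 0 t0] t0 by auto
  obtain s2 where s2: "\<And>t. t0 < t \<Longrightarrow> t < 1 \<Longrightarrow> linepath a b t \<in> part G s2"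
    using open_segment_in_part[OF E(1,2), of t0 1] t0 by auto
  show thesis using that[OF t0(1,2) s1 s2] .
qed

lemma part_of_segment:
  assumes "linepath a b u \<in> part G s" "u \<in> {p..q}" "p < q"
    and "\<And>t. p < t \<Longrightarrow> t < q \<Longrightarrow> linepath a b t \<in> part G s'"
  shows "s = s'"
  using linepath_meets_open_set[OF open_part assms(1-3)] assms(4) part_disjoint by fastforce

text \<open>Both sides are hit, so the crossing parameter is strictly inside and the two subsegments
  belong to different sides; the one on side \<open>s\<close> is returned. Hits at an end of a
  subsegment are traced back to inner parameters by openness.\<close>

lemma cut_edge_crossing:
  assumes E: "E \<in> int_edges G" "E = {a, b}" "is_cut G E"
  obtains p q where "0 \<le> p" "p < q" "q \<le> 1" "\<And>t. p < t \<Longrightarrow> t < q \<Longrightarrow> linepath a b t \<in> part G s"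
    "edge_times a b (part G s) \<subseteq> {p..q}"
proof -
  have "\<not> convex hull E \<subseteq> Gam G"
    using E(3) part_subset unfolding is_cut_def by blast
  then obtain t0 s1 s2 where t0: "0 < t0" "t0 \<le> 1"
    and s1: "\<And>t. 0 < t \<Longrightarrow> t < t0 \<Longrightarrow> linepath a b t \<in> part G s1"
    and s2: "\<And>t. t0 < t \<Longrightarrow> t < 1 \<Longrightarrow> linepath a b t \<in> part G s2"
    using edge_crossing[OF E(1,2)] by blast
  have hit: "\<exists>u\<in>{0..1}. linepath a b u \<in> part G s'" for s'
    using E(3) unfolding is_cut_def E(2) by (metis convex_hull_edge disjoint_iff)
  have left: "s' = s1" if "linepath a b u \<in> part G s'" "u \<in> {0..t0}" for u s'
    using part_of_segment[OF that t0(1) s1] .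
  have t1: "t0 < 1"
  proof (rule ccontr)
    assume "\<not> t0 < 1"
    then have "t0 = 1" using t0 by simp
    then have "s' = s1" for s' using hit[of s'] left by auto
    then show False by (metis side.distinct(1))
  qed
  have right: "s' = s2" if "linepath a b u \<in> part G s'" "u \<in> {t0..1}" for u s'
    using part_of_segment[OF that t1 s2] .
  have ne: "s1 \<noteq> s2"
  proof
    assume "s1 = s2"
    then have "s' = s1" for s'
    proof -
      obtain u where "u \<in> {0..1}" "linepath a b u \<in> part G s'" using hit by blast
      then show ?thesis using left[of u s'] right[of u s'] \<open>s1 = s2\<close> by (cases "u \<le> t0") auto
    qed
    then show False by (metis side.distinct(1))
  qed
  then consider "s = s1" | "s = s2" by (cases s; cases s1; cases s2) auto
  then show thesis
  proof cases
    case 1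
    have "edge_times a b (part G s) \<subseteq> {0..t0}"
      using right 1 ne by force
    then show ?thesis using that[of 0 t0] t0 s1 1 by auto
  next
    case 2
    have "edge_times a b (part G s) \<subseteq> {t0..1}"
      using left 2 ne by force
    then show ?thesis using that[of t0 1] t0 t1 s2 2 by auto
  qed
qed

section \<open>Fat neighbours of cut edges, uncut edges and edges away from the interface\<close>

lemma neighbour_triangle:
  assumes E: "E \<in> int_edges G" "neighbours G E = (V, W)" "E = {a, b}" "T \<in> {V, W}"
  obtains c n where "edge_triangle T a b c n"
  using neighbour_triangles[OF E(1-3)] E(4) by blast

text \<open>Every length is measured against \<open>l\<close>, half the length of the cut part, so
  the constant does not see how short that part is.\<close>

lemma cut_edge_fat:
  assumes E: "E \<in> int_edges G" "neighbours G E = (V, W)" "E = {a, b}" "is_cut G E"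
  shows "\<exists>T\<in>{V, W}. fat a b (edge_times a b (part G s)) T"
proof -
  let ?J = "edge_times a b (part G s)"
  obtain p q where pq: "0 \<le> p" "p < q" "q \<le> 1"
    and s: "\<And>t. p < t \<Longrightarrow> t < q \<Longrightarrow> linepath a b t \<in> part G s" and J: "?J \<subseteq> {p..q}"
    using cut_edge_crossing[OF E(1,3,4), of s] by blast
  let ?l = "(q - p) / 2 * dist a b" and ?x = "linepath a b ((p + q) / 2)"
  obtain T z where T: "T \<in> {V, W}"
    and z: "ball z (?l / (100 * \<kappa>\<^sup>2)) \<subseteq> convex hull T \<inter> part G s" "dist z ?x \<le> ?l" "\<kappa> \<ge> 1"
    using fat_disc_off_interface[OF E(1-3) pq s] by blast
  obtain c n where Tn: "edge_triangle T a b c n" using neighbour_triangle[OF E(1-3) T] .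
  then have ab: "a \<noteq> b" by (simp add: edge_triangle_def)
  have "fat a b ?J T"
  proof (rule fatI[OF _ z, where F = "{0, 1}"])
    show "?l > 0" using pq ab by simp
    show "side_at G T (linepath a b t) = s" if "t \<in> ?J - {0, 1}" for t
      using that by (intro side_at_part[OF Tn]) auto
    show "dist (linepath a b t) ?x \<le> 4 * ?l" if "t \<in> ?J" for t
    proof -
      have "\<bar>t - (p + q) / 2\<bar> \<le> (q - p) / 2"
      proof -
        have "p \<le> t" "t \<le> q" using J that by auto
        then show ?thesis unfolding abs_le_iff by (simp add: field_simps)
      qed
      then have "\<bar>t - (p + q) / 2\<bar> * dist a b \<le> ?l" by (intro mult_right_mono) auto
      then show ?thesis unfolding dist_linepath using \<open>?l > 0\<close> by linarith
    qed
    have "dist a b * measure lborel ?J \<le> dist a b * (q - p)"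
      using measure_unit_subinterval[OF J] pq by (intro mult_left_mono) auto
    then show "dist a b * measure lborel ?J \<le> 4 * ?l"
      using \<open>?l > 0\<close> by (simp add: algebra_simps)
  qed simp
  then show ?thesis using T by blast
qed

text \<open>\<Gamma> may touch the edge in an inner point without changing sides. The tangent disc
  is therefore taken at the midpoint of the longer piece, and the edge is at most twice as long as
  this piece. For an edge contained in \<Gamma> either neighbour would do.\<close>

lemma uncut_edge_fat:
  assumes E: "E \<in> int_edges G" "neighbours G E = (V, W)" "E = {a, b}" "\<not> is_cut G E"
  shows "\<exists>T\<in>{V, W}. fat a b {0..1} T"
proof -
  note N = int_edge_neighbours[OF E(1,2)]
  obtain c n where "edge_triangle V a b c n" using neighbour_triangle[OF E(1-3), of V] by auto
  then have ab: "a \<noteq> b" by (simp add: edge_triangle_def)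
  show ?thesis
  proof (cases "convex hull E \<subseteq> Gam G")
    case True
    let ?l = "dist a b / 2" and ?x = "linepath a b (1 / 2)"
    obtain s z where z: "ball z (?l / (100 * \<kappa>\<^sup>2)) \<subseteq> convex hull V \<inter> part G s" "dist z ?x \<le> ?l" "\<kappa> \<ge> 1"
      and side: "\<And>t. 0 < t \<Longrightarrow> t < 1 \<Longrightarrow> side_at G V (linepath a b t) = s"
      using fat_disc_on_interface[OF N(1,4) E(3) True] by blast
    have "fat a b {0..1} V"
    proof (rule fatI[OF _ z, where F = "{0, 1}"])
      show "?l > 0" using ab by simp
      show "side_at G V (linepath a b t) = s" if "t \<in> {0..1} - {0, 1}" for t
        using that by (intro side) auto
      show "dist (linepath a b t) ?x \<le> 4 * ?l" if "t \<in> {0..1}" for t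
      proof -
        have "\<bar>t - 1 / 2\<bar> \<le> 2" using that by auto
        then have "\<bar>t - 1 / 2\<bar> * dist a b \<le> 2 * dist a b" by (intro mult_right_mono) auto
        then show ?thesis unfolding dist_linepath by simp
      qed
    qed simp_all
    then show ?thesis by blast
  next
    case False
    obtain t0 s1 s2 where t0: "0 < t0" "t0 \<le> 1"
      and s1: "\<And>t. 0 < t \<Longrightarrow> t < t0 \<Longrightarrow> linepath a b t \<in> part G s1"
      and s2: "\<And>t. t0 < t \<Longrightarrow> t < 1 \<Longrightarrow> linepath a b t \<in> part G s2"
      using edge_crossing[OF E(1,3) False] by blast
    have s2': "linepath a b t \<in> part G s1" if "t0 < t" "t < 1" for t
    proof (rule ccontr)
      assume "linepath a b t \<notin> part G s1"
      then have ne: "s1 \<noteq> s2" using s2 that by metis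
      have "convex hull E \<inter> part G s \<noteq> {}" for s
      proof -
        have "linepath a b (t0 / 2) \<in> convex hull E \<inter> part G s1"
          using s1[of "t0 / 2"] linepath_in_edge[of "t0 / 2" a b] t0 E(3) by auto
        moreover have "linepath a b t \<in> convex hull E \<inter> part G s2"
          using s2[of t] linepath_in_edge[of t a b] that t0 E(3) by auto
        ultimately show ?thesis using ne by (cases s; cases s1; cases s2) blast+
      qed
      then show False using E(4) unfolding is_cut_def by blast
    qed
    \<comment> \<open>The longer piece covers at least half of the parameter interval, hence
      \<open>dist a b \<le> 4 * l\<close> below.\<close>
    obtain p q where pq: "0 \<le> p" "p < q" "q \<le> 1" "1 / 2 \<le> q - p"
      and s: "\<And>t. p < t \<Longrightarrow> t < q \<Longrightarrow> linepath a b t \<in> part G s1"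
    proof (cases "1 / 2 \<le> t0")
      case True
      then show ?thesis using that[of 0 t0] t0 s1 by auto
    next
      case False
      then show ?thesis using that[of t0 1] t0 s2' by auto
    qed
    let ?l = "(q - p) / 2 * dist a b" and ?x = "linepath a b ((p + q) / 2)"
    have "1 / 4 * dist a b \<le> ?l" using pq by (intro mult_right_mono) auto
    then have l: "dist a b \<le> 4 * ?l" by linarith
    obtain T z where T: "T \<in> {V, W}"
      and z: "ball z (?l / (100 * \<kappa>\<^sup>2)) \<subseteq> convex hull T \<inter> part G s1" "dist z ?x \<le> ?l" "\<kappa> \<ge> 1"
      using fat_disc_off_interface[OF E(1-3) pq(1-3) s] by blast
    obtain c n where Tn: "edge_triangle T a b c n" using neighbour_triangle[OF E(1-3) T] .
    have "fat a b {0..1} T"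
    proof (rule fatI[OF _ z, where F = "{0, t0, 1}"])
      show "?l > 0" using pq ab by simp
      show "side_at G T (linepath a b t) = s1" if "t \<in> {0..1} - {0, t0, 1}" for t
      proof -
        have "0 < t" "t < 1" "t \<noteq> t0" using that by auto
        then show ?thesis
          using s1[of t] s2'[of t] by (intro side_at_part[OF Tn]) (cases t t0 rule: linorder_cases; auto)+
      qed
      show "dist (linepath a b t) ?x \<le> 4 * ?l" if "t \<in> {0..1}" for t
      proof -
        have "\<bar>t - (p + q) / 2\<bar> \<le> 1" using that pq unfolding abs_le_iff by (simp add: field_simps)
        then have "\<bar>t - (p + q) / 2\<bar> * dist a b \<le> 1 * dist a b" by (intro mult_right_mono) auto
        then show ?thesis unfolding dist_linepath using l by linarith
      qed
      show "dist a b * measure lborel {0..1::real} \<le> 4 * ?l" using l by simp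
    qed simp
    then show ?thesis using T by blast
  qed
qed

text \<open>No penalty on second normal derivatives is available at these edges, so each neighbour
  has to be fat on its own. Its closed triangle misses \<Gamma>, so the incircle lies on one side,
  and shape regularity compares it with the edge.\<close>

lemma uncut_edge_off_interface_fat:
  assumes E: "E \<in> int_edges G" "neighbours G E = (V, W)" "E = {a, b}"
    and off: "E \<notin> iface_elem_edges G" and T: "T \<in> {V, W}"
  shows "fat a b {0..1} T"
proof -
  note N = int_edge_neighbours[OF E(1,2)]
  have TM: "T \<in> mesh G" "E \<in> edges_of T" using T N by auto
  have hull: "convex hull T \<inter> Gam G = {}"
    using off TM unfolding iface_elem_edges_def iface_elems_def by blast
  obtain c n where Tn: "edge_triangle T a b c n" using neighbour_triangle[OF E(1-3) T] .
  interpret edge_triangle T a b c n by (rule Tn)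
  obtain s where s: "\<And>t. 0 < t \<Longrightarrow> t < 1 \<Longrightarrow> linepath a b t \<in> part G s"
  proof -
    have "linepath a b t \<notin> Gam G" if "0 < t" "t < 1" for t
      using hull linepath_in_triangle[of t] that by auto
    then show ?thesis using open_segment_in_part[OF E(1,3), of 0 1] that by auto
  qed
  have K: "interior (convex hull T) \<subseteq> dom Q - Gam G"
    using mesh_triangle(4)[OF TM(1)] hull interior_subset by blast
  obtain y where y: "y \<in> interior (convex hull T)" "y \<in> part G s"
    using interior_near_edge_meets_part[OF Tn, of "1/2" "part G s"] open_part s[of "1/2"] by auto
  have Ks: "interior (convex hull T) \<subseteq> part G s"
    using connected_subset_part[OF convex_connected[OF convex_interior[OF convex_convex_hull]] K y] .
  obtain c' \<rho> where c': "\<rho> > 0" "cball c' \<rho> \<subseteq> convex hull T" "diameter (convex hull T) \<le> \<kappa> * \<rho>"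
    using incircle[OF TM(1)] .
  have cT: "c' \<in> convex hull T" using c' by auto
  \<comment> \<open>A radius of the inscribed disc lies in the element, so \<rho> is at most the
    diameter and \<kappa> is at least one.\<close>
  have "c' - \<rho> *\<^sub>R n \<in> convex hull T" using c' n(1) by (auto simp: dist_norm)
  then have "dist c' (c' - \<rho> *\<^sub>R n) \<le> diameter (convex hull T)" by (rule mesh_dist_le[OF TM(1) cT])
  moreover have "dist c' (c' - \<rho> *\<^sub>R n) = \<rho>" using n(1) c'(1) by (simp add: dist_norm)
  ultimately have "1 * \<rho> \<le> \<kappa> * \<rho>" using c'(3) by linarith
  then have \<kappa>: "1 \<le> \<kappa>" using c'(1) by (simp only: mult_le_cancel_right)
  have "\<kappa> * 1 \<le> \<kappa> * (500 * \<kappa>)" using \<kappa> by (intro mult_left_mono) auto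
  then have "\<kappa> * \<rho> \<le> 500 * \<kappa>\<^sup>2 * \<rho>"
    using c'(1) by (intro mult_right_mono) (auto simp: power2_eq_square)
  then have d: "dist x y \<le> 500 * \<kappa>\<^sup>2 * \<rho>" if "x \<in> convex hull T" "y \<in> convex hull T" for x y
    using mesh_dist_le[OF TM(1) that] c'(3) by linarith
  have "ball c' \<rho> \<subseteq> interior (convex hull T)" using c'(2) by (intro interior_maximal) auto
  then have "ball c' \<rho> \<subseteq> convex hull T \<inter> part G s" using Ks c'(2) by auto
  moreover have "side_at G T (linepath a b t) = s" if "t \<in> {0..1} - {0, 1}" for t
    using that s by (intro side_at_part[OF Tn]) auto
  moreover have "dist (linepath a b t) c' \<le> 500 * \<kappa>\<^sup>2 * \<rho>" if "t \<in> {0..1}" for t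
    using d[OF linepath_in_triangle[OF that] cT] .
  moreover have "dist a b * measure lborel {0..1::real} \<le> 500 * \<kappa>\<^sup>2 * \<rho>"
    using d[OF linepath_in_triangle linepath_in_triangle, of 0 1] by (simp add: dist_linepath)
  ultimately show ?thesis
    unfolding fat_def using c'(1) 
    by (intro exI[of _ s] exI[of _ c'] exI[of _ \<rho>] exI[of _ "{0, 1}"]) blast
qed

end

text \<open>For large \<open>t\<close> the term with \<open>b\<close> fades and a negative
  \<open>a\<close> would win. Applied to a form and its own diagonal, this gives the sign of each
  term of the norm.\<close>

lemma cs_nonneg:
  assumes "cs a b c"
  shows "0 \<le> a"
proof (rule ccontr)
  assume a: "\<not> 0 \<le> a"
  \<comment> \<open>Chosen so that \<open>t * a\<close> is at most
    \<open>- (\<bar>b\<bar> + 1)\<close> while \<open>b / t\<close> is at most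
    \<open>\<bar>b\<bar>\<close>.\<close>
  define t where "t = max 1 ((\<bar>b\<bar> + 1) / (- a))"
  have t: "t \<ge> 1" "(\<bar>b\<bar> + 1) / (- a) \<le> t" by (auto simp: t_def)
  have "(\<bar>b\<bar> + 1) \<le> t * (- a)" using t(2) a by (simp only: pos_divide_le_eq[of "- a"])
  moreover have "b / t \<le> \<bar>b\<bar> / 1"
    using t(1) by (intro frac_le) auto
  moreover have "0 \<le> t * a + b / t"
    using csD[OF assms, of t] t(1) abs_ge_zero[of c] by linarith
  ultimately show False by simp
qed

section \<open>Integrals along edges and along the interface\<close>

text \<open>\<open>edge_int\<close> orders the end points by a choice. This predicate names the
  chosen order, so that estimates can be carried out on a concrete parametrization.\<close>

definition edge_param :: "cell \<Rightarrow> real^2 \<Rightarrow> real^2 \<Rightarrow> bool" where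
  "edge_param E a b \<longleftrightarrow> a \<noteq> b \<and> E = {a, b} \<and> (\<forall>S f. edge_int E S f = dist a b *
     set_lebesgue_integral lborel (edge_times a b S) (\<lambda>t. f (linepath a b t)))"

lemma edge_paramD:
  assumes "edge_param E a b"
  shows "a \<noteq> b" "E = {a, b}"
    "\<And>S f. edge_int E S f = dist a b *
       set_lebesgue_integral lborel (edge_times a b S) (\<lambda>t. f (linepath a b t))"
  using assms unfolding edge_param_def by blast+

lemma edge_param_exists:
  assumes "card E = 2"
  shows "\<exists>a b. edge_param E a b"
proof -
  obtain a b where ab: "(SOME (a, b). E = {a, b}) = (a, b)" by (cases "SOME (a, b). E = {a, b}")
  have "\<exists>p. (\<lambda>(a, b). E = {a, b}) p" using assms by (auto simp: card_2_iff)
  then have "(\<lambda>(a, b). E = {a, b}) (SOME (a, b). E = {a, b})" by (rule someI_ex)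
  then have E: "E = {a, b}" unfolding ab by simp
  then have "a \<noteq> b" using assms by auto
  moreover have "edge_int E S f = dist a b *
       set_lebesgue_integral lborel (edge_times a b S) (\<lambda>t. f (linepath a b t))" for S f
    unfolding edge_int_def ab Let_def prod.case linepath_def by (simp add: dist_norm norm_minus_commute)
  ultimately show ?thesis using E unfolding edge_param_def by blast
qed

text \<open>Required for both orders of the end points, so that the property is independent of the
  order chosen in \<open>edge_int\<close>.\<close>

definition edge_bdd :: "cell \<Rightarrow> (real^2 \<Rightarrow> real) \<Rightarrow> bool" where
  "edge_bdd E f \<longleftrightarrow> (\<forall>a b. E = {a, b} \<longrightarrow> bdd_borel (\<lambda>t. f (linepath a b t)))"

lemma edge_bddD: "edge_bdd E f \<Longrightarrow> E = {a, b} \<Longrightarrow> bdd_borel (\<lambda>t. f (linepath a b t))"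
  unfolding edge_bdd_def by blast

lemma continuous_on_linepath_UNIV: "continuous_on UNIV (linepath a b)" for a b :: "real^2"
  unfolding linepath_def by (intro continuous_intros)

lemma borel_linepath_vimage:
  fixes a b :: "real^2"
  assumes "S \<in> sets borel"
  shows "linepath a b -` S \<in> sets borel"
  using measurable_sets[OF borel_measurable_continuous_onI[OF continuous_on_linepath_UNIV] assms, of a b]
  by simp

lemma borel_linepath_part:
  fixes a b :: "real^2"
  assumes "S \<in> sets borel"
  shows "edge_times a b S \<in> sets borel"
proof -
  have "edge_times a b S = {0..1} \<inter> linepath a b -` S" by auto
  then show ?thesis using borel_linepath_vimage[OF assms] by simp
qed

lemma edge_bdd_continuous:
  assumes "continuous_on UNIV f"
  shows "edge_bdd E f"
  unfolding edge_bdd_def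
  using continuous_on_compose2[OF assms continuous_on_linepath_UNIV] by (auto intro!: bdd_borel_continuous)

lemma edge_bdd_if:
  assumes "edge_bdd E f" "edge_bdd E g" "A \<in> sets borel"
  shows "edge_bdd E (\<lambda>x. if x \<in> A then f x else g x)"
  unfolding edge_bdd_def
proof (intro allI impI)
  fix a b assume "E = {a, b}"
  from bdd_borel_if[OF assms(1,2)[THEN edge_bddD, OF this] borel_linepath_vimage[OF assms(3), of a b]]
  show "bdd_borel (\<lambda>t. if linepath a b t \<in> A then f (linepath a b t) else g (linepath a b t))" by simp
qed

lemma edge_bdd_mult: "edge_bdd E f \<Longrightarrow> edge_bdd E g \<Longrightarrow> edge_bdd E (\<lambda>x. f x * g x)"
  and edge_bdd_add: "edge_bdd E f \<Longrightarrow> edge_bdd E g \<Longrightarrow> edge_bdd E (\<lambda>x. f x + g x)"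
  and edge_bdd_diff: "edge_bdd E f \<Longrightarrow> edge_bdd E g \<Longrightarrow> edge_bdd E (\<lambda>x. f x - g x)"
  and edge_bdd_divide: "edge_bdd E f \<Longrightarrow> edge_bdd E (\<lambda>x. f x / c)"
  and edge_bdd_power2: "edge_bdd E f \<Longrightarrow> edge_bdd E (\<lambda>x. (f x)\<^sup>2)"
  and edge_bdd_const: "edge_bdd E (\<lambda>x. c)"
  unfolding edge_bdd_def
  by (simp_all add: bdd_borel_mult bdd_borel_add bdd_borel_diff bdd_borel_divide_const bdd_borel_power2)

lemma cs_edge_int_weighted:
  assumes "card E = 2" "S \<in> sets borel" "edge_bdd E w" "edge_bdd E f" "edge_bdd E g" "\<And>x. 0 \<le> w x"
  shows "cs (edge_int E S (\<lambda>x. w x * f x * f x)) (edge_int E S (\<lambda>x. w x * g x * g x))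
     (edge_int E S (\<lambda>x. w x * f x * g x))"
proof -
  obtain a b where "edge_param E a b" using edge_param_exists[OF assms(1)] by blast
  note ab = edge_paramD[OF this] this
  show ?thesis unfolding ab(3)
    by (intro cs_scale cs_bdd_borel_weighted assms(3-5)[THEN edge_bddD, OF ab(2)]
        borel_linepath_part assms(2)) (auto simp: assms(6))
qed

lemma cs_edge_int:
  assumes "card E = 2" "S \<in> sets borel" "edge_bdd E f" "edge_bdd E g"
  shows "cs (edge_int E S (\<lambda>x. f x * f x)) (edge_int E S (\<lambda>x. g x * g x)) (edge_int E S (\<lambda>x. f x * g x))"
  using cs_edge_int_weighted[OF assms(1,2) edge_bdd_const[of _ 1] assms(3,4)] by simp

lemma edge_int_mono:
  assumes "card E = 2" "S \<in> sets borel" "edge_bdd E f" "edge_bdd E g" "\<And>x. f x \<le> g x"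
  shows "edge_int E S f \<le> edge_int E S g"
proof -
  obtain a b where "edge_param E a b" using edge_param_exists[OF assms(1)] by blast
  note ab = edge_paramD[OF this] this
  show ?thesis unfolding ab(3)
    by (intro mult_left_mono set_integral_mono bdd_borel_set_integrable
        assms(3,4)[THEN edge_bddD, OF ab(2)] borel_linepath_part assms(2)) (auto simp: assms(5))
qed

lemma edge_int_add:
  assumes "card E = 2" "S \<in> sets borel" "edge_bdd E f" "edge_bdd E g"
  shows "edge_int E S (\<lambda>x. f x + g x) = edge_int E S f + edge_int E S g"
proof -
  obtain a b where "edge_param E a b" using edge_param_exists[OF assms(1)] by blast
  note ab = edge_paramD[OF this] this
  have "set_integrable lborel (edge_times a b S) (\<lambda>t. h (linepath a b t))"
    if "edge_bdd E h" for h
    by (intro bdd_borel_set_integrable edge_bddD[OF that ab(2)] borel_linepath_part assms(2)) auto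
  then show ?thesis unfolding ab(3) using assms(3,4) by (simp add: set_integral_add(2) distrib_left)
qed

lemma edge_int_cmult:
  assumes "card E = 2"
  shows "edge_int E S (\<lambda>x. c * f x) = c * edge_int E S f"
proof -
  obtain a b where "edge_param E a b" using edge_param_exists[OF assms(1)] by blast
  note ab = edge_paramD[OF this] this
  show ?thesis unfolding ab(3) by simp
qed

lemma edge_len_eq_measure:
  assumes "edge_param E a b" "S \<in> sets borel"
  shows "edge_len E S = dist a b * measure lborel (edge_times a b S)"
  unfolding edge_len_def edge_paramD(3)[OF assms(1)] set_lebesgue_integral_def using borel_linepath_part[OF assms(2), of a b] by simp

lemma edge_len_nonneg:
  assumes "card E = 2"
  shows "0 \<le> edge_len E S"
proof -
  obtain a b where "edge_param E a b" using edge_param_exists[OF assms(1)] by blast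
  note ab = edge_paramD[OF this] this
  show ?thesis unfolding edge_len_def ab(3) by (intro mult_nonneg_nonneg set_integral_nonneg_on) auto
qed

lemma cs_curve_int:
  assumes g: "regular_simple_closed_C2 g" and "S \<in> sets borel"
    and "continuous_on UNIV f1" "continuous_on UNIV f2"
  shows "cs (curve_int g S (\<lambda>t. f1 t * f1 t)) (curve_int g S (\<lambda>t. f2 t * f2 t)) (curve_int g S (\<lambda>t. f1 t * f2 t))"
proof -
  let ?w = "\<lambda>t. norm (vector_derivative g (at t))"
  have J: "{t \<in> {0..1}. g t \<in> S} \<in> sets borel"
  proof -
    have "g \<in> borel_measurable borel"
      using regular_curve_derivative(4)[OF g] by (rule borel_measurable_continuous_onI)
    from measurable_sets[OF this assms(2)] have "{0..1} \<inter> g -` S \<in> sets borel" by auto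
    moreover have "{t \<in> {0..1}. g t \<in> S} = {0..1} \<inter> g -` S" by auto
    ultimately show ?thesis by simp
  qed
  have w: "bdd_borel ?w"
    using regular_curve_derivative(3)[OF g] by (intro bdd_borel_continuous continuous_on_norm)
  have "cs (set_lebesgue_integral lborel {t \<in> {0..1}. g t \<in> S} (\<lambda>t. ?w t * f1 t * f1 t))
     (set_lebesgue_integral lborel {t \<in> {0..1}. g t \<in> S} (\<lambda>t. ?w t * f2 t * f2 t))
     (set_lebesgue_integral lborel {t \<in> {0..1}. g t \<in> S} (\<lambda>t. ?w t * f1 t * f2 t))"
    using J by (intro cs_bdd_borel_weighted w bdd_borel_continuous assms(3,4)) auto
  then show ?thesis unfolding curve_int_def by (simp add: mult_ac)
qed

lemma continuous_cnormal:
  assumes "regular_simple_closed_C2 g"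
  shows "continuous_on UNIV (\<lambda>t. cnormal g t $ i)"
proof -
  have ct: "continuous_on UNIV (\<lambda>t. ctan g t)"
    unfolding ctan_def using regular_curve_derivative(2,3)[OF assms]
    by (intro continuous_on_sgn) auto
  have "continuous_on UNIV (\<lambda>t. ctan g t $ j)" for j
    using ct by (intro continuous_on_component)
  then show ?thesis
    unfolding cnormal_def by (cases "i = 1") (simp_all add: continuous_on_minus)
qed

context admissible_mesh
begin

section \<open>The volume term and the penalty terms as positive semidefinite forms\<close>

lemma piece_polys:
  assumes "u \<in> ife_space Q G" "V \<in> mesh G"
  shows "piece Q G u V s \<in> polys (deg Q)"
proof -
  have "\<exists>w. w \<in> local_space Q G V \<and> represents G V u w"
    using assms unfolding ife_space_def by blast
  then have "piece Q G u V \<in> local_space Q G V"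
    unfolding piece_def by (rule someI2_ex) blast
  moreover have "deg Q > 0" using deg by auto
  ultimately show ?thesis using local_space_polys[OF mesh_triangle(1,2)[OF assms(2)]] by blast
qed

lemma continuous_curve_jumps:
  assumes u: "u \<in> ife_space Q G" and V: "V \<in> mesh G"
  shows "continuous_on UNIV (\<lambda>t. pjump (d_n (cnormal (curve G) t)) (piece Q G u V) (curve G t))"
    and "continuous_on UNIV (\<lambda>t. pjump id (piece Q G u V) (curve G t))"
proof -
  have comp: "continuous_on UNIV (\<lambda>t. q (curve G t))" if "q \<in> polys p" for q p
    using continuous_on_compose2[OF continuous_on_polys[OF that] regular_curve_derivative(4)[OF curve_regular]]
    by auto
  have dn: "continuous_on UNIV (\<lambda>t. d_n (cnormal (curve G) t) q (curve G t))" if "q \<in> polys p" for q p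
    unfolding d_n_def
    by (intro continuous_on_sum continuous_on_mult continuous_cnormal[OF curve_regular] comp[OF pd_polys[OF that]])
  show "continuous_on UNIV (\<lambda>t. pjump (d_n (cnormal (curve G) t)) (piece Q G u V) (curve G t))"
    unfolding pjump_def by (intro continuous_on_diff dn[OF piece_polys[OF u V]])
  show "continuous_on UNIV (\<lambda>t. pjump id (piece Q G u V) (curve G t))"
    unfolding pjump_def id_def by (intro continuous_on_diff comp[OF piece_polys[OF u V]])
qed

lemma borel_hull: "V \<in> mesh G \<Longrightarrow> convex hull V \<in> sets borel"
  using mesh_triangle(5) by (simp add: borel_closed compact_imp_closed)

lemma data_pos: "beta Q s > 0" "sigma_u Q > 0" "sigma_F Q > 0" "sigma_n Q > 0" "mean_beta Q > 0"
  using data unfolding admissible_data_def mean_beta_def by (auto simp: add_pos_pos)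

lemma mesh_diameter_nonneg: "V \<in> mesh G \<Longrightarrow> 0 \<le> diameter (convex hull V)"
  using diameter_ge_0 compact_imp_bounded mesh_triangle(5) by blast

lemma cs_pen_dn_iface:
  assumes "u \<in> ife_space Q G" "v \<in> ife_space Q G"
  shows "cs (pen_dn_iface Q G u u) (pen_dn_iface Q G v v) (pen_dn_iface Q G u v)"
  unfolding pen_dn_iface_def Let_def
  by (intro cs_sum cs_scale cs_curve_int curve_regular borel_hull continuous_curve_jumps assms divide_nonneg_nonneg mult_nonneg_nonneg
      mesh_diameter_nonneg less_imp_le[OF data_pos(2)] less_imp_le[OF data_pos(5)])
    (auto simp: iface_elems_def)

lemma cs_pen_iface:
  assumes "u \<in> ife_space Q G" "v \<in> ife_space Q G"
  shows "cs (pen_iface Q G u u) (pen_iface Q G v v) (pen_iface Q G u v)"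
  unfolding pen_iface_def Let_def
  by (intro cs_sum cs_scale cs_curve_int curve_regular borel_hull continuous_curve_jumps assms divide_nonneg_nonneg mult_nonneg_nonneg zero_le_power
      mesh_diameter_nonneg less_imp_le[OF data_pos(4)] less_imp_le[OF data_pos(5)])
    (auto simp: iface_elems_def)

text \<open>Traces are charged to the energy of a single element before anything is summed, so the
  energy is split accordingly.\<close>

definition A_elem :: "(real^2 \<Rightarrow> real) \<Rightarrow> (real^2 \<Rightarrow> real) \<Rightarrow> cell \<Rightarrow> real" where
  "A_elem u v V = (\<Sum>s\<in>{Pos, Neg}. set_lebesgue_integral lborel (convex hull V \<inter> part G s)
     (\<lambda>x. beta Q s * hess_inner (piece Q G u V s) (piece Q G v V s) x))"

lemma set_integrable_hull_part:
  fixes f :: "real^2 \<Rightarrow> real"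
  assumes "V \<in> mesh G" "continuous_on UNIV f"
  shows "set_integrable lborel (convex hull V \<inter> part G s) f"
proof -
  have "set_integrable lborel (convex hull V) f"
    unfolding set_integrable_def
    by (intro borel_integrable_compact mesh_triangle(5)[OF assms(1)] continuous_on_subset[OF assms(2)]) auto
  moreover have "convex hull V \<inter> part G s \<in> sets lborel"
    using mesh_triangle(5)[OF assms(1)] open_part by (auto simp: borel_closed compact_imp_closed)
  ultimately show ?thesis by (rule set_integrable_subset) auto
qed

lemma continuous_hess_inner:
  assumes "q \<in> polys p" "r \<in> polys p'"
  shows "continuous_on UNIV (hess_inner q r)"
  unfolding hess_inner_def
  by (intro continuous_on_sum continuous_on_mult continuous_on_polys[OF pd_polys[OF pd_polys[OF assms(1)]]]
      continuous_on_polys[OF pd_polys[OF pd_polys[OF assms(2)]]])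

lemma hess_inner_weighted:
  assumes "t > 0"
  shows "2 * \<bar>hess_inner q r x\<bar> \<le> t * hess_inner q q x + hess_inner r r x / t"
proof -
  have "2 * \<bar>hess_inner q r x\<bar> \<le> (\<Sum>i\<in>UNIV. \<Sum>j\<in>UNIV. 2 * \<bar>pd i (pd j q) x * pd i (pd j r) x\<bar>)"
    unfolding hess_inner_def sum_distrib_left[symmetric]
    by (intro mult_left_mono order_trans[OF sum_abs] sum_mono) (auto intro: sum_abs)
  also have "\<dots> \<le> (\<Sum>i\<in>UNIV. \<Sum>j\<in>UNIV. t * (pd i (pd j q) x)\<^sup>2 + (pd i (pd j r) x)\<^sup>2 / t)"
    by (intro sum_mono two_mult_le_weighted assms)
  also have "\<dots> = t * hess_inner q q x + hess_inner r r x / t"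
    unfolding hess_inner_def
    by (simp add: sum.distrib sum_distrib_left sum_divide_distrib power2_eq_square)
  finally show ?thesis .
qed

lemma cs_A_elem:
  assumes "u \<in> ife_space Q G" "v \<in> ife_space Q G" "V \<in> mesh G"
  shows "cs (A_elem u u V) (A_elem v v V) (A_elem u v V)"
proof -
  have cont: "continuous_on UNIV (hess_inner (piece Q G u V s) (piece Q G v V s))"
    if "u \<in> ife_space Q G" "v \<in> ife_space Q G" for u v s
    using that by (intro continuous_hess_inner[OF piece_polys[OF _ assms(3)] piece_polys[OF _ assms(3)]])
  show ?thesis
    unfolding A_elem_def set_integral_mult_right
    by (intro cs_sum cs_scale cs_set_integral set_integrable_hull_part cont hess_inner_weighted
        assms less_imp_le[OF data_pos(1)])
qed

lemma A_h_eq_sum: "A_h Q G u v = (\<Sum>V\<in>mesh G. A_elem u v V)"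
  unfolding A_h_def A_elem_def ..

lemma cs_A_h:
  assumes "u \<in> ife_space Q G" "v \<in> ife_space Q G"
  shows "cs (A_h Q G u u) (A_h Q G v v) (A_h Q G u v)"
  unfolding A_h_eq_sum by (intro cs_sum cs_A_elem assms)

lemma A_elem_nonneg: "u \<in> ife_space Q G \<Longrightarrow> V \<in> mesh G \<Longrightarrow> 0 \<le> A_elem u u V"
  using cs_nonneg[OF cs_A_elem] by blast

text \<open>At ambiguous points \<open>side_at\<close> is an arbitrary choice, but the choice
  depends only on which of two closed sets contain the point. Four Borel cases remain.\<close>

lemma borel_side_at: "{x. side_at G V x = Pos} \<in> sets borel"
proof -
  let ?C = "\<lambda>s. closure (interior (convex hull V) \<inter> part G s)"
  \<comment> \<open>The choice as a function of two truth values, so that all points with the same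
    memberships get the same side.\<close>
  define h where "h P N = (SOME s. case s of Pos \<Rightarrow> P | Neg \<Rightarrow> N)" for P N
  have h: "side_at G V x = h (x \<in> ?C Pos) (x \<in> ?C Neg)" for x
    unfolding side_at_def h_def by (intro arg_cong[where f = Eps] ext) (simp split: side.split)
  have C: "?C s \<in> sets borel" for s by (simp add: borel_closed)
  have "{x. side_at G V x = Pos} =
      (if h True True = Pos then ?C Pos \<inter> ?C Neg else {}) \<union> (if h True False = Pos then ?C Pos - ?C Neg else {})
    \<union> (if h False True = Pos then ?C Neg - ?C Pos else {}) \<union> (if h False False = Pos then - ?C Pos \<inter> - ?C Neg else {})"
    (is "_ = ?R")
  proof (intro set_eqI)
    fix x show "x \<in> {x. side_at G V x = Pos} \<longleftrightarrow> x \<in> ?R"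
      unfolding mem_Collect_eq h by (cases "x \<in> ?C Pos"; cases "x \<in> ?C Neg") simp_all
  qed
  also have "\<dots> \<in> sets borel" using C by auto
  finally show ?thesis .
qed

lemma edge_bdd_side:
  assumes "edge_bdd E (f Pos)" "edge_bdd E (f Neg)"
  shows "edge_bdd E (\<lambda>x. f (side_at G V x) x)"
proof -
  have "(\<lambda>x. f (side_at G V x) x) = (\<lambda>x. if x \<in> {x. side_at G V x = Pos} then f Pos x else f Neg x)"
  proof
    fix x show "f (side_at G V x) x = (if x \<in> {x. side_at G V x = Pos} then f Pos x else f Neg x)"
      by (cases "side_at G V x") simp_all
  qed
  then show ?thesis using edge_bdd_if[OF assms borel_side_at] by simp
qed

lemma edge_bdd_beta_at: "edge_bdd E (beta_at Q G)"
proof -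
  have "edge_bdd E (\<lambda>x. if x \<in> part G Pos then beta Q Pos
      else if x \<in> part G Neg then beta Q Neg else mean_beta Q)"
    using open_part by (intro edge_bdd_if edge_bdd_const borel_open)
  then show ?thesis by (simp add: beta_at_def[abs_def])
qed

lemma edge_bdd_trace:
  assumes u: "u \<in> ife_space Q G" and V: "V \<in> mesh G"
    and L: "\<And>q. q \<in> polys (deg Q) \<Longrightarrow> continuous_on UNIV (L q)"
  shows "edge_bdd E (\<lambda>x. L (tr Q G u V x) x)"
  unfolding tr_def
  using edge_bdd_side[of E "\<lambda>s. L (piece Q G u V s)"] L[OF piece_polys[OF u V]]
  by (simp add: edge_bdd_continuous)

lemma edge_bdd_beta_side: "edge_bdd E (\<lambda>x. beta Q (side_at G V x))"
  using edge_bdd_side[of E "\<lambda>s x. beta Q s"] by (simp add: edge_bdd_const)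

lemma continuous_edge_operators:
  assumes "q \<in> polys p"
  shows "continuous_on UNIV (d_n n q)" "continuous_on UNIV (d_nn n q)" "continuous_on UNIV (id q)"
  using continuous_on_polys[OF d_n_polys[OF assms]] continuous_on_polys[OF d_nn_polys[OF assms]]
    continuous_on_polys[OF assms] by auto

lemma edge_bdd_jump:
  assumes "u \<in> ife_space Q G" "E \<in> int_edges G"
    and L: "\<And>q. q \<in> polys (deg Q) \<Longrightarrow> continuous_on UNIV (L q)"
  shows "edge_bdd E (edge_jump Q G E L u)"
proof -
  obtain V W where N: "neighbours G E = (V, W)" by (cases "neighbours G E")
  show ?thesis
    unfolding edge_jump_def[abs_def] N prod.case
    using int_edge_neighbours[OF assms(2) N] by (intro edge_bdd_diff edge_bdd_trace assms(1) L)
qed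

lemma card_int_edge: "E \<in> int_edges G \<Longrightarrow> card E = 2"
  unfolding int_edges_def edges_of_def by blast

lemma beta_at_nonneg: "0 \<le> beta_at Q G x"
  unfolding beta_at_def using data_pos(1,5) by (auto intro: less_imp_le)

lemma cs_pen_edges:
  assumes u: "u \<in> ife_space Q G" and v: "v \<in> ife_space Q G"
  shows "cs (pen_dn_uncut Q G u u) (pen_dn_uncut Q G v v) (pen_dn_uncut Q G u v)"
    and "cs (pen_dn_cut Q G u u) (pen_dn_cut Q G v v) (pen_dn_cut Q G u v)"
    and "cs (pen_dnn_cut Q G u u) (pen_dnn_cut Q G v v) (pen_dnn_cut Q G u v)"
    and "cs (pen_dnn_uncut Q G u u) (pen_dnn_uncut Q G v v) (pen_dnn_uncut Q G u v)"
    and "cs (pen_cut Q G u u) (pen_cut Q G v v) (pen_cut Q G u v)"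
proof -
  have dn: "edge_bdd E (edge_jump Q G E (d_n n) u)" if "u \<in> ife_space Q G" "E \<in> int_edges G" for u E n
    using that by (intro edge_bdd_jump continuous_edge_operators)
  have dnn: "edge_bdd E (edge_jump Q G E (d_nn n) u)" if "u \<in> ife_space Q G" "E \<in> int_edges G" for u E n
    using that by (intro edge_bdd_jump continuous_edge_operators)
  have id: "edge_bdd E (edge_jump Q G E id u)" if "u \<in> ife_space Q G" "E \<in> int_edges G" for u E
    using that by (intro edge_bdd_jump continuous_edge_operators)
  have S: "UNIV \<in> sets borel" "part G s \<in> sets borel" for s using open_part by auto
  note pos = less_imp_le[OF data_pos(1)] less_imp_le[OF data_pos(2)] less_imp_le[OF data_pos(3)]
    less_imp_le[OF data_pos(4)] less_imp_le[OF data_pos(5)]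
  note rules = cs_sum cs_scale cs_edge_int cs_edge_int_weighted card_int_edge S edge_bdd_beta_at
    dn dnn id u v beta_at_nonneg divide_nonneg_nonneg mult_nonneg_nonneg zero_le_power edge_len_nonneg pos
  show "cs (pen_dn_uncut Q G u u) (pen_dn_uncut Q G v v) (pen_dn_uncut Q G u v)"
    unfolding pen_dn_uncut_def Let_def by (intro rules) (auto simp: int_edges_uncut_def)
  show "cs (pen_dn_cut Q G u u) (pen_dn_cut Q G v v) (pen_dn_cut Q G u v)"
    unfolding pen_dn_cut_def Let_def by (intro rules) (auto simp: int_edges_cut_def)
  show "cs (pen_dnn_cut Q G u u) (pen_dnn_cut Q G v v) (pen_dnn_cut Q G u v)"
    unfolding pen_dnn_cut_def Let_def by (intro rules) (auto simp: int_edges_cut_def)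
  show "cs (pen_dnn_uncut Q G u u) (pen_dnn_uncut Q G v v) (pen_dnn_uncut Q G u v)"
    unfolding pen_dnn_uncut_def Let_def by (intro rules) (auto simp: int_edges_uncut_def)
  show "cs (pen_cut Q G u u) (pen_cut Q G v v) (pen_cut Q G u v)"
    unfolding pen_cut_def Let_def by (intro rules) (auto simp: int_edges_cut_def)
qed

section \<open>The consistency terms\<close>

text \<open>\<open>edge_normal\<close> is a definite description, so it has to be shown that exactly
  one vector qualifies: unit normals of an edge agree up to sign, and the third vertex of the first
  neighbour fixes the sign.\<close>

lemma edge_normal_unit:
  assumes E: "E \<in> int_edges G"
  shows "norm (edge_normal G E) = 1"
proof -
  obtain V W where N: "neighbours G E = (V, W)" by (cases "neighbours G E")
  obtain a b where Eab: "E = {a, b}" using card_int_edge[OF E] by (auto simp: card_2_iff)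
  obtain c n where Vn: "edge_triangle V a b c n" using neighbour_triangle[OF E N Eab, of V] by auto
  interpret edge_triangle V a b c n by (rule Vn)
  have "c \<noteq> a" "c \<noteq> b" using n c by auto
  then have "V - E = {c}" unfolding T Eab by auto
  then have VE: "fst (neighbours G E) - E = {c}" by (simp add: N)
  have cb: "n \<bullet> (c - b) = n \<bullet> (c - a)" using n(2) by (simp add: inner_diff_right)
  let ?P = "\<lambda>m. norm m = 1 \<and> (\<forall>x\<in>E. \<forall>y\<in>E. m \<bullet> (x - y) = 0) \<and>
             (\<forall>x\<in>E. \<forall>c\<in>fst (neighbours G E) - E. m \<bullet> (c - x) < 0)"
  have "?P (- n)"
    unfolding VE unfolding Eab using n c cb by (auto simp: inner_diff_right)
  moreover have "m = - n" if m: "?P m" for m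
  proof -
    have m': "norm m = 1" "m \<bullet> (b - a) = 0" "m \<bullet> (c - a) < 0"
      using m unfolding VE unfolding Eab by auto
    have "m \<noteq> n" using m'(3) c by auto
    then show ?thesis using unit_normal_cases[OF m'(1,2)] by blast
  qed
  ultimately have "?P (edge_normal G E)" unfolding edge_normal_def by (rule theI)
  then show ?thesis by blast
qed

text \<open>With the Hessian \<open>H\<close> the left side is the square of
  \<open>n \<bullet> H n\<close>. The Cauchy-Schwarz inequality is used once for the outer product
  and once for each row, leading to the Frobenius norm.\<close>

lemma d_nn_square_le_hess:
  assumes "norm n = 1"
  shows "(d_nn n q x)\<^sup>2 \<le> hess_inner q q x"
proof -
  have n: "n $ 1 * n $ 1 + n $ 2 * n $ 2 = 1" using assms by (simp add: norm_eq_1 inner_2)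
  let ?h = "\<lambda>i j. pd i (pd j q) x"
  have "d_nn n q x = (\<Sum>i\<in>UNIV. n $ i * (\<Sum>j\<in>UNIV. ?h i j * n $ j))"
    unfolding d_nn_def by (simp add: sum_2 algebra_simps)
  also have "\<dots> = n \<bullet> (\<chi> i. (\<chi> j. ?h i j) \<bullet> n)"
    by (simp add: inner_vec_def)
  finally have "(d_nn n q x)\<^sup>2 = (n \<bullet> (\<chi> i. (\<chi> j. ?h i j) \<bullet> n))\<^sup>2" by simp
  also have "\<dots> \<le> (n \<bullet> n) * ((\<chi> i. (\<chi> j. ?h i j) \<bullet> n) \<bullet> (\<chi> i. (\<chi> j. ?h i j) \<bullet> n))"
    by (rule Cauchy_Schwarz_ineq)
  also have "\<dots> = (\<Sum>i\<in>UNIV. ((\<chi> j. ?h i j) \<bullet> n)\<^sup>2)"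
    using n by (simp add: inner_2 inner_vec_def[of "vec_lambda _"] sum_2 power2_eq_square)
  also have "\<dots> \<le> (\<Sum>i\<in>UNIV. ((\<chi> j. ?h i j) \<bullet> (\<chi> j. ?h i j)) * (n \<bullet> n))"
    by (intro sum_mono Cauchy_Schwarz_ineq)
  also have "\<dots> = hess_inner q q x"
    using n unfolding hess_inner_def by (simp add: inner_2 sum_2)
  finally show ?thesis .
qed

text \<open>With \<open>M\<close> = \<open>500 * \<kappa>\<^sup>2\<close>, the factor
  \<open>8 * (1 + 2 * M)\<^sup>2\<close> is the cost of extrapolating from the disc to the edge, and
  \<open>M\<^sup>2\<close> comes from bounding the squared length of the edge part by the radius of
  the disc.\<close>

definition fat_const :: real where
  "fat_const = 8 * (500 * \<kappa>\<^sup>2)\<^sup>2 * (1 + 2 * (500 * \<kappa>\<^sup>2))\<^sup>2"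

lemma fat_const_nonneg: "0 \<le> fat_const"
  unfolding fat_const_def by simp

text \<open>The squared trace is bounded pointwise by the energy on the disc divided by the squared
  radius. Integration brings one factor of the length of the part, the weight brings another, and
  together they cancel the radius.\<close>

lemma fat_trace_bound:
  assumes u: "u \<in> ife_space Q G" and TM: "T \<in> mesh G" and n: "norm n = 1"
    and ep: "edge_param E a b" and S: "S \<in> sets borel"
    and fat: "fat a b (edge_times a b S) T"
    and \<beta>: "\<beta> > 0" "\<And>s. \<beta> \<le> beta Q s"
  shows "edge_len E S * edge_int E S (\<lambda>x. (d_nn n (tr Q G u T x) x)\<^sup>2) \<le> fat_const / \<beta> * A_elem u u T"
proof -
  note E = edge_paramD(3)[OF ep] and ab = edge_paramD(2)[OF ep]
  let ?J = "edge_times a b S"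
  let ?M = "500 * \<kappa>\<^sup>2"
  obtain s z \<delta> F where \<delta>: "\<delta> > 0" "ball z \<delta> \<subseteq> convex hull T \<inter> part G s" "finite F"
    and side: "\<And>t. t \<in> ?J - F \<Longrightarrow> side_at G T (linepath a b t) = s"
    and dist: "\<And>t. t \<in> ?J \<Longrightarrow> dist (linepath a b t) z \<le> ?M * \<delta>"
    and len: "dist a b * measure lborel ?J \<le> ?M * \<delta>"
    using fat unfolding fat_def by blast
  define q where "q = piece Q G u T s"
  define f where "f = d_nn n q"
  have q: "q \<in> polys (deg Q)" unfolding q_def by (rule piece_polys[OF u TM])
  have "f \<in> polys 1" unfolding f_def using polys_mono[OF d_nn_polys[OF q]] deg by auto
  then obtain g where f: "\<And>x y. f y = f x + g \<bullet> (y - x)" using polys_1_affine by blast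
  let ?I = "set_lebesgue_integral lborel (convex hull T \<inter> part G s) (\<lambda>x. (f x)\<^sup>2)"
  have contf: "continuous_on UNIV (\<lambda>x. (f x)\<^sup>2)"
    unfolding f_def by (intro continuous_on_power continuous_edge_operators(2)[OF q])
  note intf = set_integrable_hull_part[OF TM contf, of s]
  have I0: "0 \<le> ?I" by (rule set_integral_nonneg_on) simp
  \<comment> \<open>Bound for the squared trace at every point of the edge part, from extrapolating
    the affine \<open>f\<close> out of the disc.\<close>
  define B where "B = 8 * (1 + 2 * ?M)\<^sup>2 * ?I / \<delta>\<^sup>2"
  have B0: "0 \<le> B" unfolding B_def using I0 by simp
  have B: "(f (linepath a b t))\<^sup>2 \<le> B" if "t \<in> ?J" for t
  proof -
    have "(f (linepath a b t))\<^sup>2 * \<delta>\<^sup>2 \<le> 8 * (1 + 2 * ?M)\<^sup>2 * ?I"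
      using affine_square_le_integral[OF f \<delta>(1,2) intf dist[OF that]] .
    then show ?thesis unfolding B_def using \<delta>(1) by (simp add: pos_le_divide_eq)
  qed
  have Jb: "?J \<in> sets borel" by (rule borel_linepath_part[OF S])
  \<comment> \<open>On \<open>F\<close> the trace may pick the polynomial of the other side; a
    finite set does not affect the integral.\<close>
  have F0: "AE t in lborel. t \<notin> F"
    using \<delta>(3) by (intro AE_not_in finite_imp_null_set_lborel)
  let ?h = "\<lambda>t. (d_nn n (tr Q G u T (linepath a b t)) (linepath a b t))\<^sup>2"
  have "set_lebesgue_integral lborel ?J ?h \<le> set_lebesgue_integral lborel ?J (\<lambda>t. B)"
  proof (rule set_integral_mono_AE)
    have "edge_bdd E (\<lambda>x. (d_nn n (tr Q G u T x) x)\<^sup>2)"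
      by (intro edge_bdd_power2 edge_bdd_trace[OF u TM] continuous_edge_operators)
    from edge_bddD[OF this ab] show "set_integrable lborel ?J ?h"
      using Jb by (rule bdd_borel_set_integrable) auto
    show "set_integrable lborel ?J (\<lambda>t. B)" using Jb by (intro bdd_borel_set_integrable) auto
    show "AE t\<in>?J in lborel. ?h t \<le> B"
      using F0
    proof (rule AE_mp, intro AE_I2 impI)
      fix t assume "t \<notin> F" "t \<in> ?J"
      then show "?h t \<le> B" using B[of t] side[of t] unfolding tr_def f_def q_def by simp
    qed
  qed
  also have "\<dots> = B * measure lborel ?J"
    unfolding set_lebesgue_integral_def using Jb by simp
  finally have 1: "edge_int E S (\<lambda>x. (d_nn n (tr Q G u T x) x)\<^sup>2) \<le> B * edge_len E S"
    unfolding edge_len_eq_measure[OF ep S] unfolding E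
    by (auto dest: mult_left_mono[of _ _ "dist a b"] simp: mult_ac)
  have l: "0 \<le> edge_len E S" "edge_len E S \<le> ?M * \<delta>"
    using len unfolding edge_len_eq_measure[OF ep S] by auto
  have "edge_len E S * edge_int E S (\<lambda>x. (d_nn n (tr Q G u T x) x)\<^sup>2) \<le> edge_len E S * (B * edge_len E S)"
    using 1 l(1) by (rule mult_left_mono)
  also have "\<dots> = B * (edge_len E S)\<^sup>2" by (simp add: power2_eq_square)
  also have "\<dots> \<le> B * (?M * \<delta>)\<^sup>2" using l B0 by (intro mult_left_mono power_mono)
  also have "\<dots> = fat_const * ?I"
    unfolding B_def fat_const_def using \<delta>(1) by (simp add: power_mult_distrib)
  also have "\<dots> \<le> fat_const * (A_elem u u T / \<beta>)"
  proof (rule mult_left_mono[OF _ fat_const_nonneg])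
    have "\<beta> * ?I = set_lebesgue_integral lborel (convex hull T \<inter> part G s) (\<lambda>x. \<beta> * (f x)\<^sup>2)"
      by simp
    also have "\<dots> \<le> set_lebesgue_integral lborel (convex hull T \<inter> part G s) (\<lambda>x. beta Q s * hess_inner q q x)"
    proof (rule set_integral_mono)
      show "set_integrable lborel (convex hull T \<inter> part G s) (\<lambda>x. \<beta> * (f x)\<^sup>2)"
        using intf by simp
      show "set_integrable lborel (convex hull T \<inter> part G s) (\<lambda>x. beta Q s * hess_inner q q x)"
        using set_integrable_hull_part[OF TM continuous_hess_inner[OF q q]] by simp
      show "\<beta> * (f x)\<^sup>2 \<le> beta Q s * hess_inner q q x" for x
        unfolding f_def using d_nn_square_le_hess[OF n] \<beta> data_pos(1)[of s]
        by (intro mult_mono) auto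
    qed
    also have "\<dots> \<le> A_elem u u T"
    proof -
      have nn: "0 \<le> set_lebesgue_integral lborel (convex hull T \<inter> part G s')
          (\<lambda>x. beta Q s' * hess_inner (piece Q G u T s') (piece Q G u T s') x)" for s'
        using data_pos(1)[of s'] by (intro set_integral_nonneg_on) (simp add: hess_inner_def sum_nonneg)
      show ?thesis unfolding A_elem_def q_def using nn[of Pos] nn[of Neg] by (cases s) auto
    qed
    finally show "?I \<le> A_elem u u T / \<beta>" using \<beta>(1) by (simp add: pos_le_divide_eq mult.commute)
  qed
  finally show ?thesis by simp
qed

text \<open>Free of the choice made by \<open>neighbours\<close>, so that sums over edges and
  elements can be interchanged.\<close>

definition elems_of :: "cell \<Rightarrow> cell set" where
  "elems_of E = {T \<in> mesh G. E \<in> edges_of T}"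

lemma A_elem_neighbours_le:
  assumes u: "u \<in> ife_space Q G" and E: "E \<in> int_edges G" "neighbours G E = (V, W)"
  shows "A_elem u u V + A_elem u u W \<le> (\<Sum>T\<in>elems_of E. A_elem u u T)"
proof -
  note N = int_edge_neighbours[OF E]
  have "A_elem u u V + A_elem u u W = (\<Sum>T\<in>{V, W}. A_elem u u T)" using N(3) by simp
  also have "\<dots> \<le> (\<Sum>T\<in>elems_of E. A_elem u u T)"
    using finite_mesh N A_elem_nonneg[OF u] by (intro sum_mono2) (auto simp: elems_of_def)
  finally show ?thesis .
qed

lemma finite_int_edges: "finite (int_edges G)"
proof -
  have "int_edges G \<subseteq> (\<Union>V\<in>mesh G. Pow V)" unfolding int_edges_def edges_of_def by blast
  then show ?thesis using finite_mesh mesh_triangle(6) by (auto intro: finite_subset)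
qed

text \<open>Double counting: after the interchange of sums, each triangle is counted at most once
  for each of its three edges.\<close>

lemma sum_over_edges_le:
  assumes u: "u \<in> ife_space Q G"
  shows "(\<Sum>E\<in>int_edges G. \<Sum>T\<in>elems_of E. A_elem u u T) \<le> 3 * A_h Q G u u"
proof -
  have "(\<Sum>E\<in>int_edges G. \<Sum>T\<in>elems_of E. A_elem u u T)
      = (\<Sum>T\<in>mesh G. \<Sum>E | E \<in> int_edges G \<and> E \<in> edges_of T. A_elem u u T)"
    unfolding elems_of_def using finite_int_edges finite_mesh by (intro sum.swap_restrict)
  also have "\<dots> \<le> (\<Sum>T\<in>mesh G. 3 * A_elem u u T)"
  proof (rule sum_mono)
    fix T assume T: "T \<in> mesh G"
    have fin: "finite (edges_of T)" 
      unfolding edges_of_def using mesh_triangle(6)[OF T] by simp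
    have "card {E \<in> int_edges G. E \<in> edges_of T} \<le> card (edges_of T)"
      using fin by (intro card_mono) auto
    also have "\<dots> = 3 choose 2"
      unfolding edges_of_def using n_subsets[OF mesh_triangle(6)[OF T], of 2] mesh_triangle(1)[OF T] by simp
    finally have "real (card {E \<in> int_edges G. E \<in> edges_of T}) \<le> 3" by (simp add: choose_two)
    then show "(\<Sum>E | E \<in> int_edges G \<and> E \<in> edges_of T. A_elem u u T) \<le> 3 * A_elem u u T"
      using A_elem_nonneg[OF u T] by (simp add: mult_right_mono)
  qed
  also have "\<dots> = 3 * A_h Q G u u" unfolding A_h_eq_sum sum_distrib_left ..
  finally show ?thesis .
qed

text \<open>Dominates the coefficients and their reciprocals, so a single number gives upper and
  lower bounds on both sides of the interface.\<close>

definition beta_bound :: real where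
  "beta_bound = beta Q Pos + beta Q Neg + 1 / beta Q Pos + 1 / beta Q Neg"

lemma beta_bound: "beta Q s \<le> beta_bound" "1 / beta_bound \<le> beta Q s" "beta_bound > 0"
proof -
  have p: "beta Q Pos > 0" "beta Q Neg > 0" "1 / beta Q Pos > 0" "1 / beta Q Neg > 0"
    using data_pos(1) by auto
  show B: "beta_bound > 0" unfolding beta_bound_def using p by linarith
  show B': "beta Q s \<le> beta_bound"
    unfolding beta_bound_def using p by (cases s) (simp_all add: add_nonneg_nonneg)
  have "1 / beta Q s \<le> beta_bound" unfolding beta_bound_def using p by (cases s) (simp_all add: add_nonneg_nonneg)
  then show "1 / beta_bound \<le> beta Q s"
    using B data_pos(1)[of s] by (simp add: field_simps)
qed

lemma beta_at_ge: "1 / beta_bound \<le> beta_at Q G x"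
  unfolding beta_at_def mean_beta_def using beta_bound(2)[of Pos] beta_bound(2)[of Neg] by auto

text \<open>The square of \<open>beta_bound\<close> removes the coefficients from the average. The
  bracket stems from the case of one fat neighbour: three times its trace bound, plus twice the
  jump.\<close>

definition cons_const :: real where
  "cons_const = beta_bound\<^sup>2 * (3 * (fat_const * beta_bound) + 2)"

text \<open>With a single fat neighbour, the trace from the other one is controlled by the jump of
  \<open>\<partial>\<^sub>n\<^sub>n u\<close>.\<close>

lemma average_bound:
  assumes u: "u \<in> ife_space Q G" and E: "E \<in> int_edges G" "neighbours G E = (V, W)"
    and S: "S \<in> sets borel" and n: "norm n = 1"
    and ep: "edge_param E a b"
    and fat: "(\<exists>T\<in>{V, W}. fat a b (edge_times a b S) T) \<and> j = 1 \<or>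
      (\<forall>T\<in>{V, W}. fat a b (edge_times a b S) T) \<and> j = 0"
  shows "edge_len E S * edge_int E S (\<lambda>x. edge_avg_beta Q G E (d_nn n) u x * edge_avg_beta Q G E (d_nn n) u x)
    \<le> cons_const * ((\<Sum>T\<in>elems_of E. A_elem u u T) + j * (edge_len E S *
        edge_int E S (\<lambda>x. edge_jump Q G E (d_nn n) u x * edge_jump Q G E (d_nn n) u x)))"
proof -
  note N = int_edge_neighbours[OF E]
  note E2 = card_int_edge[OF E(1)]
  define f where "f T x = d_nn n (tr Q G u T x) x" for T x
  have f: "edge_bdd E (f T)" if "T \<in> mesh G" for T
    unfolding f_def[abs_def] by (intro edge_bdd_trace[OF u that] continuous_edge_operators)
  note fV = f[OF N(1)] and fW = f[OF N(2)]
  let ?av = "edge_avg_beta Q G E (d_nn n) u"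
  have av: "?av x = (beta Q (side_at G V x) * f V x + beta Q (side_at G W x) * f W x) / 2" for x
    unfolding edge_avg_beta_def E(2) f_def by simp
  have ju: "edge_jump Q G E (d_nn n) u x = f V x - f W x" for x
    unfolding edge_jump_def E(2) f_def by simp
  have avb: "edge_bdd E ?av"
    unfolding av[abs_def] by (intro edge_bdd_divide edge_bdd_add edge_bdd_mult edge_bdd_beta_side fV fW)
  let ?l = "edge_len E S" and ?a = "\<Sum>T\<in>elems_of E. A_elem u u T"
  let ?X = "?l * edge_int E S (\<lambda>x. (f V x - f W x)\<^sup>2)"
  have l: "0 \<le> ?l" using edge_len_nonneg[OF E2] .
  have pt: "?av x * ?av x \<le> beta_bound\<^sup>2 * ((f V x)\<^sup>2 + (f W x)\<^sup>2)" for x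
  proof -
    have b: "(beta Q s)\<^sup>2 \<le> beta_bound\<^sup>2" for s
      using beta_bound(1)[of s] data_pos(1)[of s] by (intro power_mono) auto
    let ?p = "beta Q (side_at G V x) * f V x" and ?q = "beta Q (side_at G W x) * f W x"
    have "?av x * ?av x \<le> ?p\<^sup>2 + ?q\<^sup>2"
    proof -
      have "0 \<le> (?p - ?q)\<^sup>2 + 2 * (?p\<^sup>2 + ?q\<^sup>2)" by simp
      then show ?thesis unfolding av by (simp add: power2_eq_square field_simps)
    qed
    also have "\<dots> \<le> beta_bound\<^sup>2 * (f V x)\<^sup>2 + beta_bound\<^sup>2 * (f W x)\<^sup>2"
      unfolding power_mult_distrib by (intro add_mono mult_right_mono b) auto
    finally show ?thesis by (simp add: distrib_left)
  qed
  have "edge_int E S (\<lambda>x. ?av x * ?av x) \<le> edge_int E S (\<lambda>x. beta_bound\<^sup>2 * ((f V x)\<^sup>2 + (f W x)\<^sup>2))"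
    by (intro edge_int_mono E2 S edge_bdd_mult avb edge_bdd_const edge_bdd_add edge_bdd_power2 fV fW pt)
  also have "\<dots> = beta_bound\<^sup>2 * (edge_int E S (\<lambda>x. (f V x)\<^sup>2) + edge_int E S (\<lambda>x. (f W x)\<^sup>2))"
    by (simp add: edge_int_cmult[OF E2] edge_int_add[OF E2 S] edge_bdd_power2 fV fW)
  finally have 1: "?l * edge_int E S (\<lambda>x. ?av x * ?av x) \<le> beta_bound\<^sup>2 *
      (?l * edge_int E S (\<lambda>x. (f V x)\<^sup>2) + ?l * edge_int E S (\<lambda>x. (f W x)\<^sup>2))"
    using mult_left_mono[OF _ l] by (fastforce simp: algebra_simps)
  \<comment> \<open>Either trace is the other one plus or minus the jump; squaring the sum costs a
    factor 2.\<close>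
  have tri: "?l * edge_int E S (\<lambda>x. (f T x)\<^sup>2) \<le> 2 * (?l * edge_int E S (\<lambda>x. (f T' x)\<^sup>2)) + 2 * ?X"
    if TT: "T \<in> {V, W}" "T' \<in> {V, W}" for T T'
  proof -
    have "(f T x)\<^sup>2 \<le> 2 * (f T' x)\<^sup>2 + 2 * (f V x - f W x)\<^sup>2" for x
    proof -
      have "0 \<le> (2 * f V x - f W x)\<^sup>2" "0 \<le> (2 * f W x - f V x)\<^sup>2" by simp_all
      then show ?thesis using TT by (auto simp: power2_eq_square algebra_simps)
    qed
    then have "edge_int E S (\<lambda>x. (f T x)\<^sup>2) \<le> edge_int E S (\<lambda>x. 2 * (f T' x)\<^sup>2 + 2 * (f V x - f W x)\<^sup>2)"
      using TT N by (intro edge_int_mono E2 S edge_bdd_mult edge_bdd_const edge_bdd_add edge_bdd_power2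
          edge_bdd_diff f) auto
    also have "\<dots> = 2 * edge_int E S (\<lambda>x. (f T' x)\<^sup>2) + 2 * edge_int E S (\<lambda>x. (f V x - f W x)\<^sup>2)"
    proof -
      have "edge_bdd E (\<lambda>x. 2 * (f T' x)\<^sup>2)" "edge_bdd E (\<lambda>x. 2 * (f V x - f W x)\<^sup>2)"
        using TT N by (intro edge_bdd_mult edge_bdd_const edge_bdd_power2 edge_bdd_diff f; auto)+
      then show ?thesis by (simp add: edge_int_cmult[OF E2] edge_int_add[OF E2 S])
    qed
    finally show ?thesis using mult_left_mono[OF _ l] by (fastforce simp: algebra_simps)
  qed
  define C where "C = fat_const * beta_bound"
  have C0: "0 \<le> C" unfolding C_def using fat_const_nonneg beta_bound(3) by simp
  have fatT: "?l * edge_int E S (\<lambda>x. (f T x)\<^sup>2) \<le> C * A_elem u u T"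
    if "T \<in> {V, W}" "fat a b (edge_times a b S) T" for T
  proof -
    have TM: "T \<in> mesh G" using that N by auto
    have "0 < 1 / beta_bound" using beta_bound(3) by simp
    from fat_trace_bound[OF u TM n ep S that(2) this beta_bound(2)]
    show ?thesis unfolding f_def C_def by simp
  qed
  have A0: "0 \<le> A_elem u u V" "0 \<le> A_elem u u W" using A_elem_nonneg[OF u] N by auto
  have aVW: "A_elem u u V + A_elem u u W \<le> ?a" by (rule A_elem_neighbours_le[OF u E])
  have a0: "0 \<le> ?a" using aVW A0 by linarith
  have X0: "0 \<le> ?X" 
  proof -
    have "edge_int E S (\<lambda>x. 0 * 0) \<le> edge_int E S (\<lambda>x. (f V x - f W x)\<^sup>2)"
      by (intro edge_int_mono E2 S edge_bdd_const edge_bdd_power2 edge_bdd_diff fV fW) simp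
    moreover have "edge_int E S (\<lambda>x. 0 * 0) = 0 * edge_int E S (\<lambda>x. 0)" using edge_int_cmult[OF E2] .
    ultimately show ?thesis using l by simp
  qed
  \<comment> \<open>The number \<open>j\<close> switches the jump term: with \<open>j = 1\<close>
    one fat neighbour suffices, with \<open>j = 0\<close> both neighbours are fat and no jump is
    required.\<close>
  have 2: "?l * edge_int E S (\<lambda>x. (f V x)\<^sup>2) + ?l * edge_int E S (\<lambda>x. (f W x)\<^sup>2) \<le> (3 * C + 2) * (?a + j * ?X)"
    using fat
  proof (elim disjE conjE)
    assume "\<exists>T\<in>{V, W}. fat a b (edge_times a b S) T" and j: "j = 1"
    then obtain T where T: "T \<in> {V, W}" "fat a b (edge_times a b S) T" by blast
    have "C * A_elem u u T \<le> C * ?a" using T(1) A0 aVW C0 by (intro mult_left_mono) auto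
    then have T3: "?l * edge_int E S (\<lambda>x. (f T x)\<^sup>2) \<le> C * ?a" using fatT[OF T] by linarith
    \<comment> \<open>The trace from the fat neighbour counts once for itself and twice for its
      share in the other trace.\<close>
    have "?l * edge_int E S (\<lambda>x. (f V x)\<^sup>2) + ?l * edge_int E S (\<lambda>x. (f W x)\<^sup>2) \<le>
        3 * (?l * edge_int E S (\<lambda>x. (f T x)\<^sup>2)) + 2 * ?X"
      using tri[of V W] tri[of W V] T(1) by auto
    also have "\<dots> \<le> 3 * C * ?a + 2 * ?X" using T3 by simp
    also have "\<dots> \<le> (3 * C + 2) * (?a + j * ?X)"
    proof -
      have "0 \<le> C * ?X" using C0 X0 by (rule mult_nonneg_nonneg)
      then show ?thesis using a0 unfolding j by (simp add: distrib_left distrib_right)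
    qed
    finally show ?thesis .
  next
    assume *: "\<forall>T\<in>{V, W}. fat a b (edge_times a b S) T" and j: "j = 0"
    have "?l * edge_int E S (\<lambda>x. (f V x)\<^sup>2) + ?l * edge_int E S (\<lambda>x. (f W x)\<^sup>2)
        \<le> C * A_elem u u V + C * A_elem u u W"
      using * by (intro add_mono fatT) auto
    also have "\<dots> \<le> C * ?a" using aVW C0 unfolding distrib_left[symmetric] by (rule mult_left_mono)
    also have "\<dots> \<le> (3 * C + 2) * ?a" using C0 a0 by (intro mult_right_mono) auto
    finally show ?thesis unfolding j by simp
  qed
  have "?l * edge_int E S (\<lambda>x. ?av x * ?av x) \<le> beta_bound\<^sup>2 * ((3 * C + 2) * (?a + j * ?X))"
    using 1 mult_left_mono[OF 2, of "beta_bound\<^sup>2"] by simp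
  then show ?thesis unfolding cons_const_def ju C_def by (simp add: power2_eq_square mult.assoc)
qed

text \<open>The consistency integral runs over the whole edge, the penalties over its two parts. The
  parts miss at most the end points and the crossing point, a null set.\<close>

lemma cut_edge_int_split:
  assumes E: "E \<in> int_edges G" "is_cut G E" and f: "edge_bdd E f"
  shows "edge_int E UNIV f = (\<Sum>s\<in>{Pos, Neg}. edge_int E (part G s) f)"
proof -
  obtain a b where "edge_param E a b" using edge_param_exists[OF card_int_edge[OF E(1)]] by blast
  note ab = edge_paramD[OF this] this
  have nG: "\<not> convex hull E \<subseteq> Gam G"
    using E(2) part_subset unfolding is_cut_def by blast
  obtain t0 s1 s2 where t0: "0 < t0" "t0 \<le> 1"
    and s1: "\<And>t. 0 < t \<Longrightarrow> t < t0 \<Longrightarrow> linepath a b t \<in> part G s1"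
    and s2: "\<And>t. t0 < t \<Longrightarrow> t < 1 \<Longrightarrow> linepath a b t \<in> part G s2"
    using edge_crossing[OF E(1) ab(2) nG] by blast
  let ?J = "\<lambda>S. edge_times a b S"
  let ?f = "\<lambda>t. f (linepath a b t)"
  have J: "?J UNIV \<in> sets borel" "?J (part G s) \<in> sets borel" for s
    using borel_linepath_part open_part by auto
  have bdd: "bdd_borel ?f" using edge_bddD[OF f ab(2)] .
  have disj: "?J (part G Pos) \<inter> ?J (part G Neg) = {}"
    using part_disjoint[of _ Pos Neg] by auto
  have F: "t \<in> ?J (part G Pos) \<union> ?J (part G Neg)" if "t \<in> {0..1}" "t \<notin> {0, t0, 1}" for t
  proof -
    have "linepath a b t \<in> part G s1 \<or> linepath a b t \<in> part G s2"
      using that s1[of t] s2[of t] by (cases t t0 rule: linorder_cases) auto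
    then show ?thesis using that(1) by (cases s1; cases s2) auto
  qed
  have "AE t in lborel. t \<notin> {0, t0, 1}"
    by (intro AE_not_in finite_imp_null_set_lborel) simp
  then have "AE t in lborel. indicator (?J UNIV) t *\<^sub>R ?f t
      = indicator (?J (part G Pos) \<union> ?J (part G Neg)) t *\<^sub>R ?f t"
  proof (rule AE_mp, intro AE_I2 impI)
    fix t assume "t \<notin> {0, t0, 1}"
    then have "t \<in> ?J UNIV \<longleftrightarrow> t \<in> ?J (part G Pos) \<union> ?J (part G Neg)" using F[of t] by auto
    then show "indicator (?J UNIV) t *\<^sub>R ?f t
        = indicator (?J (part G Pos) \<union> ?J (part G Neg)) t *\<^sub>R ?f t"
      by (simp only: indicator_def)
  qed
  then have "set_lebesgue_integral lborel (?J UNIV) ?f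
      = set_lebesgue_integral lborel (?J (part G Pos) \<union> ?J (part G Neg)) ?f"
    unfolding set_lebesgue_integral_def using bdd J
    by (intro integral_cong_AE) (auto simp: bdd_borel_def intro!: borel_measurable_scaleR)
  also have "\<dots> = set_lebesgue_integral lborel (?J (part G Pos)) ?f
      + set_lebesgue_integral lborel (?J (part G Neg)) ?f"
    using J by (intro set_integral_Un disj bdd_borel_set_integrable bdd) auto
  finally show ?thesis unfolding ab(3) by (simp add: distrib_left)
qed

text \<open>The length of the part serves as the parameter that rescales the Cauchy-Schwarz
  inequality, so it must be positive.\<close>

lemma cut_edge_len_pos:
  assumes E: "E \<in> int_edges G" "is_cut G E"
  shows "0 < edge_len E (part G s)"
proof -
  obtain a b where "edge_param E a b" using edge_param_exists[OF card_int_edge[OF E(1)]] by blast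
  note ab = edge_paramD[OF this] this
  obtain p q where pq: "0 \<le> p" "p < q" "q \<le> 1"
    and s: "\<And>t. p < t \<Longrightarrow> t < q \<Longrightarrow> linepath a b t \<in> part G s"
    and J: "edge_times a b (part G s) \<subseteq> {p..q}"
    using cut_edge_crossing[OF E(1) ab(2) E(2), of s] by blast
  have P: "part G s \<in> sets borel" using open_part by simp
  have "measure lborel {p<..<q} \<le> measure lborel (edge_times a b (part G s))"
  proof (rule measure_mono_fmeasurable)
    show "{p<..<q} \<subseteq> edge_times a b (part G s)" using s pq by auto
    have "{p..q} \<in> fmeasurable lborel" using pq by (simp add: fmeasurable_def)
    then show "edge_times a b (part G s) \<in> fmeasurable lborel"
      by (rule fmeasurableI2[OF _ J]) (use borel_linepath_part[OF P, of a b] in \<open>simp only: sets_lborel\<close>)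
  qed simp
  moreover have "measure lborel {p<..<q} = q - p" using pq by simp
  ultimately have "0 < measure lborel (edge_times a b (part G s))" using pq by linarith
  moreover have "0 < dist a b" using ab(1) by simp
  ultimately show ?thesis unfolding edge_len_eq_measure[OF ab(4) P] by (rule mult_pos_pos[rotated])
qed

lemma edge_len_pos:
  assumes "E \<in> int_edges G"
  shows "0 < edge_len E UNIV"
proof -
  obtain a b where "edge_param E a b" using edge_param_exists[OF card_int_edge[OF assms]] by blast
  note ab = edge_paramD[OF this] this
  have "{t \<in> {0..1::real}. linepath a b t \<in> UNIV} = {0..1}" by auto
  then show ?thesis using edge_len_eq_measure[OF ab(4), of UNIV] ab(1) by simp
qed

lemma edge_bdd_avg:
  assumes "u \<in> ife_space Q G" "E \<in> int_edges G"
  shows "edge_bdd E (edge_avg_beta Q G E (d_nn n) u)"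
proof -
  obtain V W where N: "neighbours G E = (V, W)" by (cases "neighbours G E")
  note N' = int_edge_neighbours[OF assms(2) N]
  show ?thesis
    unfolding edge_avg_beta_def[abs_def] N prod.case
    by (intro edge_bdd_divide edge_bdd_add edge_bdd_mult edge_bdd_beta_side
        edge_bdd_trace[OF assms(1)] N'(1,2) continuous_edge_operators)
qed

section \<open>Bounding the consistency terms by the energy and the penalties, edge by edge\<close>

abbreviation jn :: "cell \<Rightarrow> (real^2 \<Rightarrow> real) \<Rightarrow> real^2 \<Rightarrow> real" where
  "jn E u x \<equiv> edge_jump Q G E (d_n (edge_normal G E)) u x"

abbreviation jnn :: "cell \<Rightarrow> (real^2 \<Rightarrow> real) \<Rightarrow> real^2 \<Rightarrow> real" where
  "jnn E u x \<equiv> edge_jump Q G E (d_nn (edge_normal G E)) u x"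

abbreviation av :: "cell \<Rightarrow> (real^2 \<Rightarrow> real) \<Rightarrow> real^2 \<Rightarrow> real" where
  "av E u x \<equiv> edge_avg_beta Q G E (d_nn (edge_normal G E)) u x"

abbreviation nearA :: "cell \<Rightarrow> (real^2 \<Rightarrow> real) \<Rightarrow> real" where
  "nearA E u \<equiv> \<Sum>T\<in>elems_of E. A_elem u u T"

lemma edge_bdd_jn_jnn:
  assumes "u \<in> ife_space Q G" "E \<in> int_edges G"
  shows "edge_bdd E (jn E u)" "edge_bdd E (jnn E u)"
proof -
  show "edge_bdd E (jn E u)" by (intro edge_bdd_jump assms continuous_edge_operators)
  show "edge_bdd E (jnn E u)" by (intro edge_bdd_jump assms continuous_edge_operators)
qed

text \<open>\<open>K1\<close> belongs to the function whose average is taken, \<open>K2\<close> to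
  the one whose jump is taken. The quotients of \<open>beta_bound\<close> by a penalty parameter
  convert plain squared integrals into penalty terms.\<close>

definition K1 :: real where "K1 = cons_const * (1 + beta_bound / sigma_F Q)"
definition K2 :: real where "K2 = beta_bound / sigma_u Q"

lemma const_nonneg: "0 \<le> cons_const" "0 \<le> K1" "0 \<le> K2"
proof -
  show c: "0 \<le> cons_const"
    unfolding cons_const_def using fat_const_nonneg beta_bound(3) by simp
  show "0 \<le> K1" unfolding K1_def using c beta_bound(3) data_pos(3) by simp
  show "0 \<le> K2" unfolding K2_def using beta_bound(3) data_pos(2) by simp
qed

lemma nearA_nonneg: "u \<in> ife_space Q G \<Longrightarrow> 0 \<le> nearA E u"
  by (intro sum_nonneg A_elem_nonneg) (auto simp: elems_of_def)

text \<open>The Cauchy-Schwarz inequality weighted by the length of the part: the length goes to the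
  average, where the trace bound needs it, and its reciprocal to the jump, where the penalty has it.
  \<open>X\<close> and \<open>Y\<close> stand for the penalty terms of the part, so that cut and
  uncut edges share the argument.\<close>

lemma cs_consistency_part:
  assumes u: "u \<in> ife_space Q G" and v: "v \<in> ife_space Q G" and E: "E \<in> int_edges G" "neighbours G E = (V, W)"
    and S: "S \<in> sets borel" "0 < edge_len E S"
    and fat: "\<And>a b. E = {a, b} \<Longrightarrow>
      (\<exists>T\<in>{V, W}. fat a b (edge_times a b S) T) \<and> j = 1 \<or>
      (\<forall>T\<in>{V, W}. fat a b (edge_times a b S) T) \<and> j = 0"
    and X: "j * (edge_len E S * edge_int E S (\<lambda>x. jnn E u x * jnn E u x)) \<le> beta_bound / sigma_F Q * X"
    and Y: "edge_int E S (\<lambda>x. jn E v x * jn E v x) / edge_len E S \<le> K2 * Y"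
    and X0: "0 \<le> X"
  shows "cs (K1 * (nearA E u + X)) (K2 * Y) (edge_int E S (\<lambda>x. av E u x * jn E v x))"
proof -
  obtain a b where "edge_param E a b" using edge_param_exists[OF card_int_edge[OF E(1)]] by blast
  note ab = edge_paramD[OF this] this
  have "cs (edge_int E S (\<lambda>x. av E u x * av E u x)) (edge_int E S (\<lambda>x. jn E v x * jn E v x))
      (edge_int E S (\<lambda>x. av E u x * jn E v x))"
    by (intro cs_edge_int card_int_edge E(1) S(1) edge_bdd_avg[OF u E(1)] edge_bdd_jn_jnn[OF v E(1)])
  from cs_rescale[OF this S(2)]
  have "cs (edge_len E S * edge_int E S (\<lambda>x. av E u x * av E u x))
      (edge_int E S (\<lambda>x. jn E v x * jn E v x) / edge_len E S)
      (edge_int E S (\<lambda>x. av E u x * jn E v x))" .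
  then show ?thesis
  proof (rule cs_mono[OF _ _ Y])
    have "edge_len E S * edge_int E S (\<lambda>x. av E u x * av E u x) \<le> cons_const * (nearA E u
        + j * (edge_len E S * edge_int E S (\<lambda>x. jnn E u x * jnn E u x)))"
      using average_bound[OF u E S(1) edge_normal_unit[OF E(1)] ab(4) fat[OF ab(2)]] .
    also have "\<dots> \<le> cons_const * (nearA E u + beta_bound / sigma_F Q * X)"
      using X const_nonneg(1) by (intro mult_left_mono add_left_mono)
    also have "\<dots> \<le> cons_const * ((1 + beta_bound / sigma_F Q) * (nearA E u + X))"
    proof (rule mult_left_mono[OF _ const_nonneg(1)])
      have "0 \<le> beta_bound / sigma_F Q * nearA E u"
        using beta_bound(3) data_pos(3) nearA_nonneg[OF u] by (intro mult_nonneg_nonneg) auto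
      then show "nearA E u + beta_bound / sigma_F Q * X \<le> (1 + beta_bound / sigma_F Q) * (nearA E u + X)"
        using X0 unfolding distrib_left distrib_right by linarith
    qed
    finally show "edge_len E S * edge_int E S (\<lambda>x. av E u x * av E u x) \<le> K1 * (nearA E u + X)"
      unfolding K1_def by (simp add: mult.assoc)
  qed
qed

definition cut_dn :: "(real^2 \<Rightarrow> real) \<Rightarrow> cell \<Rightarrow> side \<Rightarrow> real" where
  "cut_dn v E s = sigma_u Q * beta Q s / edge_len E (part G s) *
     edge_int E (part G s) (\<lambda>x. jn E v x * jn E v x)"

definition cut_dnn :: "(real^2 \<Rightarrow> real) \<Rightarrow> cell \<Rightarrow> side \<Rightarrow> real" where
  "cut_dnn u E s = sigma_F Q * edge_len E (part G s) * beta Q s *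
     edge_int E (part G s) (\<lambda>x. jnn E u x * jnn E u x)"

definition uncut_dn :: "(real^2 \<Rightarrow> real) \<Rightarrow> cell \<Rightarrow> real" where
  "uncut_dn v E = sigma_u Q / edge_len E UNIV *
     edge_int E UNIV (\<lambda>x. beta_at Q G x * jn E v x * jn E v x)"

definition uncut_dnn :: "(real^2 \<Rightarrow> real) \<Rightarrow> cell \<Rightarrow> real" where
  "uncut_dnn u E = sigma_F Q * edge_len E UNIV *
     edge_int E UNIV (\<lambda>x. beta_at Q G x * jnn E u x * jnn E u x)"

lemma pen_sums:
  "pen_dn_cut Q G v v = (\<Sum>E\<in>int_edges_cut G. \<Sum>s\<in>{Pos, Neg}. cut_dn v E s)"
  "pen_dnn_cut Q G v v = (\<Sum>E\<in>int_edges_cut G. \<Sum>s\<in>{Pos, Neg}. cut_dnn v E s)"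
  "pen_dn_uncut Q G v v = (\<Sum>E\<in>int_edges_uncut G. uncut_dn v E)"
  "pen_dnn_uncut Q G v v = (\<Sum>E\<in>int_edges_uncut G \<inter> iface_elem_edges G. uncut_dnn v E)"
  unfolding pen_dn_cut_def pen_dnn_cut_def pen_dn_uncut_def pen_dnn_uncut_def
    cut_dn_def cut_dnn_def uncut_dn_def uncut_dnn_def Let_def by (rule refl)+

lemma edge_int_square_nonneg:
  assumes "card E = 2" "S \<in> sets borel" "edge_bdd E f"
  shows "0 \<le> edge_int E S (\<lambda>x. f x * f x)"
  using cs_nonneg[OF cs_edge_int[OF assms(1,2,3,3)]] .

lemma le_beta_bound_mult:
  assumes "0 \<le> y" "1 / beta_bound * y \<le> z" "0 < \<sigma>"
  shows "y \<le> beta_bound / \<sigma> * (\<sigma> * z)"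
  using assms beta_bound(3) by (simp add: field_simps)

lemma cs_consistency_cut:
  assumes u: "u \<in> ife_space Q G" and v: "v \<in> ife_space Q G" and E: "E \<in> int_edges G" "is_cut G E"
  shows "cs (K1 * (nearA E u + cut_dnn u E s)) (K2 * cut_dn v E s)
    (edge_int E (part G s) (\<lambda>x. av E u x * jn E v x))"
proof -
  obtain V W where N: "neighbours G E = (V, W)" by (cases "neighbours G E")
  let ?S = "part G s"
  have S: "?S \<in> sets borel" using open_part by simp
  note E2 = card_int_edge[OF E(1)]
  have l: "0 < edge_len E ?S" by (rule cut_edge_len_pos[OF E])
  have n1: "0 \<le> edge_int E ?S (\<lambda>x. jnn E u x * jnn E u x)"
    by (intro edge_int_square_nonneg E2 S edge_bdd_jn_jnn[OF u E(1)])
  have n2: "0 \<le> edge_int E ?S (\<lambda>x. jn E v x * jn E v x)"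
    by (intro edge_int_square_nonneg E2 S edge_bdd_jn_jnn[OF v E(1)])
  show ?thesis
  proof (rule cs_consistency_part[OF u v E(1) N S l, where j = 1])
    fix a b assume ab: "E = {a, b}"
    show "(\<exists>T\<in>{V, W}. fat a b (edge_times a b ?S) T) \<and> (1::real) = 1 \<or>
      (\<forall>T\<in>{V, W}. fat a b (edge_times a b ?S) T) \<and> (1::real) = 0"
      using cut_edge_fat[OF E(1) N ab E(2), of s] by simp
  next
    let ?y = "edge_len E ?S * edge_int E ?S (\<lambda>x. jnn E u x * jnn E u x)"
    have y: "0 \<le> ?y" using l n1 by simp
    then have "1 / beta_bound * ?y \<le> beta Q s * ?y" using beta_bound(2) by (intro mult_right_mono)
    from le_beta_bound_mult[OF y this data_pos(3)]
    show "1 * ?y \<le> beta_bound / sigma_F Q * cut_dnn u E s"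
      unfolding cut_dnn_def by (simp add: mult_ac)
    show "0 \<le> cut_dnn u E s"
      unfolding cut_dnn_def using l n1 data_pos(1)[of s] data_pos(3) by (intro mult_nonneg_nonneg) auto
  next
    let ?y = "edge_int E ?S (\<lambda>x. jn E v x * jn E v x) / edge_len E ?S"
    have y: "0 \<le> ?y" using l n2 by simp
    then have "1 / beta_bound * ?y \<le> beta Q s * ?y" using beta_bound(2) by (intro mult_right_mono)
    from le_beta_bound_mult[OF y this data_pos(2)]
    show "?y \<le> K2 * cut_dn v E s"
      unfolding cut_dn_def K2_def by (simp add: mult_ac)
  qed
qed

text \<open>The penalty on second normal derivatives is summed over edges of interface elements
  only, hence the case distinction; at all other edges both neighbours are fat and the jump drops
  out.\<close>

lemma cs_consistency_uncut:
  assumes u: "u \<in> ife_space Q G" and v: "v \<in> ife_space Q G" and E: "E \<in> int_edges G" "\<not> is_cut G E"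
  shows "cs (K1 * (nearA E u + (if E \<in> iface_elem_edges G then uncut_dnn u E else 0))) (K2 * uncut_dn v E)
    (edge_int E UNIV (\<lambda>x. av E u x * jn E v x))"
proof -
  obtain V W where N: "neighbours G E = (V, W)" by (cases "neighbours G E")
  have S: "UNIV \<in> sets borel" by simp
  have J: "{t \<in> {0..1::real}. linepath a b t \<in> UNIV} = {0..1}" for a b :: "real^2" by auto
  note E2 = card_int_edge[OF E(1)]
  have l: "0 < edge_len E UNIV" by (rule edge_len_pos[OF E(1)])
  have weight: "1 / beta_bound * edge_int E UNIV (\<lambda>x. f x * f x) \<le> edge_int E UNIV (\<lambda>x. beta_at Q G x * f x * f x)"
    if "edge_bdd E f" for f
  proof -
    have "1 / beta_bound * edge_int E UNIV (\<lambda>x. f x * f x) = edge_int E UNIV (\<lambda>x. 1 / beta_bound * (f x * f x))"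
      by (rule edge_int_cmult[OF E2, symmetric])
    also have "\<dots> \<le> edge_int E UNIV (\<lambda>x. beta_at Q G x * f x * f x)"
    proof (intro edge_int_mono E2 S edge_bdd_mult edge_bdd_const edge_bdd_beta_at that)
      show "1 / beta_bound * (f x * f x) \<le> beta_at Q G x * f x * f x" for x
        unfolding mult.assoc by (intro mult_right_mono beta_at_ge) simp
    qed
    finally show ?thesis .
  qed
  have n1: "0 \<le> edge_int E UNIV (\<lambda>x. jnn E u x * jnn E u x)"
    by (intro edge_int_square_nonneg E2 S edge_bdd_jn_jnn[OF u E(1)])
  have n2: "0 \<le> edge_int E UNIV (\<lambda>x. jn E v x * jn E v x)"
    by (intro edge_int_square_nonneg E2 S edge_bdd_jn_jnn[OF v E(1)])
  note w1 = weight[OF edge_bdd_jn_jnn(2)[OF u E(1)]] and w2 = weight[OF edge_bdd_jn_jnn(1)[OF v E(1)]]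
  have n3: "0 \<le> edge_int E UNIV (\<lambda>x. beta_at Q G x * jnn E u x * jnn E u x)"
    using w1 n1 beta_bound(3) by (meson divide_nonneg_pos mult_nonneg_nonneg order_trans zero_le_one)
  let ?j = "if E \<in> iface_elem_edges G then 1 else 0 :: real"
  let ?X = "if E \<in> iface_elem_edges G then uncut_dnn u E else 0"
  show ?thesis
  proof (rule cs_consistency_part[OF u v E(1) N S l, where j = ?j])
    fix a b assume ab: "E = {a, b}"
    show "(\<exists>T\<in>{V, W}. fat a b (edge_times a b UNIV) T) \<and> ?j = 1 \<or>
      (\<forall>T\<in>{V, W}. fat a b (edge_times a b UNIV) T) \<and> ?j = 0"
      unfolding J using uncut_edge_fat[OF E(1) N ab E(2)] uncut_edge_off_interface_fat[OF E(1) N ab]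
      by (cases "E \<in> iface_elem_edges G") auto
  next
    let ?y = "edge_len E UNIV * edge_int E UNIV (\<lambda>x. jnn E u x * jnn E u x)"
    have y: "0 \<le> ?y" using l n1 by simp
    have "1 / beta_bound * ?y \<le> edge_len E UNIV * edge_int E UNIV (\<lambda>x. beta_at Q G x * jnn E u x * jnn E u x)"
      using mult_left_mono[OF w1 less_imp_le[OF l]] by (simp add: mult_ac)
    from le_beta_bound_mult[OF y this data_pos(3)]
    show "?j * ?y \<le> beta_bound / sigma_F Q * ?X"
      unfolding uncut_dnn_def by (simp add: mult.assoc)
    show "0 \<le> ?X"
      unfolding uncut_dnn_def using l n3 data_pos(3) by simp
  next
    let ?y = "edge_int E UNIV (\<lambda>x. jn E v x * jn E v x) / edge_len E UNIV"
    have y: "0 \<le> ?y" using l n2 by simp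
    have "1 / beta_bound * ?y \<le> edge_int E UNIV (\<lambda>x. beta_at Q G x * jn E v x * jn E v x) / edge_len E UNIV"
      using divide_right_mono[OF w2 less_imp_le[OF l]] by simp
    from le_beta_bound_mult[OF y this data_pos(2)]
    show "?y \<le> K2 * uncut_dn v E"
      unfolding uncut_dn_def K2_def by simp
  qed
qed

text \<open>The factor 6 is two times three: a cut edge draws on the energy of its neighbours once
  for each side, and every element has three edges.\<close>

lemma cs_consistency:
  assumes u: "u \<in> ife_space Q G" and v: "v \<in> ife_space Q G"
  shows "cs (K1 * (6 * A_h Q G u u + pen_dnn_cut Q G u u + pen_dnn_uncut Q G u u))
    (K2 * (pen_dn_cut Q G v v + pen_dn_uncut Q G v v)) (consistency Q G u v)"
proof -
  let ?c = "\<lambda>E. edge_int E UNIV (\<lambda>x. av E u x * jn E v x)"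
  let ?X = "\<lambda>E. if E \<in> iface_elem_edges G then uncut_dnn u E else 0"
  have un: "int_edges G = int_edges_cut G \<union> int_edges_uncut G" "int_edges_cut G \<inter> int_edges_uncut G = {}"
    unfolding int_edges_cut_def int_edges_uncut_def by auto
  have fin: "finite (int_edges_cut G)" "finite (int_edges_uncut G)"
    using finite_int_edges un(1) by auto
  have cut: "cs (K1 * (2 * nearA E u + (\<Sum>s\<in>{Pos, Neg}. cut_dnn u E s)))
      (K2 * (\<Sum>s\<in>{Pos, Neg}. cut_dn v E s)) (?c E)" if "E \<in> int_edges_cut G" for E
  proof -
    have E: "E \<in> int_edges G" "is_cut G E" using that unfolding int_edges_cut_def by auto
    have "edge_bdd E (\<lambda>x. av E u x * jn E v x)"
      by (intro edge_bdd_mult edge_bdd_avg[OF u E(1)] edge_bdd_jn_jnn[OF v E(1)])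
    from cut_edge_int_split[OF E this]
    have c: "?c E = (\<Sum>s\<in>{Pos, Neg}. edge_int E (part G s) (\<lambda>x. av E u x * jn E v x))" .
    have "cs (\<Sum>s\<in>{Pos, Neg}. K1 * (nearA E u + cut_dnn u E s)) (\<Sum>s\<in>{Pos, Neg}. K2 * cut_dn v E s) (?c E)"
      unfolding c by (intro cs_sum cs_consistency_cut u v E)
    moreover have "(\<Sum>s\<in>{Pos, Neg}. K1 * (nearA E u + cut_dnn u E s))
        = K1 * (2 * nearA E u + (\<Sum>s\<in>{Pos, Neg}. cut_dnn u E s))"
      by (simp add: distrib_left)
    moreover have "(\<Sum>s\<in>{Pos, Neg}. K2 * cut_dn v E s) = K2 * (\<Sum>s\<in>{Pos, Neg}. cut_dn v E s)"
      by (rule sum_distrib_left[symmetric])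
    ultimately show ?thesis by metis
  qed
  have uncut: "cs (K1 * (nearA E u + ?X E)) (K2 * uncut_dn v E) (?c E)" if "E \<in> int_edges_uncut G" for E
    using that unfolding int_edges_uncut_def by (intro cs_consistency_uncut u v) auto
  have 1: "cs (K1 * (2 * (\<Sum>E\<in>int_edges_cut G. nearA E u) + pen_dnn_cut Q G u u))
      (K2 * pen_dn_cut Q G v v) (\<Sum>E\<in>int_edges_cut G. ?c E)"
    using cs_sum[OF cut, of "int_edges_cut G" "\<lambda>E. E"]
    unfolding pen_sums sum_distrib_left[symmetric] sum.distrib by blast
  have 2: "cs (K1 * ((\<Sum>E\<in>int_edges_uncut G. nearA E u) + pen_dnn_uncut Q G u u))
      (K2 * pen_dn_uncut Q G v v) (\<Sum>E\<in>int_edges_uncut G. ?c E)"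
    using cs_sum[OF uncut, of "int_edges_uncut G" "\<lambda>E. E"]
    unfolding pen_sums sum_distrib_left[symmetric] sum.distrib sum.inter_restrict[OF fin(2)] by blast
  have c: "consistency Q G u v = (\<Sum>E\<in>int_edges_cut G. ?c E) + (\<Sum>E\<in>int_edges_uncut G. ?c E)"
    unfolding consistency_def Let_def un(1) by (rule sum.union_disjoint[OF fin un(2)])
  have A: "(\<Sum>E\<in>int_edges_cut G. nearA E u) + (\<Sum>E\<in>int_edges_uncut G. nearA E u) \<le> 3 * A_h Q G u u"
    using sum_over_edges_le[OF u] unfolding un(1) sum.union_disjoint[OF fin un(2)] .
  have A0: "0 \<le> (\<Sum>E\<in>int_edges_uncut G. nearA E u)" by (intro sum_nonneg nearA_nonneg[OF u])
  show ?thesis unfolding c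
  proof (rule cs_mono[OF cs_add[OF 1 2]])
    show "K1 * (2 * (\<Sum>E\<in>int_edges_cut G. nearA E u) + pen_dnn_cut Q G u u)
       + K1 * ((\<Sum>E\<in>int_edges_uncut G. nearA E u) + pen_dnn_uncut Q G u u)
       \<le> K1 * (6 * A_h Q G u u + pen_dnn_cut Q G u u + pen_dnn_uncut Q G u u)"
      unfolding distrib_left[symmetric] using A A0 by (intro mult_left_mono const_nonneg(2)) linarith
  qed (simp add: distrib_left)
qed

section \<open>Assembling the continuity estimate\<close>

definition norm_sq :: "(real^2 \<Rightarrow> real) \<Rightarrow> real" where
  "norm_sq v = A_h Q G v v
     + pen_dn_uncut Q G v v + pen_dn_iface Q G v v + pen_dn_cut Q G v v
     + pen_dnn_uncut Q G v v + pen_dnn_cut Q G v v + pen_cut Q G v v + pen_iface Q G v v"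

text \<open>The summand 1 pays for the forms shared with the norm; \<open>6 * K1\<close> and
  \<open>K2\<close> pay for the consistency terms with the two orders of the arguments.\<close>

definition cont_const :: real where "cont_const = 6 * K1 + K2 + 1"

lemma a_h_continuous:
  assumes u: "u \<in> ife_space Q G" and v: "v \<in> ife_space Q G"
  shows "a_h Q G u v \<le> cont_const * norm_h Q G u * norm_h Q G v"
proof -
  have pos: "0 \<le> A_h Q G w w" "0 \<le> pen_dn_uncut Q G w w" "0 \<le> pen_dn_iface Q G w w" "0 \<le> pen_dn_cut Q G w w"
    "0 \<le> pen_dnn_uncut Q G w w" "0 \<le> pen_dnn_cut Q G w w" "0 \<le> pen_cut Q G w w" "0 \<le> pen_iface Q G w w"
    if "w \<in> ife_space Q G" for w
    using cs_A_h cs_pen_edges cs_pen_dn_iface cs_pen_iface that by (blast intro: cs_nonneg)+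
  have N0: "0 \<le> norm_sq w" if "w \<in> ife_space Q G" for w
    unfolding norm_sq_def using pos[OF that] by (intro add_nonneg_nonneg)
  have cons: "cs (6 * K1 * norm_sq u) (K2 * norm_sq v) (consistency Q G u v)"
    if u: "u \<in> ife_space Q G" and v: "v \<in> ife_space Q G" for u v
  proof (rule cs_mono[OF cs_consistency[OF u v]])
    have "6 * A_h Q G u u + pen_dnn_cut Q G u u + pen_dnn_uncut Q G u u \<le> 6 * norm_sq u"
      unfolding norm_sq_def using pos[OF u] by simp
    then show "K1 * (6 * A_h Q G u u + pen_dnn_cut Q G u u + pen_dnn_uncut Q G u u) \<le> 6 * K1 * norm_sq u"
      using mult_left_mono[OF _ const_nonneg(2)] by (fastforce simp: mult_ac)
    show "K2 * (pen_dn_cut Q G v v + pen_dn_uncut Q G v v) \<le> K2 * norm_sq v"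
      unfolding norm_sq_def using pos[OF v] by (intro mult_left_mono const_nonneg(3)) simp
  qed
  have rest: "cs (norm_sq u) (norm_sq v) (A_h Q G u v
     + pen_dn_uncut Q G u v + pen_dn_iface Q G u v + pen_dn_cut Q G u v
     + pen_dnn_uncut Q G u v + pen_dnn_cut Q G u v + pen_cut Q G u v + pen_iface Q G u v)"
    unfolding norm_sq_def
    by (intro cs_add cs_A_h cs_pen_edges cs_pen_dn_iface cs_pen_iface u v)
  \<comment> \<open>Swapping the factors in the second consistency term exchanges the roles of
    \<open>6 * K1\<close> and \<open>K2\<close>, so both arguments end up with the same total
    constant.\<close>
  have "cs (norm_sq u + 6 * K1 * norm_sq u + K2 * norm_sq u) (norm_sq v + K2 * norm_sq v + 6 * K1 * norm_sq v)
     (A_h Q G u v + pen_dn_uncut Q G u v + pen_dn_iface Q G u v + pen_dn_cut Q G u v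
     + pen_dnn_uncut Q G u v + pen_dnn_cut Q G u v + pen_cut Q G u v + pen_iface Q G u v
     + - consistency Q G u v + - consistency Q G v u)"
    by (intro cs_add[OF cs_add[OF rest]] cs_uminus cons[OF u v] cs_commute[OF cons[OF v u]])
  moreover have "norm_sq u + 6 * K1 * norm_sq u + K2 * norm_sq u = cont_const * norm_sq u"
    "norm_sq v + K2 * norm_sq v + 6 * K1 * norm_sq v = cont_const * norm_sq v"
    unfolding cont_const_def by (simp_all add: algebra_simps)
  ultimately have "cs (cont_const * norm_sq u) (cont_const * norm_sq v) (a_h Q G u v)"
    unfolding a_h_def J_hu_def J_hn_def by (simp add: algebra_simps)
  moreover have C: "0 \<le> cont_const" unfolding cont_const_def using const_nonneg by simp
  ultimately have "a_h Q G u v \<le> sqrt (cont_const * norm_sq u) * sqrt (cont_const * norm_sq v)"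
    using N0[OF u] N0[OF v] by (intro cs_imp_le_sqrt) auto
  also have "\<dots> = cont_const * norm_h Q G u * norm_h Q G v"
  proof -
    have "sqrt cont_const * x * (sqrt cont_const * y) = (sqrt cont_const * sqrt cont_const) * x * y" for x y
      by simp
    then show ?thesis
      unfolding norm_h_def norm_sq_def[symmetric] real_sqrt_mult using C by simp
  qed
  finally show ?thesis .
qed

end

theorem theorem4p1:
  fixes Q :: fem_data and \<kappa> :: real
  assumes "deg Q \<in> {2, 3}"
    and "admissible_data Q"
  shows "\<exists>C::real. \<forall>G. admissible \<kappa> Q G \<longrightarrow>
           (\<forall>u\<in>ife_space Q G. \<forall>v\<in>ife_space Q G.
              a_h Q G u v \<le> C * norm_h Q G u * norm_h Q G v)"
proof (intro exI allI impI ballI)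
  fix G u v
  assume "admissible \<kappa> Q G"
  then interpret admissible_mesh \<kappa> Q G using assms by unfold_locales
  assume "u \<in> ife_space Q G" "v \<in> ife_space Q G"
  \<comment> \<open>The constant is a function of \<kappa> and \<open>Q\<close> alone and does not
    involve \<open>G\<close>; this is the uniformity over meshes and interfaces.\<close>
  then show "a_h Q G u v \<le> admissible_mesh.cont_const \<kappa> Q * norm_h Q G u * norm_h Q G v"
    by (rule a_h_continuous)
qed

end
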